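(* Let $n\ge2$, $q\in(1,2)$, $p=q/(q-1)$, $\alpha\in(0,1)$, and let $\Omega\subset\mathbb{R}^n$ be a bounded connected open set with Lipschitz boundary. Let $f\in L^p(\Omega)$ with $\int_\Omega f\,dx=0$, and let $\sigma_0\in L^p(\Omega,\mathbb{R}^n)$ be the solution of the problem $$(\mathrm{P1})\qquad \inf_{\sigma\in L^p(\Omega,\mathbb{R}^n)}\left\{\int_\Omega\left(\tfrac1p|\sigma|^p+|\sigma|\right)dx:\ -\mathrm{div}\,\sigma=f \text{ in }\Omega,\ \langle\sigma,\nu\rangle=0\text{ on }\partial\Omega\right\}.$$ Then the following implications hold: $$f\in W^{1,p}_{loc}(\Omega)\ \Rightarrow\ \sigma_0\in B^{\frac{2}{p(3-q)}}_{p,\infty,loc}(\Omega),$$ $$f\in B^{\alpha}_{p,\infty,loc}(\Omega)\ \Rightarrow\ \sigma_0\in B^{\min\{\frac{\alpha+1}{p},\frac{2}{p(3-q)}\}}_{p,\infty,loc}(\Omega).$$ Furthermore: (a) If $f\in W^{1,p}_{loc}(\Omega)$, then for every solution $u$ of the problem $$(\mathrm{P2})\qquad \sup_{u\in W^{1,q}(\Omega)}\left\{\int_\Omega uf\,dx-\int_\Omega\tfrac1q(|\nabla u|-1)_+^q\,dx\right\}$$ and every ball $B_R\Subset\Omega$ of radius $R$, with $B_{R/2}$ the concentric ball of radius $R/2$, the estimate $$\int_{B_{R/2}}|\tau_{s,h}\sigma_0-\sigma_0|^p\,dx\le C_1\left(\|\nabla f\|_{L^p(B')}\|\nabla u\|_{L^q(B')}|h|^2+\|\nabla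 u\|^q_{L^q(B')}|h|^{\frac{2}{3-q}}\right)$$ holds for every $s\in\{1,\dots,n\}$ and every $h\in\mathbb{R}$ with $|h|\le r_0<\frac12\mathrm{dist}(B_R,\partial\Omega)$, where $B'=B_R+B(0,r_0)$ and $C_1=C_1(R,q,n)$ is a positive constant depending only on $R,q,n$. (b) If $f\in B^\alpha_{p,\infty,loc}(\Omega)$, then for every solution $u$ of $(\mathrm{P2})$ and every ball $B_R\Subset\Omega$ of radius $R$, the estimate $$\int_{B_{R/2}}|\tau_{s,h}\sigma_0-\sigma_0|^p\,dx\le C_2\left(\|f\|_{B^\alpha_{p,\infty}(B')}\|\nabla u\|_{L^q(B')}|h|^{\alpha+1}+\|\nabla u\|^q_{L^q(B')}|h|^{\frac{2}{3-q}}\right)$$ holds for every $s\in\{1,\dots,n\}$ and every $h\in\mathbb{R}$ with $|h|\le r_0<\frac12\mathrm{dist}(B_R,\partial\Omega)$, where $B'=B_R+B(0,r_0)$ and $C_2=C_2(R,q,n)$ is a positive constant depending only on $R,q,n$.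
   Context: Notation. $(\cdot)_+$ is the positive part; $\nu$ is the outer normal on $\partial\Omega$. The constraint in (P1) is meant in the weak sense: $\int_\Omega\langle\sigma,\nabla\varphi\rangle\,dx=\int_\Omega f\varphi\,dx$ for all $\varphi\in W^{1,q}(\Omega)$. The infimum in (P1) is assumed finite, so that (P1) has exactly one solution. The function $z\mapsto\frac1q(|z|-1)_+^q$ is the Legendre transform of $\sigma\mapsto\frac1p|\sigma|^p+|\sigma|$, and (P2) is the convex dual of (P1). Shift: $\tau_{s,h}F(x)=F(x+he_s)$, where $e_s$ is the unit vector in the $x_s$ direction. Besov spaces: for $0<\beta<1$, $1\le m<\infty$, $v\in B^\beta_{m,\infty}(\mathbb{R}^n)$ means $v\in L^m(\mathbb{R}^n)$ and $[v]_{\dot B^\beta_{m,\infty}(\mathbb{R}^n)}=\sup_{h\in\mathbb{R}^n\setminus\{0\}}\left(\int_{\mathbb{R}^n}\frac{|v(x+h)-v(x)|^m}{|h|^{\beta m}}dx\right)^{1/m}<\infty$. $v\in B^\beta_{m,\infty,loc}(\Omega)$ means $\varphi v\in B^\beta_{m,\infty}(\mathbb{R}^n)$ for every $\varphi\in C_c^\infty(\Omega)$ (componentwise for vector-valued $v$). On a ball $B'$, $\|v\|_{B^\beta_{m,\infty}(B')}=\|v\|_{L^m(B')}+[v]_{\dot B^\beta_{m,\infty}(B')}$, where the seminorm on $B'$ is $\sup_{h\ne0}\left(\int_{\{x\in B':\,x+h\in B'\}}\frac{|v(x+h)-v(x)|^m}{|h|^{\beta m}}dx\right)^{1/m}$.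 *)

theory Defs
  imports "HOL-Analysis.Analysis"
begin

section \<open>Lebesgue spaces\<close>

(* Elements of function spaces are genuine functions on the whole type; only their values on S
   matter, and only up to null sets. *)

definition Lp :: "real \<Rightarrow> 'a::euclidean_space set \<Rightarrow> ('a \<Rightarrow> 'b::real_normed_vector) set" where
  "Lp p S = {f. f \<in> borel_measurable (lebesgue_on S)
                \<and> integrable (lebesgue_on S) (\<lambda>x. norm (f x) powr p)}"

definition Lp_norm :: "real \<Rightarrow> 'a::euclidean_space set \<Rightarrow> ('a \<Rightarrow> 'b::real_normed_vector) \<Rightarrow> real" where
  "Lp_norm p S f = (\<integral>x. norm (f x) powr p \<partial>lebesgue_on S) powr (1 / p)"

definition locally_integrable_on ::
    "('a::euclidean_space \<Rightarrow> 'b::{banach, second_countable_topology}) \<Rightarrow> 'a set \<Rightarrow> bool"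
    (infix "locally'_integrable'_on" 50) where
  "f locally_integrable_on S \<longleftrightarrow> (\<forall>K. compact K \<and> K \<subseteq> S \<longrightarrow> integrable (lebesgue_on K) f)"


section \<open>Test functions\<close>

definition partial_deriv :: "'n \<Rightarrow> (real^'n::finite \<Rightarrow> real) \<Rightarrow> real^'n \<Rightarrow> real" where
  "partial_deriv i \<phi> x = frechet_derivative \<phi> (at x) (axis i 1)"

primrec C_diff :: "nat \<Rightarrow> (real^'n::finite \<Rightarrow> real) \<Rightarrow> bool" where
  "C_diff 0 \<phi> \<longleftrightarrow> continuous_on UNIV \<phi>"
| "C_diff (Suc k) \<phi> \<longleftrightarrow>
     (\<forall>x. \<phi> differentiable (at x)) \<and> (\<forall>i. C_diff k (partial_deriv i \<phi>))"

(* C_c^\<infinity>(\<Omega>), each element extended by zero to the whole space. *)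
definition test_function :: "(real^'n::finite) set \<Rightarrow> (real^'n \<Rightarrow> real) set" where
  "test_function \<Omega> = {\<phi>. (\<forall>k. C_diff k \<phi>)
      \<and> compact (closure {x. \<phi> x \<noteq> 0}) \<and> closure {x. \<phi> x \<noteq> 0} \<subseteq> \<Omega>}"


section \<open>Weak gradients and Sobolev spaces\<close>

definition has_weak_gradient ::
    "(real^'n::finite) set \<Rightarrow> (real^'n \<Rightarrow> real) \<Rightarrow> (real^'n \<Rightarrow> real^'n) \<Rightarrow> bool" where
  "has_weak_gradient \<Omega> u G \<longleftrightarrow>
     u locally_integrable_on \<Omega> \<and> G locally_integrable_on \<Omega> \<and>
     (\<forall>\<phi>\<in>test_function \<Omega>. \<forall>i.
        (\<integral>x. u x * partial_deriv i \<phi> x \<partial>lebesgue_on \<Omega>)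
          = - (\<integral>x. (G x $ i) * \<phi> x \<partial>lebesgue_on \<Omega>))"

(* A chosen representative: the weak gradient is unique up to null sets of the open set \<Omega>.
   It is meaningful only if u has a weak gradient. *)
definition weak_gradient ::
    "(real^'n::finite) set \<Rightarrow> (real^'n \<Rightarrow> real) \<Rightarrow> real^'n \<Rightarrow> real^'n" where
  "weak_gradient \<Omega> u = (SOME G. has_weak_gradient \<Omega> u G)"

definition W1 :: "real \<Rightarrow> (real^'n::finite) set \<Rightarrow> (real^'n \<Rightarrow> real) set" where
  "W1 q \<Omega> = {u \<in> Lp q \<Omega>. \<exists>G \<in> Lp q \<Omega>. has_weak_gradient \<Omega> u G}"

definition W1_loc :: "real \<Rightarrow> (real^'n::finite) set \<Rightarrow> (real^'n \<Rightarrow> real) set" where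
  "W1_loc p \<Omega> = {u. \<exists>G. has_weak_gradient \<Omega> u G \<and>
      (\<forall>K. compact K \<and> K \<subseteq> \<Omega> \<longrightarrow> u \<in> Lp p K \<and> G \<in> Lp p K)}"


section \<open>Besov spaces\<close>

definition besov_quotient ::
    "real \<Rightarrow> real \<Rightarrow> 'a::euclidean_space set \<Rightarrow> ('a \<Rightarrow> 'b::real_normed_vector) \<Rightarrow> 'a \<Rightarrow> real" where
  "besov_quotient \<beta> m S v h =
     (\<integral>x. norm (v (x + h) - v x) powr m / norm h powr (\<beta> * m)
        \<partial>lebesgue_on {x \<in> S. x + h \<in> S}) powr (1 / m)"

(* The real-valued supremum is meaningful only if the quotients are bounded. *)
definition besov_seminorm ::
    "real \<Rightarrow> real \<Rightarrow> 'a::euclidean_space set \<Rightarrow> ('a \<Rightarrow> 'b::real_normed_vector) \<Rightarrow> real" where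
  "besov_seminorm \<beta> m S v = (SUP h\<in>UNIV - {0}. besov_quotient \<beta> m S v h)"

definition besov_norm ::
    "real \<Rightarrow> real \<Rightarrow> 'a::euclidean_space set \<Rightarrow> ('a \<Rightarrow> 'b::real_normed_vector) \<Rightarrow> real" where
  "besov_norm \<beta> m S v = Lp_norm m S v + besov_seminorm \<beta> m S v"

(* B^\<beta>_{m,\<infinity>}(R^n): boundedness of the quotients says that the seminorm is finite. *)
definition besov :: "real \<Rightarrow> real \<Rightarrow> ('a::euclidean_space \<Rightarrow> 'b::real_normed_vector) set" where
  "besov \<beta> m = {v \<in> Lp m UNIV. bdd_above (besov_quotient \<beta> m UNIV v ` (UNIV - {0}))}"

definition besov_loc :: "real \<Rightarrow> real \<Rightarrow> (real^'n::finite) set \<Rightarrow> (real^'n \<Rightarrow> real) set" where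
  "besov_loc \<beta> m \<Omega> = {v. \<forall>\<phi>\<in>test_function \<Omega>. (\<lambda>x. \<phi> x * v x) \<in> besov \<beta> m}"

definition besov_loc_vec :: "real \<Rightarrow> real \<Rightarrow> (real^'n::finite) set \<Rightarrow> (real^'n \<Rightarrow> real^'k) set" where
  "besov_loc_vec \<beta> m \<Omega> = {v. \<forall>i. (\<lambda>x. v x $ i) \<in> besov_loc \<beta> m \<Omega>}"


section \<open>Domains and shifts\<close>

(* Near each boundary point, \<Omega> is the part strictly on one side of the graph of a Lipschitz
   function of the n - 1 coordinates orthogonal to some direction e. The hyperplane orthogonal
   to e is parametrised by the orthogonal projection y - (y \<bullet> e) e, so only the values of g on that
   hyperplane are used; composing with this projection extends any Lipschitz function on the
   hyperplane to the whole space. *)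
definition lipschitz_boundary :: "(real^'n::finite) set \<Rightarrow> bool" where
  "lipschitz_boundary \<Omega> \<longleftrightarrow>
     (\<forall>x\<in>frontier \<Omega>. \<exists>r>0. \<exists>e. \<exists>L. \<exists>g :: real^'n \<Rightarrow> real.
        norm e = 1 \<and> L-lipschitz_on UNIV g \<and>
        \<Omega> \<inter> ball x r = {y \<in> ball x r. y \<bullet> e > g (y - (y \<bullet> e) *\<^sub>R e)})"

definition shift :: "'n \<Rightarrow> real \<Rightarrow> (real^'n::finite \<Rightarrow> 'b) \<Rightarrow> real^'n \<Rightarrow> 'b" where
  "shift s h F x = F (x + h *\<^sub>R axis s 1)"


section \<open>The two variational problems\<close>

(* -div \<sigma> = f in \<Omega> with zero normal trace, in the weak sense. *)
definition P1_admissible ::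
    "real \<Rightarrow> (real^'n::finite) set \<Rightarrow> (real^'n \<Rightarrow> real) \<Rightarrow> (real^'n \<Rightarrow> real^'n) \<Rightarrow> bool" where
  "P1_admissible q \<Omega> f \<sigma> \<longleftrightarrow> \<sigma> \<in> Lp (q / (q - 1)) \<Omega> \<and>
     (\<forall>\<phi>\<in>W1 q \<Omega>. (\<integral>x. \<sigma> x \<bullet> weak_gradient \<Omega> \<phi> x \<partial>lebesgue_on \<Omega>)
                    = (\<integral>x. f x * \<phi> x \<partial>lebesgue_on \<Omega>))"

definition P1_energy :: "real \<Rightarrow> (real^'n::finite) set \<Rightarrow> (real^'n \<Rightarrow> real^'n) \<Rightarrow> real" where
  "P1_energy p \<Omega> \<sigma> = (\<integral>x. norm (\<sigma> x) powr p / p + norm (\<sigma> x) \<partial>lebesgue_on \<Omega>)"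

(* On a bounded \<Omega> the energy of every admissible field is finite, so the existence of an
   admissible field (implied here) is the same as finiteness of the infimum. *)
definition P1_solution ::
    "real \<Rightarrow> (real^'n::finite) set \<Rightarrow> (real^'n \<Rightarrow> real) \<Rightarrow> (real^'n \<Rightarrow> real^'n) \<Rightarrow> bool" where
  "P1_solution q \<Omega> f \<sigma> \<longleftrightarrow>
     is_arg_min (P1_energy (q / (q - 1)) \<Omega>) (P1_admissible q \<Omega> f) \<sigma>"

definition P2_functional ::
    "real \<Rightarrow> (real^'n::finite) set \<Rightarrow> (real^'n \<Rightarrow> real) \<Rightarrow> (real^'n \<Rightarrow> real) \<Rightarrow> real" where
  "P2_functional q \<Omega> f u =
     (\<integral>x. u x * f x \<partial>lebesgue_on \<Omega>)
     - (\<integral>x. max 0 (norm (weak_gradient \<Omega> u x) - 1) powr q / q \<partial>lebesgue_on \<Omega>)"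

definition P2_solution ::
    "real \<Rightarrow> (real^'n::finite) set \<Rightarrow> (real^'n \<Rightarrow> real) \<Rightarrow> (real^'n \<Rightarrow> real) \<Rightarrow> bool" where
  "P2_solution q \<Omega> f u \<longleftrightarrow> is_arg_max (P2_functional q \<Omega> f) (\<lambda>u. u \<in> W1 q \<Omega>) u"

end

theory Submission
  imports Defs
begin

text \<open>
  Put \<open>H(s) = |s|^p / p + |s|\<close>, let \<open>H\<^sup>*(z) = (|z| - 1)\<^sub>+^q / q\<close> be its conjugate, and let
  \<open>F = \<nabla>H\<^sup>*\<close>; these are \<open>energy\<close>, \<open>conj_energy\<close> and \<open>flux\<close> below.
  Formally, the optimality conditions say that the minimiser of the primal problem is \<open>\<sigma> = F(\<nabla>u)\<close> with \<open>u\<close> a maximiser of the dual problem, and all the regularity of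
  \<open>\<sigma>\<close> comes from the \<open>p\<close>-uniform convexity of \<open>H\<close> (\<open>energy_uniformly_convex\<close>). Its symmetric
  form is the monotonicity estimate
  \<open>2c |F(z) - F(w)|^p \<le> \<langle>F(z) - F(w), z - w\<rangle>\<close> (\<open>flux_monotone\<close>).

  Let \<open>\<Delta>g(x) = g(x + h) - g(x)\<close> and let \<open>\<eta>\<close> be a cutoff. Testing the
  divergence constraint, once shifted and once not, with \<open>\<eta>\<^sup>2 \<Delta>u\<close> gives
  \<open>\<integral> \<langle>\<Delta>\<sigma>, \<eta>\<^sup>2 \<Delta>\<nabla>u + 2\<eta> \<Delta>u \<nabla>\<eta>\<rangle> = \<integral> \<Delta>f \<eta>\<^sup>2 \<Delta>u\<close>. By monotonicity the first term on the left
  controls \<open>\<integral> \<eta>\<^sup>2 |\<Delta>\<sigma>|^p\<close>, Young's inequality absorbs the second one at the price of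
  \<open>\<integral> |\<Delta>u|^q \<le> |h|^q \<integral> |\<nabla>u|^q\<close>, and the right-hand side is at most
  \<open>\<parallel>\<Delta>f\<parallel>\<^sub>p |h| \<parallel>\<nabla>u\<parallel>\<^sub>q\<close> (\<open>energy_estimate\<close>). The exponent \<open>q\<close> reached here is at least
  \<open>2 / (3 - q)\<close>, because \<open>q (3 - q) - 2 = (q - 1)(2 - q)\<close>; so for \<open>|h| \<le> 1\<close> the estimate is
  stronger than the claim, and for \<open>|h| > 1\<close> the claim follows from \<open>|\<sigma>|^p \<le> |\<nabla>u|^q\<close>.

  The two problems are linked as follows. On \<open>W^{1,q}\<close> the dual functional is
  \<open>u \<mapsto> \<integral> \<langle>\<sigma>, \<nabla>u\<rangle> - H\<^sup>*(\<nabla>u)\<close>, which is bounded above by \<open>\<integral> H(\<sigma>)\<close>. Along a maximising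
  sequence \<open>u\<^sub>k\<close> the expansion of \<open>H\<^sup>*\<close> to order \<open>q\<close> makes the first variation tend to zero;
  monotonicity then shows that \<open>F(\<nabla>u\<^sub>k)\<close> is Cauchy in \<open>L^p\<close>. Its limit is admissible, and
  comparing its energy with that of \<open>\<sigma>\<close> by uniform convexity identifies it as \<open>\<sigma>\<close>
  (\<open>flux_convergence\<close>). The difference estimate is therefore stated for every \<open>u\<close> with an error
  controlled by \<open>\<parallel>\<sigma> - F(\<nabla>u)\<parallel>\<^sub>p\<close>. It passes to the limit along \<open>u\<^sub>k\<close>, which gives the Besov
  regularity of \<open>\<sigma>\<close>; and since a maximiser \<open>u\<close> is a constant maximising
  sequence, \<open>\<sigma> = F(\<nabla>u)\<close> holds almost everywhere for it and the local estimates have no error.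

  Two facts on Sobolev functions enter: the uniqueness of weak gradients
  (\<open>fundamental_lemma\<close>) and the bound for difference quotients on a set \<open>D\<close> in terms of the gradient on
  any set containing \<open>D + [0,1] h\<close> (\<open>difference_quotient_bound\<close>). The latter follows from
  \<open>u(x + h) - u(x) = \<integral>\<^sub>0\<^sup>1 \<langle>\<nabla>u(x + t h), h\<rangle> dt\<close>, proved by testing and Fubini.
\<close>

section \<open>Inequalities for powers\<close>

lemma powr_mult_self: "(x::real) \<ge> 0 \<Longrightarrow> x * x powr (a - 1) = x powr a"
  by (cases "x = 0") (simp_all add: powr_diff)

lemma powr_convex_nonneg:
  fixes r :: real assumes "r \<ge> 1" "a \<ge> 0" "b \<ge> 0"
  shows "((a + b) / 2) powr r \<le> (a powr r + b powr r) / 2"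
proof (cases "a > 0 \<and> b > 0")
  case True
  then have "((1-1/2) * a + (1/2) * b) powr r \<le> (1-1/2) * a powr r + (1/2) * b powr r"
    using convex_onD[OF powr_convex[OF assms(1)], of "1/2" a b] by (simp add: field_simps)
  then show ?thesis by (simp add: field_simps)
next
  case False
  have *: "(c / 2) powr r \<le> c powr r / 2" if "c \<ge> 0" for c :: real
  proof -
    have "(2::real) powr 1 \<le> 2 powr r" using assms by (intro powr_mono) auto
    then have "c powr r / 2 powr r \<le> c powr r / 2" by (intro divide_left_mono) auto
    then show ?thesis using that by (simp add: powr_divide)
  qed
  from False assms have "a = 0 \<or> b = 0" by auto
  then show ?thesis using *[of a] *[of b] assms by auto
qed

lemma norm_add_powr_le:
  fixes x y :: "'a::real_normed_vector"
  assumes "r \<ge> 1"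
  shows "norm (x + y) powr r \<le> 2 powr (r - 1) * (norm x powr r + norm y powr r)"
proof -
  have "norm (x + y) powr r \<le> (norm x + norm y) powr r"
    using assms norm_triangle_ineq by (intro powr_mono2) auto
  also have "\<dots> = 2 powr r * ((norm x + norm y) / 2) powr r"
    by (simp add: powr_divide)
  also have "\<dots> \<le> 2 powr r * ((norm x powr r + norm y powr r) / 2)"
    using assms by (intro mult_left_mono powr_convex_nonneg) auto
  also have "\<dots> = 2 powr (r - 1) * (norm x powr r + norm y powr r)"
    by (simp add: powr_diff)
  finally show ?thesis .
qed

lemma powr_add_superadditive:
  fixes r :: real assumes "r \<ge> 1" "a \<ge> 0" "b \<ge> 0"
  shows "a powr r + b powr r \<le> (a + b) powr r"
proof (cases "a + b = 0")
  case True
  then have "a = 0" "b = 0" using assms by linarith+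
  then show ?thesis using assms by simp
next
  case False
  define s where "s = a + b"
  have s: "s > 0" using False assms by (simp add: s_def)
  have *: "c powr r \<le> c * s powr (r - 1)" if "0 \<le> c" "c \<le> s" for c
  proof -
    have "c powr r = c * c powr (r - 1)" using powr_mult_self[of c r] that by simp
    also have "\<dots> \<le> c * s powr (r - 1)" using that assms by (intro mult_left_mono powr_mono2) auto
    finally show ?thesis .
  qed
  have "a powr r + b powr r \<le> a * s powr (r - 1) + b * s powr (r - 1)"
    using *[of a] *[of b] assms by (simp add: s_def)
  also have "\<dots> = s * s powr (r - 1)" by (simp add: s_def algebra_simps)
  also have "\<dots> = s powr r" using powr_mult_self[of s r] s by simp
  finally show ?thesis by (simp add: s_def)
qed

text \<open>Clarkson's inequality in an inner product space: the parallelogram law, then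
  superadditivity of \<open>t \<mapsto> t^(p/2)\<close> on the left and its convexity on the right.\<close>

lemma Clarkson_ineq:
  fixes a b :: "'a::real_inner"
  assumes "p \<ge> 2"
  shows "norm ((1/2) *\<^sub>R (a + b)) powr p + norm ((1/2) *\<^sub>R (a - b)) powr p \<le> (norm a powr p + norm b powr p) / 2"
proof -
  have sq: "x powr p = (x\<^sup>2) powr (p / 2)" if "x \<ge> 0" for x :: real
    using that powr_powr[of x 2 "p/2"] by (cases "x = 0") (auto simp flip: powr_numeral)
  let ?x = "(1/2) *\<^sub>R (a + b)" and ?y = "(1/2) *\<^sub>R (a - b)"
  have par: "(norm ?x)\<^sup>2 + (norm ?y)\<^sup>2 = ((norm a)\<^sup>2 + (norm b)\<^sup>2) / 2"
    by (simp add: power2_norm_eq_inner inner_add_left inner_add_right inner_diff_left inner_diff_right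
        inner_commute field_simps)
  have "norm ?x powr p + norm ?y powr p = ((norm ?x)\<^sup>2) powr (p/2) + ((norm ?y)\<^sup>2) powr (p/2)"
    using sq[of "norm ?x"] sq[of "norm ?y"] by simp
  also have "\<dots> \<le> ((norm ?x)\<^sup>2 + (norm ?y)\<^sup>2) powr (p/2)"
    using assms by (intro powr_add_superadditive) auto
  also have "\<dots> = (((norm a)\<^sup>2 + (norm b)\<^sup>2) / 2) powr (p/2)" by (simp only: par)
  also have "\<dots> \<le> (((norm a)\<^sup>2) powr (p/2) + ((norm b)\<^sup>2) powr (p/2)) / 2"
    using assms by (intro powr_convex_nonneg) auto
  also have "\<dots> = (norm a powr p + norm b powr p) / 2"
    using sq[of "norm a"] sq[of "norm b"] by simp
  finally show ?thesis .
qed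

section \<open>Convex duality of the two integrands\<close>

locale exponents =
  fixes p q :: real
  assumes q: "1 < q" "q < 2" and p_def: "p = q / (q - 1)"
begin

lemma p_gt_2: "p > 2" using q by (simp add: p_def field_simps)
lemma conj_pq: "1 / p + 1 / q = 1" using q by (simp add: p_def field_simps)
lemma p_q1: "p * (q - 1) = q" using q by (simp add: p_def field_simps)
lemma q_p1: "q * (p - 1) = p" using q by (simp add: p_def field_simps)

lemma young: "0 \<le> a \<Longrightarrow> 0 \<le> b \<Longrightarrow> a * b \<le> a powr q / q + b powr p / p"
  using Youngs_inequality[of q p a b] q p_gt_2 conj_pq by (simp add: add.commute)

lemma young_scaled:
  assumes "k > 0" "0 \<le> a" "0 \<le> b"
  shows "a * b \<le> (k * p) powr (- q / p) * a powr q / q + k * b powr p"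
proof -
  define l where "l = (k * p) powr (1 / p)"
  have p: "p > 0" using p_gt_2 by simp
  have l: "l > 0" using assms p by (simp add: l_def)
  have lp: "l powr p = k * p" using assms p by (simp add: l_def powr_powr)
  have lq: "l powr q = (k * p) powr (q / p)" using assms p by (simp add: l_def powr_powr)
  have "a * b = (a / l) * (l * b)" using l by simp
  also have "\<dots> \<le> (a / l) powr q / q + (l * b) powr p / p"
    using assms l by (intro young) auto
  also have "(l * b) powr p / p = k * b powr p" using l assms lp p by (simp add: powr_mult)
  also have "(a / l) powr q = a powr q / (k * p) powr (q / p)" using l assms lq by (simp add: powr_divide)
  finally show ?thesis by (simp add: powr_minus field_simps)
qed

definition energy :: "'a::real_inner \<Rightarrow> real" where
  "energy s = norm s powr p / p + norm s"
definition conj_energy :: "'a::real_inner \<Rightarrow> real" where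
  "conj_energy z = max 0 (norm z - 1) powr q / q"

text \<open>The gradient of \<open>conj_energy\<close>. For \<open>z = 0\<close> the quotient is \<open>0 / 0 = 0\<close>, and the whole unit
  ball is mapped to \<open>0\<close>.\<close>

definition flux :: "'a::real_inner \<Rightarrow> 'a" where
  "flux z = (max 0 (norm z - 1) powr (q - 1) / norm z) *\<^sub>R z"

text \<open>The modulus \<open>conv_const\<close> of uniform convexity of \<open>H\<close> is the one that the midpoint argument
  below delivers. \<open>growth_const\<close> is the constant that Young's inequality produces when the term
  \<open>conv_const * norm b powr p\<close> is absorbed.\<close>

definition conv_const :: real where "conv_const = 2 powr (1 - p) / p"
definition growth_const :: real where "growth_const = (conv_const * p) powr (- q / p) / q"

lemma conv_const_pos: "conv_const > 0" using p_gt_2 by (simp add: conv_const_def)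
lemma growth_const_pos: "growth_const > 0" using conv_const_pos p_gt_2 q by (simp add: growth_const_def)

lemma conj_energy_nonneg: "conj_energy s \<ge> 0" using q by (simp add: conj_energy_def)

lemma norm_flux: "norm (flux z) = max 0 (norm z - 1) powr (q - 1)"
  by (cases "z = 0") (simp_all add: flux_def)

lemma norm_flux_powr: "norm (flux z) powr p = max 0 (norm z - 1) powr q"
  using p_q1 by (simp add: norm_flux powr_powr mult.commute)

lemma norm_flux_powr_le: "norm (flux z) powr p \<le> norm z powr q"
  unfolding norm_flux_powr using q by (intro powr_mono2) auto

lemma inner_flux: "z \<bullet> flux z = norm z * max 0 (norm z - 1) powr (q - 1)"
  by (cases "z = 0") (simp_all add: flux_def dot_square_norm power2_eq_square)

lemma Fenchel_eq: "energy (flux z) + conj_energy z = z \<bullet> flux z"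
proof -
  let ?m = "max 0 (norm z - 1)"
  have "energy (flux z) + conj_energy z = ?m powr q / p + ?m powr (q - 1) + ?m powr q / q"
    unfolding energy_def conj_energy_def norm_flux_powr unfolding norm_flux by simp
  also have "\<dots> = ?m powr q * (1/p + 1/q) + ?m powr (q - 1)" by (simp add: algebra_simps)
  also have "\<dots> = ?m * ?m powr (q - 1) + ?m powr (q - 1)" by (simp add: conj_pq powr_mult_self)
  also have "\<dots> = norm z * ?m powr (q - 1)"
    by (cases "norm z > 1") (auto simp: max_def algebra_simps)
  finally show ?thesis by (simp add: inner_flux)
qed

text \<open>The tangent inequality for \<open>|s|^p / p\<close>: Cauchy-Schwarz reduces it to Young's inequality.\<close>

lemma power_gradient_ineq:
  fixes a b :: "'a::real_inner"
  shows "norm a powr p / p + (norm a powr (p - 2) *\<^sub>R a) \<bullet> (b - a) \<le> norm b powr p / p"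
proof (cases "a = 0")
  case True then show ?thesis using p_gt_2 by simp
next
  case False
  have 1: "norm a powr (p - 2) * norm a = norm a powr (p - 1)"
    using powr_mult_self[of "norm a" "p - 1"] by (simp add: mult.commute)
  have 2: "(norm a powr (p - 2) *\<^sub>R a) \<bullet> a = norm a powr p"
  proof -
    have "(norm a powr (p - 2) *\<^sub>R a) \<bullet> a = (norm a powr (p - 2) * norm a) * norm a"
      by (simp add: dot_square_norm power2_eq_square)
    also have "\<dots> = norm a powr p" using 1 powr_mult_self[of "norm a" p] by (simp add: mult.commute)
    finally show ?thesis .
  qed
  have "(norm a powr (p - 2) *\<^sub>R a) \<bullet> b \<le> norm (norm a powr (p - 2) *\<^sub>R a) * norm b"
    by (rule norm_cauchy_schwarz)
  also have "\<dots> = norm a powr (p - 1) * norm b" using 1 by simp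
  also have "\<dots> \<le> (norm a powr (p - 1)) powr q / q + norm b powr p / p"
    by (rule young) auto
  also have "(norm a powr (p - 1)) powr q = norm a powr p" using q_p1 by (simp add: powr_powr mult.commute)
  finally have 3: "(norm a powr (p - 2) *\<^sub>R a) \<bullet> b \<le> norm a powr p / q + norm b powr p / p" .
  have "norm a powr p / p + norm a powr p / q = norm a powr p"
    using conj_pq by (simp add: divide_inverse flip: distrib_left)
  with 2 3 show ?thesis by (simp add: inner_diff_right)
qed

text \<open>Clarkson's inequality bounds the value at the midpoint of \<open>a\<close> and \<open>b\<close> from above, the tangent
  inequality at \<open>a\<close> bounds it from below.\<close>

lemma power_uniformly_convex:
  fixes a b :: "'a::real_inner"
  shows "norm a powr p / p + (norm a powr (p - 2) *\<^sub>R a) \<bullet> (b - a) + conv_const * norm (b - a) powr p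
      \<le> norm b powr p / p"
proof -
  let ?m = "(1/2) *\<^sub>R (a + b)"
  let ?g = "norm a powr (p - 2) *\<^sub>R a"
  have m: "?m - a = (1/2) *\<^sub>R (b - a)" by (simp add: algebra_simps flip: scaleR_2 scaleR_left_distrib)
  have p: "p > 0" using p_gt_2 by simp
  have 1: "norm a powr p / p + (?g \<bullet> (b - a)) / 2 \<le> norm ?m powr p / p"
    using power_gradient_ineq[of a ?m] unfolding m by simp
  have 2: "norm ?m powr p + norm ((1/2) *\<^sub>R (a - b)) powr p \<le> (norm a powr p + norm b powr p) / 2"
    using p_gt_2 by (intro Clarkson_ineq) auto
  have 3: "norm ((1/2) *\<^sub>R (a - b)) powr p = 2 powr (-p) * norm (b - a) powr p"
  proof -
    have "norm ((1/2) *\<^sub>R (a - b)) = norm (b - a) / 2" by (simp add: norm_minus_commute)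
    then show ?thesis by (simp only: powr_divide powr_minus_divide) simp
  qed
  have "2 * (norm ?m powr p / p) + 2 * 2 powr (-p) / p * norm (b - a) powr p \<le> (norm a powr p + norm b powr p) / p"
    using mult_left_mono[OF 2[unfolded 3], of "2 / p"] p
    by (simp only: distrib_left times_divide_eq_left times_divide_eq_right add_divide_distrib) simp
  moreover have "2 * 2 powr (-p) / p = conv_const" by (simp add: conv_const_def powr_diff powr_minus field_simps)
  ultimately have 4: "2 * (norm ?m powr p / p) + conv_const * norm (b - a) powr p \<le> norm a powr p / p + norm b powr p / p"
    by (simp add: add_divide_distrib)
  from 1 4 show ?thesis by linarith
qed

text \<open>The vector \<open>z\<close> is a subgradient of \<open>energy\<close> at \<open>flux z\<close>: it splits into the gradient of
  \<open>|s|^p / p\<close> at \<open>flux z\<close> and a subgradient of the norm, namely \<open>z / |z|\<close> if \<open>|z| > 1\<close>, and \<open>z\<close> itself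
  in the unit ball, where \<open>flux z = 0\<close>. The \<open>p\<close>-th power contributes the remainder term.\<close>

lemma energy_uniformly_convex:
  fixes b z :: "'a::real_inner"
  shows "energy (flux z) + z \<bullet> (b - flux z) + conv_const * norm (b - flux z) powr p \<le> energy b"
proof (cases "norm z \<le> 1")
  case True
  then have F0: "flux z = 0" using q by (simp add: flux_def max_def)
  have "z \<bullet> b \<le> norm z * norm b" by (rule norm_cauchy_schwarz)
  also have "\<dots> \<le> norm b" using True by (simp add: mult_left_le_one_le)
  finally show ?thesis using power_uniformly_convex[of 0 b] p_gt_2 unfolding F0 energy_def by simp
next
  case False
  let ?m = "norm z - 1"
  have m: "?m > 0" using False by simp
  have nF: "norm (flux z) = ?m powr (q - 1)" using m by (simp add: norm_flux max_def)
  have e: "(q - 1) * (p - 2) + (q - 1) = 1"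
    using p_q1 by (simp add: algebra_simps)
  have "norm (flux z) powr (p - 2) *\<^sub>R flux z = (?m powr ((q - 1) * (p - 2)) * ?m powr (q - 1) / norm z) *\<^sub>R z"
    using m by (simp add: nF powr_powr flux_def max_def)
  also have "?m powr ((q - 1) * (p - 2)) * ?m powr (q - 1) = ?m powr 1"
    unfolding powr_add[symmetric] e ..
  finally have g: "norm (flux z) powr (p - 2) *\<^sub>R flux z = (?m / norm z) *\<^sub>R z" using m by simp
  have "?m / norm z + 1 / norm z = 1"
    using False by (auto simp: diff_divide_distrib)
  then have "z = (?m / norm z) *\<^sub>R z + (1 / norm z) *\<^sub>R z"
    by (metis scaleR_left_distrib scaleR_one)
  then have zd: "z \<bullet> x = (norm (flux z) powr (p - 2) *\<^sub>R flux z) \<bullet> x + ((1 / norm z) *\<^sub>R z) \<bullet> x" for x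
    unfolding g by (metis inner_add_left)
  have zF: "((1 / norm z) *\<^sub>R z) \<bullet> flux z = norm (flux z)"
    using False inner_flux[of z] norm_flux[of z] by auto
  have "((1 / norm z) *\<^sub>R z) \<bullet> b \<le> norm ((1 / norm z) *\<^sub>R z) * norm b" by (rule norm_cauchy_schwarz)
  also have "\<dots> \<le> norm b" using False by (auto simp: mult_left_le_one_le)
  finally show ?thesis using power_uniformly_convex[of "flux z" b] zF unfolding energy_def zd by (simp add: inner_diff_right)
qed

lemma Fenchel_Young: "z \<bullet> s \<le> energy s + conj_energy z"
proof -
  have "0 \<le> conv_const * norm (s - flux z) powr p" using conv_const_pos by simp
  then show ?thesis using energy_uniformly_convex[of z s] Fenchel_eq[of z] by (simp add: inner_diff_right)
qed

lemma flux_monotone: "2 * conv_const * norm (flux z - flux w) powr p \<le> (flux z - flux w) \<bullet> (z - w)"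
  using energy_uniformly_convex[of z "flux w"] energy_uniformly_convex[of w "flux z"]
  by (simp add: inner_diff_left inner_diff_right inner_commute norm_minus_commute)

text \<open>Dual to uniform convexity: \<open>H\<^sup>*\<close> is differentiable with a remainder of order \<open>q\<close>. The Fenchel
  identity at \<open>z + w\<close> turns the convexity remainder, which enters with a negative sign, into
  something that absorbs \<open>w \<bullet> (flux (z + w) - flux z)\<close>.\<close>

lemma conj_energy_expansion: "conj_energy (z + w) \<le> conj_energy z + w \<bullet> flux z + growth_const * norm w powr q"
proof -
  let ?s = "flux (z + w)"
  have "w \<bullet> (?s - flux z) \<le> norm w * norm (?s - flux z)" by (rule norm_cauchy_schwarz)
  also have "\<dots> \<le> (conv_const * p) powr (- q / p) * norm w powr q / q + conv_const * norm (?s - flux z) powr p"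
    using conv_const_pos by (intro young_scaled) auto
  finally have "w \<bullet> (?s - flux z) \<le> growth_const * norm w powr q + conv_const * norm (?s - flux z) powr p" by (simp add: growth_const_def)
  then show ?thesis
    using Fenchel_eq[of "z + w"] Fenchel_eq[of z] energy_uniformly_convex[of z ?s]
    by (simp add: inner_diff_right inner_add_left)
qed

lemma norm_powr_le_conj_energy: "norm z powr q \<le> 2 powr q * (1 + q * conj_energy z)"
proof -
  let ?m = "max 0 (norm z - 1)"
  have "norm z powr q \<le> (1 + ?m) powr q" using q by (intro powr_mono2) auto
  also have "\<dots> = 2 powr q * ((1 + ?m) / 2) powr q" by (simp add: powr_divide)
  also have "\<dots> \<le> 2 powr q * ((1 powr q + ?m powr q) / 2)"
    using q by (intro mult_left_mono powr_convex_nonneg) auto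
  also have "\<dots> \<le> 2 powr q * (1 + q * conj_energy z)"
    using q by (intro mult_left_mono) (auto simp: conj_energy_def field_simps)
  finally show ?thesis .
qed

end

section \<open>Lebesgue spaces over a measure\<close>

text \<open>Young's inequality applied to the normalised functions; if one of the norms vanishes, the
  product is zero almost everywhere.\<close>

lemma Holder:
  fixes f g :: "'a \<Rightarrow> real" and r s :: real
  assumes rs: "r > 1" "s > 1" "1 / r + 1 / s = 1"
    and [measurable]: "f \<in> borel_measurable M" "g \<in> borel_measurable M"
    and f: "integrable M (\<lambda>x. \<bar>f x\<bar> powr r)" and g: "integrable M (\<lambda>x. \<bar>g x\<bar> powr s)"
  shows "integrable M (\<lambda>x. f x * g x)"
    and "(\<integral>x. \<bar>f x * g x\<bar> \<partial>M) \<le> (\<integral>x. \<bar>f x\<bar> powr r \<partial>M) powr (1 / r) * (\<integral>x. \<bar>g x\<bar> powr s \<partial>M) powr (1 / s)"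
proof -
  have young: "\<bar>a * b\<bar> \<le> \<bar>a\<bar> powr r / r + \<bar>b\<bar> powr s / s" for a b :: real
    using Youngs_inequality[OF rs, of "\<bar>a\<bar>" "\<bar>b\<bar>"] by (simp add: abs_mult)
  show int: "integrable M (\<lambda>x. f x * g x)"
  proof (rule Bochner_Integration.integrable_bound)
    show "integrable M (\<lambda>x. \<bar>f x\<bar> powr r / r + \<bar>g x\<bar> powr s / s)" using f g by auto
    show "AE x in M. norm (f x * g x) \<le> norm (\<bar>f x\<bar> powr r / r + \<bar>g x\<bar> powr s / s)"
      using young by (auto intro!: AE_I2 order_trans[OF young])
  qed simp
  define A where "A = (\<integral>x. \<bar>f x\<bar> powr r \<partial>M) powr (1 / r)"
  define B where "B = (\<integral>x. \<bar>g x\<bar> powr s \<partial>M) powr (1 / s)"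
  have A: "A powr r = (\<integral>x. \<bar>f x\<bar> powr r \<partial>M)" and B: "B powr s = (\<integral>x. \<bar>g x\<bar> powr s \<partial>M)"
    using rs by (auto simp: A_def B_def powr_powr)
  show "(\<integral>x. \<bar>f x * g x\<bar> \<partial>M) \<le> A * B"
  proof (cases "A = 0 \<or> B = 0")
    case True
    have "AE x in M. f x * g x = 0"
    proof (cases "A = 0")
      case True
      then have "AE x in M. \<bar>f x\<bar> powr r = 0"
        using f A rs by (subst integral_nonneg_eq_0_iff_AE[symmetric]) auto
      then show ?thesis by eventually_elim simp
    next
      case False
      with True have "B = 0" by simp
      then have "AE x in M. \<bar>g x\<bar> powr s = 0"
        using g B rs by (subst integral_nonneg_eq_0_iff_AE[symmetric]) auto
      then show ?thesis by eventually_elim simp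
    qed
    then have "(\<integral>x. \<bar>f x * g x\<bar> \<partial>M) = 0"
      by (subst integral_eq_zero_AE) auto
    then show ?thesis using True by auto
  next
    case False
    then have AB: "A > 0" "B > 0" by (auto simp: A_def B_def)
    have "(\<integral>x. \<bar>f x * g x\<bar> \<partial>M) \<le> (\<integral>x. (A * B) * ((\<bar>f x\<bar> powr r / A powr r) / r + (\<bar>g x\<bar> powr s / B powr s) / s) \<partial>M)"
    proof (rule integral_mono)
      show "integrable M (\<lambda>x. (A * B) * ((\<bar>f x\<bar> powr r / A powr r) / r + (\<bar>g x\<bar> powr s / B powr s) / s))"
        using f g by auto
      fix x
      have "\<bar>f x * g x\<bar> = (A * B) * \<bar>(f x / A) * (g x / B)\<bar>" using AB by (simp add: abs_mult)
      also have "\<dots> \<le> (A * B) * (\<bar>f x / A\<bar> powr r / r + \<bar>g x / B\<bar> powr s / s)"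
        using AB by (intro mult_left_mono young) auto
      also have "\<dots> = (A * B) * ((\<bar>f x\<bar> powr r / A powr r) / r + (\<bar>g x\<bar> powr s / B powr s) / s)"
        using AB by (simp add: powr_divide)
      finally show "\<bar>f x * g x\<bar> \<le> (A * B) * ((\<bar>f x\<bar> powr r / A powr r) / r + (\<bar>g x\<bar> powr s / B powr s) / s)" .
    qed (use int in auto)
    also have "\<dots> = (A * B) * (((\<integral>x. \<bar>f x\<bar> powr r \<partial>M) / A powr r) / r + ((\<integral>x. \<bar>g x\<bar> powr s \<partial>M) / B powr s) / s)"
      using f g by simp
    also have "\<dots> = A * B" unfolding A[symmetric] B[symmetric] using AB rs by simp
    finally show ?thesis .
  qed
qed

text \<open>The spaces \<open>Lp\<close> are those of \<open>lebesgue_on S\<close>. General measures are needed because functions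
  extended by zero live on \<open>lebesgue\<close>, and averages over a parameter interval on a restriction of
  \<open>lborel\<close>.\<close>

definition in_Lp :: "'a measure \<Rightarrow> real \<Rightarrow> ('a \<Rightarrow> 'b::real_normed_vector) \<Rightarrow> bool" where
  "in_Lp M r f \<longleftrightarrow> f \<in> borel_measurable M \<and> integrable M (\<lambda>x. norm (f x) powr r)"

definition norm_Lp :: "'a measure \<Rightarrow> real \<Rightarrow> ('a \<Rightarrow> 'b::real_normed_vector) \<Rightarrow> real" where
  "norm_Lp M r f = (\<integral>x. norm (f x) powr r \<partial>M) powr (1 / r)"

lemma Lp_iff: "f \<in> Lp r S \<longleftrightarrow> in_Lp (lebesgue_on S) r f"
  by (simp add: Lp_def in_Lp_def)

lemma Lp_norm_eq: "Lp_norm r S f = norm_Lp (lebesgue_on S) r f"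
  by (simp add: Lp_norm_def norm_Lp_def)

lemma norm_Lp_nonneg [simp]: "norm_Lp M r f \<ge> 0" by (simp add: norm_Lp_def)

lemma norm_Lp_powr: "r > 0 \<Longrightarrow> norm_Lp M r f powr r = (\<integral>x. norm (f x) powr r \<partial>M)"
  by (simp add: norm_Lp_def powr_powr)

lemma in_Lp_measurable [measurable_dest]: "in_Lp M r f \<Longrightarrow> f \<in> borel_measurable M"
  by (simp add: in_Lp_def)

lemma in_Lp_integrable: "in_Lp M r f \<Longrightarrow> integrable M (\<lambda>x. norm (f x) powr r)"
  by (simp add: in_Lp_def)

lemma in_Lp_cong_AE:
  fixes f g :: "'a \<Rightarrow> 'b::{real_normed_vector, second_countable_topology}"
  assumes "in_Lp M r f" "g \<in> borel_measurable M" "AE x in M. f x = g x"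
  shows "in_Lp M r g"
proof -
  have "integrable M (\<lambda>x. norm (g x) powr r)"
    using assms in_Lp_measurable[OF assms(1)]
    by (intro integrable_cong_AE_imp[OF in_Lp_integrable[OF assms(1)]]) (auto elim: eventually_mono)
  then show ?thesis using assms by (simp add: in_Lp_def)
qed

lemma in_Lp_bound:
  fixes f :: "'a \<Rightarrow> 'b::{real_normed_vector, second_countable_topology}" and g :: "'a \<Rightarrow> 'c::{real_normed_vector, second_countable_topology}"
  assumes "r > 0" "in_Lp M r g" "f \<in> borel_measurable M" "AE x in M. norm (f x) \<le> C * norm (g x)"
  shows "in_Lp M r f"
proof -
  have [measurable]: "f \<in> borel_measurable M" "g \<in> borel_measurable M" using assms by auto
  have "integrable M (\<lambda>x. norm (f x) powr r)"
  proof (rule Bochner_Integration.integrable_bound)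
    show "integrable M (\<lambda>x. (max C 0) powr r * norm (g x) powr r)"
      using in_Lp_integrable[OF assms(2)] by simp
    show "AE x in M. norm (norm (f x) powr r) \<le> norm ((max C 0) powr r * norm (g x) powr r)"
      using assms(4)
    proof eventually_elim
      case (elim x)
      have "norm (f x) \<le> max C 0 * norm (g x)" using elim by (rule order_trans) (auto intro: mult_right_mono)
      then have "norm (f x) powr r \<le> (max C 0 * norm (g x)) powr r" using assms(1) by (intro powr_mono2) auto
      then show ?case by (simp add: powr_mult)
    qed
  qed simp
  then show ?thesis using assms by (simp add: in_Lp_def)
qed

lemma in_Lp_add:
  fixes f g :: "'a \<Rightarrow> 'b::{real_normed_vector, second_countable_topology}"
  assumes "r \<ge> 1" "in_Lp M r f" "in_Lp M r g" shows "in_Lp M r (\<lambda>x. f x + g x)"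
proof -
  have [measurable]: "f \<in> borel_measurable M" "g \<in> borel_measurable M" using assms by auto
  have "integrable M (\<lambda>x. norm (f x + g x) powr r)"
  proof (rule Bochner_Integration.integrable_bound)
    show "integrable M (\<lambda>x. 2 powr (r - 1) * (norm (f x) powr r + norm (g x) powr r))"
      using assms by (auto simp: in_Lp_def)
    show "AE x in M. norm (norm (f x + g x) powr r) \<le> norm (2 powr (r - 1) * (norm (f x) powr r + norm (g x) powr r))"
      using norm_add_powr_le[OF assms(1)] by (auto simp: add_nonneg_nonneg)
  qed simp
  then show ?thesis by (simp add: in_Lp_def)
qed

lemma in_Lp_scaleR:
  fixes f :: "'a \<Rightarrow> 'b::{real_normed_vector, second_countable_topology}"
  assumes "in_Lp M r f" shows "in_Lp M r (\<lambda>x. c *\<^sub>R f x)"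
  using assms by (auto simp: in_Lp_def powr_mult)

lemma in_Lp_minus:
  fixes f :: "'a \<Rightarrow> 'b::{real_normed_vector, second_countable_topology}"
  assumes "in_Lp M r f" shows "in_Lp M r (\<lambda>x. - f x)"
  using in_Lp_scaleR[OF assms, of "-1"] by simp

lemma in_Lp_diff:
  fixes f g :: "'a \<Rightarrow> 'b::{real_normed_vector, second_countable_topology}"
  assumes "r \<ge> 1" "in_Lp M r f" "in_Lp M r g" shows "in_Lp M r (\<lambda>x. f x - g x)"
  using in_Lp_add[OF assms(1,2) in_Lp_minus[OF assms(3)]] by simp

lemma in_Lp_norm:
  fixes f :: "'a \<Rightarrow> 'b::{real_normed_vector, second_countable_topology}"
  assumes "in_Lp M r f" shows "in_Lp M r (\<lambda>x. norm (f x))"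
  using assms by (auto simp: in_Lp_def)

lemma Holder_inner:
  fixes f g :: "'a \<Rightarrow> 'b::euclidean_space" and r s :: real
  assumes rs: "r > 1" "s > 1" "1 / r + 1 / s = 1"
    and f: "in_Lp M r f" and g: "in_Lp M s g"
  shows "integrable M (\<lambda>x. f x \<bullet> g x)" "integrable M (\<lambda>x. norm (f x) * norm (g x))"
    and "(\<integral>x. norm (f x) * norm (g x) \<partial>M) \<le> norm_Lp M r f * norm_Lp M s g"
    and "\<bar>\<integral>x. f x \<bullet> g x \<partial>M\<bar> \<le> norm_Lp M r f * norm_Lp M s g"
proof -
  have [measurable]: "f \<in> borel_measurable M" "g \<in> borel_measurable M" using f g by auto
  note H = Holder[OF rs, of "\<lambda>x. norm (f x)" M "\<lambda>x. norm (g x)"]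
  show 1: "integrable M (\<lambda>x. norm (f x) * norm (g x))" using H(1) f g by (auto simp: in_Lp_def)
  show 2: "integrable M (\<lambda>x. f x \<bullet> g x)"
    by (rule Bochner_Integration.integrable_bound[OF 1]) (auto simp: Cauchy_Schwarz_ineq2)
  show 3: "(\<integral>x. norm (f x) * norm (g x) \<partial>M) \<le> norm_Lp M r f * norm_Lp M s g"
    using H(2) f g by (auto simp: in_Lp_def norm_Lp_def)
  have "\<bar>\<integral>x. f x \<bullet> g x \<partial>M\<bar> \<le> (\<integral>x. \<bar>f x \<bullet> g x\<bar> \<partial>M)" by (rule integral_abs_bound)
  also have "\<dots> \<le> (\<integral>x. norm (f x) * norm (g x) \<partial>M)"
    using 1 2 by (intro integral_mono) (auto simp: Cauchy_Schwarz_ineq2)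
  finally show "\<bar>\<integral>x. f x \<bullet> g x \<partial>M\<bar> \<le> norm_Lp M r f * norm_Lp M s g" using 3 by linarith
qed

lemma in_Lp_imp_integrable:
  fixes f :: "'a \<Rightarrow> 'b::{banach, second_countable_topology}"
  assumes "finite_measure M" "r \<ge> 1" "in_Lp M r f" shows "integrable M f"
proof (rule Bochner_Integration.integrable_bound)
  interpret finite_measure M by fact
  show "integrable M (\<lambda>x. 1 + norm (f x) powr r)" using assms by (auto simp: in_Lp_def)
  show "f \<in> borel_measurable M" using assms by auto
  show "AE x in M. norm (f x) \<le> norm (1 + norm (f x) powr r)"
  proof (rule AE_I2)
    fix x
    have "norm (f x) \<le> 1 + norm (f x) powr r"
    proof (cases "norm (f x) \<le> 1")
      case True
      then show ?thesis by (smt (verit) powr_ge_zero)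
    next
      case False
      then have "norm (f x) powr 1 \<le> norm (f x) powr r" using assms by (intro powr_mono) auto
      then show ?thesis using False by simp
    qed
    then show "norm (f x) \<le> norm (1 + norm (f x) powr r)" by simp
  qed
qed

lemma in_Lp_const:
  assumes "finite_measure M" shows "in_Lp M r (\<lambda>x. c)"
proof -
  interpret finite_measure M by fact
  show ?thesis by (simp add: in_Lp_def)
qed

lemma L1_le_Lp:
  fixes f :: "'a \<Rightarrow> 'b::{real_normed_vector, second_countable_topology}"
  assumes "finite_measure M" "r > 1" "in_Lp M r f"
  shows "(\<integral>x. norm (f x) \<partial>M) \<le> measure M (space M) powr (1 - 1/r) * norm_Lp M r f"
proof -
  interpret finite_measure M by fact
  define s where "s = r / (r - 1)"
  have s: "s > 1" "1 / r + 1 / s = 1" using assms by (auto simp: s_def field_simps)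
  have "(\<integral>x. norm (f x) * norm (1::real) \<partial>M) \<le> norm_Lp M r (\<lambda>x. norm (f x)) * norm_Lp M s (\<lambda>x. 1::real)"
    using Holder_inner(3)[OF assms(2) s in_Lp_norm[OF assms(3)] in_Lp_const[OF assms(1), of s "1::real"]] by simp
  also have "norm_Lp M s (\<lambda>x. 1::real) = measure M (space M) powr (1 - 1/r)"
  proof -
    have "1 / s = 1 - 1 / r" using s by simp
    then show ?thesis by (simp only: norm_Lp_def) simp
  qed
  finally show ?thesis by (simp add: norm_Lp_def mult.commute)
qed

text \<open>On a finite measure space a Cauchy sequence in \<open>L^r\<close> is Cauchy in \<open>L^1\<close>, so that a subsequence
  converges almost everywhere; Fatou's lemma turns the Cauchy property into convergence in \<open>L^r\<close> to
  that limit.\<close>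

lemma Lp_complete:
  fixes s :: "nat \<Rightarrow> 'a \<Rightarrow> 'b::{banach, second_countable_topology}"
  assumes fin: "finite_measure M" and r: "r > 1" and s: "\<And>n. in_Lp M r (s n)"
    and Cauchy: "\<And>e. e > 0 \<Longrightarrow> \<exists>N. \<forall>i\<ge>N. \<forall>j\<ge>N. (\<integral>x. norm (s i x - s j x) powr r \<partial>M) < e"
  obtains t where "in_Lp M r t" "(\<lambda>n. \<integral>x. norm (s n x - t x) powr r \<partial>M) \<longlonglongrightarrow> 0"
proof -
  interpret finite_measure M by fact
  have [measurable]: "s n \<in> borel_measurable M" for n using s[of n] by auto
  define m where "m = measure M (space M) powr (1 - 1/r)"
  have d: "in_Lp M r (\<lambda>x. s i x - s j x)" for i j using s r by (intro in_Lp_diff) auto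
  obtain k where k: "strict_mono k" "AE x in M. Cauchy (\<lambda>i. s (k i) x)"
  proof (rule cauchy_L1_AE_cauchy_subseq)
    show "integrable M (s n)" for n using in_Lp_imp_integrable[OF fin _ s] r by simp
    fix e :: real assume e: "e > 0"
    define e' where "e' = (e / (m + 1)) powr r"
    have m: "m \<ge> 0" by (simp add: m_def)
    have "e' > 0" using e m by (simp add: e'_def)
    then obtain N where N: "(\<integral>x. norm (s i x - s j x) powr r \<partial>M) < e'" if "i \<ge> N" "j \<ge> N" for i j
      using Cauchy by blast
    have "(LINT x|M. norm (s i x - s j x)) < e" if "i \<ge> N" "j \<ge> N" for i j
    proof -
      have "norm_Lp M r (\<lambda>x. s i x - s j x) \<le> e' powr (1 / r)"
        using N[OF that] r unfolding norm_Lp_def by (intro powr_mono2) auto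
      also have "\<dots> = e / (m + 1)" using e m r by (simp add: e'_def powr_powr)
      finally have 1: "norm_Lp M r (\<lambda>x. s i x - s j x) \<le> e / (m + 1)" .
      have "(LINT x|M. norm (s i x - s j x)) \<le> m * norm_Lp M r (\<lambda>x. s i x - s j x)"
        unfolding m_def by (rule L1_le_Lp[OF fin r d])
      also have "\<dots> \<le> m * (e / (m + 1))" using 1 m by (intro mult_left_mono)
      also have "\<dots> < e" using e m by (simp add: field_simps)
      finally show ?thesis .
    qed
    then show "\<exists>N. \<forall>i\<ge>N. \<forall>j\<ge>N. (LINT x|M. norm (s i x - s j x)) < e" by blast
  qed
  define t where "t x = lim (\<lambda>i. s (k i) x)" for x
  have t[measurable]: "t \<in> borel_measurable M" unfolding t_def by (rule borel_measurable_lim_metric) simp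
  have lim: "AE x in M. (\<lambda>i. s (k i) x) \<longlonglongrightarrow> t x"
    using k(2) by eventually_elim (simp add: t_def Cauchy_convergent_iff convergent_LIMSEQ_iff)
  have main: "integrable M (\<lambda>x. norm (s n x - t x) powr r) \<and> (\<integral>x. norm (s n x - t x) powr r \<partial>M) \<le> e"
    if e: "e > 0" and N: "\<And>i j. i \<ge> N \<Longrightarrow> j \<ge> N \<Longrightarrow> (\<integral>x. norm (s i x - s j x) powr r \<partial>M) < e" and n: "n \<ge> N" for e N n
  proof -
    have "(\<integral>\<^sup>+x. ennreal (norm (s n x - t x) powr r) \<partial>M) = (\<integral>\<^sup>+x. liminf (\<lambda>i. ennreal (norm (s n x - s (k i) x) powr r)) \<partial>M)"
    proof (rule nn_integral_cong_AE)
      show "AE x in M. ennreal (norm (s n x - t x) powr r) = liminf (\<lambda>i. ennreal (norm (s n x - s (k i) x) powr r))"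
        using lim
      proof eventually_elim
        case (elim x)
        have "(\<lambda>i. norm (s n x - s (k i) x) powr r) \<longlonglongrightarrow> norm (s n x - t x) powr r"
          using elim r by (intro tendsto_intros) auto
        then have "(\<lambda>i. ennreal (norm (s n x - s (k i) x) powr r)) \<longlonglongrightarrow> ennreal (norm (s n x - t x) powr r)"
          by (intro tendsto_ennrealI)
        then show ?case using lim_imp_Liminf[of sequentially] by (metis sequentially_bot)
      qed
    qed
    also have "\<dots> \<le> liminf (\<lambda>i. \<integral>\<^sup>+x. ennreal (norm (s n x - s (k i) x) powr r) \<partial>M)"
      by (rule nn_integral_liminf) simp
    also have "\<dots> \<le> ennreal e"
    proof (rule Liminf_le)
      show "\<forall>\<^sub>F i in sequentially. (\<integral>\<^sup>+x. ennreal (norm (s n x - s (k i) x) powr r) \<partial>M) \<le> ennreal e"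
        using eventually_ge_at_top[of N]
      proof eventually_elim
        case (elim i)
        then have "k i \<ge> N" using seq_suble[OF k(1)] le_trans by blast
        then have "(\<integral>x. norm (s n x - s (k i) x) powr r \<partial>M) < e" using N n by blast
        then show ?case using in_Lp_integrable[OF d[of n "k i"]]
          by (subst nn_integral_eq_integral) (auto intro: ennreal_leI)
      qed
    qed simp
    finally have le: "(\<integral>\<^sup>+x. ennreal (norm (s n x - t x) powr r) \<partial>M) \<le> ennreal e" .
    have int: "integrable M (\<lambda>x. norm (s n x - t x) powr r)"
      using le by (intro integrableI_bounded) (auto simp: top_unique intro: le_less_trans)
    moreover have "(\<integral>x. norm (s n x - t x) powr r \<partial>M) \<le> e"
      using le int e by (subst (asm) nn_integral_eq_integral) auto
    ultimately show ?thesis by simp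
  qed
  have tL: "in_Lp M r t"
  proof -
    obtain N where N: "\<And>i j. i \<ge> N \<Longrightarrow> j \<ge> N \<Longrightarrow> (\<integral>x. norm (s i x - s j x) powr r \<partial>M) < 1"
      using Cauchy[of 1] by auto
    have "in_Lp M r (\<lambda>x. s N x - t x)" using main[of 1 N N] N by (simp add: in_Lp_def)
    from in_Lp_diff[OF _ s[of N] this] r show ?thesis by simp
  qed
  moreover have "(\<lambda>n. \<integral>x. norm (s n x - t x) powr r \<partial>M) \<longlonglongrightarrow> 0"
  proof (rule LIMSEQ_I)
    fix e :: real assume "e > 0"
    then have e: "e / 2 > 0" by simp
    then obtain N where N: "\<And>i j. i \<ge> N \<Longrightarrow> j \<ge> N \<Longrightarrow> (\<integral>x. norm (s i x - s j x) powr r \<partial>M) < e / 2"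
      using Cauchy[of "e/2"] by auto
    show "\<exists>N. \<forall>n\<ge>N. norm ((\<integral>x. norm (s n x - t x) powr r \<partial>M) - 0) < e"
      using main[OF e N] e by (intro exI[of _ N]) (fastforce simp: Bochner_Integration.integral_nonneg_AE)
  qed
  ultimately show ?thesis by (rule that)
qed

section \<open>Smooth functions and cutoffs\<close>

definition smooth :: "(real^'n::finite \<Rightarrow> real) \<Rightarrow> bool" where
  "smooth f \<longleftrightarrow> (\<forall>k. C_diff k f)"

definition grad :: "(real^'n::finite \<Rightarrow> real) \<Rightarrow> real^'n \<Rightarrow> real^'n" where
  "grad f x = (\<chi> i. partial_deriv i f x)"

lemma partial_deriv_eq:
  assumes "(f has_derivative f') (at x)" shows "partial_deriv i f x = f' (axis i 1)"
  unfolding partial_deriv_def using frechet_derivative_at[OF assms] by simp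

lemma has_derivative_grad:
  assumes "f differentiable (at x)" shows "(f has_derivative (\<lambda>v. grad f x \<bullet> v)) (at x)"
proof -
  let ?f' = "frechet_derivative f (at x)"
  have d: "(f has_derivative ?f') (at x)" using assms frechet_derivative_works by blast
  interpret bounded_linear ?f' using d by (rule has_derivative_bounded_linear)
  have "?f' v = grad f x \<bullet> v" for v
  proof -
    have e: "(\<Sum>i\<in>UNIV. v $ i *\<^sub>R axis i 1) = v"
      using basis_expansion[of v] by (simp add: scalar_mult_eq_scaleR)
    have "?f' v = ?f' (\<Sum>i\<in>UNIV. v $ i *\<^sub>R axis i 1)"
      by (simp only: e)
    also have "\<dots> = (\<Sum>i\<in>UNIV. v $ i * ?f' (axis i 1))" by (simp add: sum scaleR)
    also have "\<dots> = grad f x \<bullet> v" by (simp add: grad_def inner_vec_def partial_deriv_def mult.commute)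
    finally show ?thesis .
  qed
  then have "?f' = (\<lambda>v. grad f x \<bullet> v)" by auto
  with d show ?thesis by simp
qed

lemma C_diff_Suc_imp: "C_diff (Suc k) f \<Longrightarrow> C_diff k f"
proof (induction k arbitrary: f)
  case 0
  then have "\<forall>x. f differentiable (at x)" by simp
  then show ?case by (auto simp: continuous_on_eq_continuous_at intro: differentiable_imp_continuous_within)
next
  case (Suc k)
  then show ?case by auto
qed

lemma smooth_imp_differentiable: "smooth f \<Longrightarrow> f differentiable (at x)"
  unfolding smooth_def by (metis C_diff.simps(2))
lemma smooth_partial: "smooth f \<Longrightarrow> smooth (partial_deriv i f)"
  unfolding smooth_def by (metis C_diff.simps(2))
lemma smooth_imp_continuous: "smooth f \<Longrightarrow> continuous_on S f"
  unfolding smooth_def using continuous_on_subset by (metis C_diff.simps(1) subset_UNIV)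

lemma smooth_has_derivative: "smooth f \<Longrightarrow> (f has_derivative (\<lambda>v. grad f x \<bullet> v)) (at x)"
  by (intro has_derivative_grad smooth_imp_differentiable)

lemma C_diff_SucI:
  assumes "\<And>x. (f has_derivative f' x) (at x)" "\<And>i. C_diff k (\<lambda>x. f' x (axis i 1))"
  shows "C_diff (Suc k) f"
proof -
  have "partial_deriv i f = (\<lambda>x. f' x (axis i 1))" for i
    using partial_deriv_eq[OF assms(1)] by auto
  then show ?thesis using assms by (auto simp: differentiable_def)
qed

lemma C_diff_const: "C_diff k (\<lambda>x. c)"
proof (induction k arbitrary: c)
  case (Suc k)
  show ?case by (rule C_diff_SucI[where f' = "\<lambda>x v. 0"]) (auto simp: Suc)
qed simp

lemma C_diff_add: "C_diff k f \<Longrightarrow> C_diff k g \<Longrightarrow> C_diff k (\<lambda>x. f x + g x)"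
proof (induction k arbitrary: f g)
  case 0 then show ?case by (auto intro: continuous_intros)
next
  case (Suc k)
  then have d: "(f has_derivative (\<lambda>v. grad f x \<bullet> v)) (at x)" "(g has_derivative (\<lambda>v. grad g x \<bullet> v)) (at x)" for x
    by (auto intro: has_derivative_grad)
  have "C_diff k (\<lambda>x. partial_deriv i f x + partial_deriv i g x)" for i using Suc by simp
  then show ?case
    by (intro C_diff_SucI[where f' = "\<lambda>x v. grad f x \<bullet> v + grad g x \<bullet> v"] has_derivative_add d)
       (simp add: grad_def inner_axis)
qed

lemma C_diff_mult: "C_diff k f \<Longrightarrow> C_diff k g \<Longrightarrow> C_diff k (\<lambda>x. f x * g x)"
proof (induction k arbitrary: f g)
  case 0 then show ?case by (auto intro: continuous_intros)
next
  case (Suc k)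
  then have d: "(f has_derivative (\<lambda>v. grad f x \<bullet> v)) (at x)" "(g has_derivative (\<lambda>v. grad g x \<bullet> v)) (at x)" for x
    by (auto intro: has_derivative_grad)
  have "C_diff k f" "C_diff k g" using Suc C_diff_Suc_imp by blast+
  then have "C_diff k (\<lambda>x. f x * partial_deriv i g x + partial_deriv i f x * g x)" for i
    using Suc by (intro C_diff_add Suc.IH) auto
  then show ?case
    by (intro C_diff_SucI[where f' = "\<lambda>x v. f x * (grad g x \<bullet> v) + (grad f x \<bullet> v) * g x"] has_derivative_mult d)
       (simp add: grad_def inner_axis)
qed

lemma C_diff_inverse:
  assumes "smooth f" "\<And>x. f x \<noteq> 0" shows "C_diff k (\<lambda>x. inverse (f x))"
proof (induction k)
  case 0 then show ?case using assms smooth_imp_continuous[of f UNIV] by (auto intro: continuous_intros)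
next
  case (Suc k)
  have "C_diff k (\<lambda>x. - 1 * (inverse (f x) * partial_deriv i f x * inverse (f x)))" for i
    using smooth_partial[OF assms(1), of i] by (intro C_diff_mult C_diff_const Suc) (auto simp: smooth_def)
  then show ?case
    using assms
    by (intro C_diff_SucI[where f' = "\<lambda>x v. - (inverse (f x) * (grad f x \<bullet> v) * inverse (f x))"]
        Deriv.has_derivative_inverse smooth_has_derivative) (auto simp: grad_def inner_axis)
qed

lemma smooth_const: "smooth (\<lambda>x. c)" by (simp add: smooth_def C_diff_const)
lemma smooth_add: "smooth f \<Longrightarrow> smooth g \<Longrightarrow> smooth (\<lambda>x. f x + g x)" by (simp add: smooth_def C_diff_add)
lemma smooth_mult: "smooth f \<Longrightarrow> smooth g \<Longrightarrow> smooth (\<lambda>x. f x * g x)" by (simp add: smooth_def C_diff_mult)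
lemma smooth_inverse: "smooth f \<Longrightarrow> (\<And>x. f x \<noteq> 0) \<Longrightarrow> smooth (\<lambda>x. inverse (f x))"
  using C_diff_inverse smooth_def by blast
lemma smooth_cmult: "smooth f \<Longrightarrow> smooth (\<lambda>x. c * f x)" by (intro smooth_mult smooth_const)
lemma smooth_diff: "smooth f \<Longrightarrow> smooth g \<Longrightarrow> smooth (\<lambda>x. f x - g x)"
  using smooth_add[of f "\<lambda>x. -1 * g x"] smooth_cmult[of g "-1"] by simp
lemma smooth_sum: "finite A \<Longrightarrow> (\<And>a. a \<in> A \<Longrightarrow> smooth (f a)) \<Longrightarrow> smooth (\<lambda>x. \<Sum>a\<in>A. f a x)"
  by (induction A rule: finite_induct) (auto intro: smooth_add smooth_const)
lemma smooth_prod: "finite A \<Longrightarrow> (\<And>a. a \<in> A \<Longrightarrow> smooth (f a)) \<Longrightarrow> smooth (\<lambda>x. \<Prod>a\<in>A. f a x)"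
  by (induction A rule: finite_induct) (auto intro: smooth_mult smooth_const)

lemma smooth_component: "smooth (\<lambda>x::real^'n::finite. x $ i)"
proof -
  have "C_diff k (\<lambda>x::real^'n. x $ i)" for k
  proof (cases k)
    case (Suc m)
    show ?thesis unfolding Suc
      by (rule C_diff_SucI[where f' = "\<lambda>x v. v $ i"])
         (auto intro!: bounded_linear_imp_has_derivative bounded_linear_vec_nth C_diff_const)
  qed (auto intro: continuous_intros)
  then show ?thesis by (simp add: smooth_def)
qed

lemma smooth_norm_squared: "smooth (\<lambda>x. (norm (x - a))\<^sup>2)"
proof -
  have "smooth (\<lambda>x. \<Sum>i\<in>UNIV. (x $ i - a $ i) * (x $ i - a $ i))"
    by (intro smooth_sum smooth_mult smooth_diff smooth_component smooth_const) auto
  moreover have "(norm (x - a))\<^sup>2 = (\<Sum>i\<in>UNIV. (x $ i - a $ i) * (x $ i - a $ i))" for x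
    by (simp add: power2_norm_eq_inner inner_vec_def)
  ultimately show ?thesis by simp
qed

lemma partial_deriv_translate:
  assumes "f differentiable (at (x + h))"
  shows "partial_deriv i (\<lambda>x. f (x + h)) x = partial_deriv i f (x + h)"
proof -
  have "((\<lambda>x. f (x + h)) has_derivative (\<lambda>v. grad f (x + h) \<bullet> v)) (at x)"
  proof -
    have "((\<lambda>x. x + h) has_derivative (\<lambda>v. v)) (at x)" by (auto intro!: derivative_eq_intros)
    from has_derivative_compose[OF this has_derivative_grad[OF assms]] show ?thesis .
  qed
  then show ?thesis by (simp add: partial_deriv_eq grad_def inner_axis)
qed

lemma C_diff_translate: "C_diff k f \<Longrightarrow> C_diff k (\<lambda>x. f (x + h))"
proof (induction k arbitrary: f)
  case 0
  then show ?case by (auto intro!: continuous_intros continuous_on_compose2[of UNIV f])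
next
  case (Suc k)
  have "(\<lambda>x. partial_deriv i (\<lambda>x. f (x + h)) x) = (\<lambda>x. partial_deriv i f (x + h))" for i
    using Suc.prems by (intro ext partial_deriv_translate) auto
  moreover have "(\<lambda>x. f (x + h)) differentiable (at x)" for x
  proof -
    have "(\<lambda>x. x + h) differentiable (at x)" by (intro derivative_intros)
    moreover have "f differentiable (at (x + h))" using Suc.prems by simp
    ultimately show ?thesis using differentiable_chain_at[of "\<lambda>x. x + h" x f] by (simp add: o_def)
  qed
  ultimately show ?case using Suc by auto
qed

lemma smooth_translate: "smooth f \<Longrightarrow> smooth (\<lambda>x. f (x + h))"
  by (simp add: smooth_def C_diff_translate)

lemma partial_deriv_mult:
  assumes "smooth f" "smooth g"
  shows "partial_deriv i (\<lambda>x. f x * g x) x = f x * partial_deriv i g x + partial_deriv i f x * g x"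
  using partial_deriv_eq[OF has_derivative_mult[OF smooth_has_derivative[OF assms(1)] smooth_has_derivative[OF assms(2)]]]
  by (simp add: grad_def inner_axis)

text \<open>The class of functions \<open>P(1/t) exp(-1/t)\<close>, extended by zero to \<open>t \<le> 0\<close>, is closed under
  differentiation. This makes \<open>exp(-1/t)\<close> smooth by an induction that treats all of them at once.\<close>

definition flat :: "real poly \<Rightarrow> real \<Rightarrow> real" where
  "flat P t = (if t > 0 then poly P (1 / t) * exp (- (1 / t)) else 0)"

lemma poly_exp_decay: "((\<lambda>x. poly P x * exp (- x)) \<longlongrightarrow> (0::real)) at_top"
proof -
  have "((\<lambda>x. \<Sum>i\<le>degree P. coeff P i * (x ^ i / exp x)) \<longlongrightarrow> (\<Sum>i\<le>degree P. coeff P i * 0)) at_top"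
    by (intro tendsto_sum tendsto_mult tendsto_const tendsto_power_div_exp_0)
  then show ?thesis by (simp add: poly_altdef sum_distrib_right exp_minus divide_inverse mult.assoc)
qed

lemma flat_tendsto_0: "(flat P \<longlongrightarrow> 0) (at 0)"
proof -
  have "((\<lambda>t. poly P (1 / t) * exp (- (1 / t))) \<longlongrightarrow> 0) (at_right 0)"
    by (rule filterlim_compose[OF poly_exp_decay]) (simp add: filterlim_inverse_at_top_right flip: inverse_eq_divide)
  then have "(flat P \<longlongrightarrow> 0) (at_right 0)"
    by (rule Lim_transform_eventually) (auto simp: flat_def eventually_at_filter)
  moreover have "(flat P \<longlongrightarrow> 0) (at_left 0)"
    by (rule Lim_transform_eventually[OF tendsto_const]) (auto simp: flat_def eventually_at_filter)
  ultimately show ?thesis by (simp add: filterlim_split_at)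
qed

text \<open>At \<open>0\<close> the difference quotient of \<open>flat P\<close> is \<open>flat ([:0,1:] * P)\<close>, a function of the same
  class, which tends to \<open>0\<close>.\<close>

lemma flat_deriv: "(flat P has_real_derivative flat ([:0,0,1:] * (P - pderiv P)) t) (at t)"
proof -
  consider "t > 0" | "t < 0" | "t = 0" by linarith
  then show ?thesis
  proof cases
    case 1
    have "((\<lambda>t. poly P (1 / t) * exp (- (1 / t))) has_real_derivative flat ([:0,0,1:] * (P - pderiv P)) t) (at t)"
    proof -
      have "((\<lambda>t. poly P (1 / t)) has_real_derivative poly (pderiv P) (1 / t) * (- 1 / t\<^sup>2)) (at t)"
        by (rule DERIV_chain2[OF poly_DERIV]) (use 1 in \<open>auto intro!: derivative_eq_intros simp: power2_eq_square\<close>)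
      moreover have "((\<lambda>t. exp (- (1 / t))) has_real_derivative exp (- (1 / t)) * (1 / t\<^sup>2)) (at t)"
        using 1 by (auto intro!: derivative_eq_intros simp: power2_eq_square)
      ultimately have "((\<lambda>t. poly P (1 / t) * exp (- (1 / t))) has_real_derivative
          poly (pderiv P) (1 / t) * (- 1 / t\<^sup>2) * exp (- (1 / t)) + exp (- (1 / t)) * (1 / t\<^sup>2) * poly P (1 / t)) (at t)"
        using DERIV_mult by blast
      then show ?thesis using 1
        by (rule_tac DERIV_cong) (auto simp: flat_def power2_eq_square algebra_simps)
    qed
    then show ?thesis
      by (rule has_field_derivative_transform_within_open[where S = "{0<..}"]) (use 1 in \<open>auto simp: flat_def\<close>)
  next
    case 2
    have "((\<lambda>t. 0) has_real_derivative flat ([:0,0,1:] * (P - pderiv P)) t) (at t)"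
      using 2 by (simp add: flat_def)
    then show ?thesis
      by (rule has_field_derivative_transform_within_open[where S = "{..<0}"]) (use 2 in \<open>auto simp: flat_def\<close>)
  next
    case 3
    have "((\<lambda>y. (flat P y - flat P 0) / (y - 0)) \<longlongrightarrow> 0) (at 0)"
      by (rule Lim_transform_eventually[OF flat_tendsto_0[of "[:0,1:] * P"]]) (auto simp: flat_def)
    then show ?thesis unfolding 3 has_field_derivative_iff by (simp add: flat_def)
  qed
qed

lemma C_diff_flat:
  assumes "smooth g" shows "C_diff k (\<lambda>x. flat P (g x))"
proof (induction k arbitrary: P)
  case 0
  have "continuous_on UNIV (flat P)"
    by (meson flat_deriv DERIV_continuous continuous_at_imp_continuous_on)
  then show ?case using smooth_imp_continuous[OF assms] by (auto intro: continuous_on_compose2)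
next
  case (Suc k)
  let ?Q = "[:0,0,1:] * (P - pderiv P)"
  have d: "((\<lambda>x. flat P (g x)) has_derivative (\<lambda>v. (grad g x \<bullet> v) * flat ?Q (g x))) (at x)" for x
    using has_derivative_compose[OF smooth_has_derivative[OF assms] flat_deriv[unfolded has_field_derivative_def]]
    by (simp add: mult.commute)
  have "C_diff k (\<lambda>x. partial_deriv i g x * flat ?Q (g x))" for i
    using smooth_partial[OF assms] by (intro C_diff_mult Suc.IH) (auto simp: smooth_def)
  then show ?case by (intro C_diff_SucI[OF d]) (simp add: grad_def inner_axis)
qed

definition bump :: "real \<Rightarrow> real" where "bump t = (if t > 0 then exp (- (1 / t)) else 0)"

lemma smooth_bump: "smooth g \<Longrightarrow> smooth (\<lambda>x. bump (g x))"
proof -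
  assume "smooth g"
  from C_diff_flat[OF this, of _ 1] have "smooth (\<lambda>x. flat 1 (g x))" by (simp add: smooth_def)
  moreover have "flat 1 = bump" by (auto simp: flat_def bump_def)
  ultimately show ?thesis by simp
qed

lemma bump_bounds: "0 \<le> bump t" "bump t \<le> 1" by (auto simp: bump_def)
lemma bump_zero_iff: "bump t = 0 \<longleftrightarrow> t \<le> 0" by (auto simp: bump_def)

lemma test_functionI:
  assumes "smooth \<phi>" "compact K" "\<And>x. x \<notin> K \<Longrightarrow> \<phi> x = 0" "K \<subseteq> \<Omega>"
  shows "\<phi> \<in> test_function \<Omega>"
proof -
  have "closure {x. \<phi> x \<noteq> 0} \<subseteq> K" using assms by (intro closure_minimal) (auto intro: compact_imp_closed)
  moreover from this have "compact (closure {x. \<phi> x \<noteq> 0})"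
    using compact_Int_closed[OF assms(2), of "closure {x. \<phi> x \<noteq> 0}"] by (simp add: Int_absorb1)
  ultimately show ?thesis using assms by (auto simp: test_function_def smooth_def)
qed

lemma test_functionE:
  assumes "\<phi> \<in> test_function \<Omega>"
  obtains K where "smooth \<phi>" "compact K" "\<And>x. x \<notin> K \<Longrightarrow> \<phi> x = 0" "K \<subseteq> \<Omega>" "K = closure {x. \<phi> x \<noteq> 0}"
proof (rule that[of "closure {x. \<phi> x \<noteq> 0}"])
  have s: "(\<forall>k. C_diff k \<phi>) \<and> compact (closure {x. \<phi> x \<noteq> 0}) \<and> closure {x. \<phi> x \<noteq> 0} \<subseteq> \<Omega>"
    using assms unfolding test_function_def by (rule CollectD)
  show "smooth \<phi>" using s unfolding smooth_def by (rule conjunct1)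
  show "compact (closure {x. \<phi> x \<noteq> 0})" "closure {x. \<phi> x \<noteq> 0} \<subseteq> \<Omega>" using s by (iprover)+
  show "\<phi> x = 0" if "x \<notin> closure {x. \<phi> x \<noteq> 0}" for x
    using that closure_subset[of "{x. \<phi> x \<noteq> 0}"] by auto
qed (rule refl)

lemma partial_deriv_outside:
  assumes "closed K" "\<And>x. x \<notin> K \<Longrightarrow> \<phi> x = 0" "x \<notin> K"
  shows "partial_deriv i \<phi> x = 0"
proof -
  have "(\<phi> has_derivative (\<lambda>v. 0)) (at x)"
    by (rule has_derivative_transform_within_open[where f = "\<lambda>x. 0" and s = "- K"]) (use assms in auto)
  from partial_deriv_eq[OF this] show ?thesis .
qed

lemma grad_outside:
  assumes "closed K" "\<And>x. x \<notin> K \<Longrightarrow> \<phi> x = 0" "x \<notin> K"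
  shows "grad \<phi> x = 0"
  using partial_deriv_outside[OF assms] by (simp add: grad_def vec_eq_iff)

lemma continuous_grad: "smooth \<phi> \<Longrightarrow> continuous_on S (grad \<phi>)"
  unfolding grad_def by (intro continuous_intros smooth_imp_continuous smooth_partial)

lemma compact_support_bounded:
  fixes g :: "'a::euclidean_space \<Rightarrow> 'b::real_normed_vector"
  assumes "continuous_on UNIV g" "compact K" "\<And>x. x \<notin> K \<Longrightarrow> g x = 0"
  obtains B where "B > 0" "\<And>x. norm (g x) \<le> B"
proof -
  have "compact (g ` K)" using assms(2) continuous_on_subset[OF assms(1), of K] by (intro compact_continuous_image) auto
  then obtain B where "B > 0" "\<forall>y\<in>g ` K. norm y \<le> B" using compact_imp_bounded bounded_pos by metis
  then have "norm (g x) \<le> B" for x using assms(3)[of x] by (cases "x \<in> K") auto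
  with \<open>B > 0\<close> show ?thesis using that by blast
qed

lemma test_function_bounds:
  assumes "\<phi> \<in> test_function \<Omega>"
  obtains B where "B > 0" "\<And>x. \<bar>\<phi> x\<bar> \<le> B" "\<And>x. norm (grad \<phi> x) \<le> B"
proof -
  obtain K where K: "smooth \<phi>" "compact K" "\<And>x. x \<notin> K \<Longrightarrow> \<phi> x = 0" using test_functionE[OF assms] by metis
  obtain A where A: "A > 0" "\<And>x. norm (\<phi> x) \<le> A"
    using compact_support_bounded[OF smooth_imp_continuous[OF K(1)] K(2,3)] by blast
  obtain B where B: "B > 0" "\<And>x. norm (grad \<phi> x) \<le> B"
    using compact_support_bounded[OF continuous_grad[OF K(1)] K(2) grad_outside[OF compact_imp_closed[OF K(2)] K(3)]] by blast
  show ?thesis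
  proof (rule that[of "A + B"])
    show "\<bar>\<phi> x\<bar> \<le> A + B" for x using A(2)[of x] B(1) by simp
    show "norm (grad \<phi> x) \<le> A + B" for x using B(2)[of x] A(1) by simp
  qed (use A B in simp)
qed

lemma test_function_partial: "\<phi> \<in> test_function \<Omega> \<Longrightarrow> partial_deriv i \<phi> \<in> test_function \<Omega>"
proof (erule test_functionE)
  fix K assume K: "smooth \<phi>" "compact K" "\<And>x. x \<notin> K \<Longrightarrow> \<phi> x = 0" "K \<subseteq> \<Omega>"
  show ?thesis
    by (rule test_functionI[OF smooth_partial[OF K(1)] K(2) partial_deriv_outside[OF compact_imp_closed[OF K(2)] K(3)] K(4)])
qed

lemma smooth_lipschitz:
  assumes "smooth \<phi>" "\<And>x. norm (grad \<phi> x) \<le> B"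
  shows "\<bar>\<phi> (x + h) - \<phi> x\<bar> \<le> B * norm h"
proof -
  have "norm (\<phi> (x + h) - \<phi> x) \<le> B * norm (x + h - x)"
  proof (rule differentiable_bound[of UNIV _ "\<lambda>x v. grad \<phi> x \<bullet> v"])
    fix y
    show "(\<phi> has_derivative (\<lambda>v. grad \<phi> y \<bullet> v)) (at y within UNIV)" using smooth_has_derivative[OF assms(1)] by simp
    show "onorm (\<lambda>v. grad \<phi> y \<bullet> v) \<le> B"
    proof (rule onorm_le)
      fix v
      have "norm (grad \<phi> y \<bullet> v) \<le> norm (grad \<phi> y) * norm v" by (simp add: Cauchy_Schwarz_ineq2)
      also have "\<dots> \<le> B * norm v" using assms(2)[of y] by (intro mult_right_mono) auto
      finally show "norm (grad \<phi> y \<bullet> v) \<le> B * norm v" .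
    qed
  qed auto
  then show ?thesis by simp
qed

text \<open>With \<open>A\<close> positive exactly inside the ball of radius \<open>R\<close> and \<open>B\<close> positive exactly outside the
  one of radius \<open>r\<close>, the quotient \<open>A / (A + B)\<close> is the cutoff.\<close>

lemma ball_cutoff:
  fixes r R :: real
  assumes "0 < r" "r < R"
  obtains \<eta> :: "real^'n::finite \<Rightarrow> real" where "smooth \<eta>" "\<And>x. 0 \<le> \<eta> x" "\<And>x. \<eta> x \<le> 1" "\<And>x. norm x \<le> r \<Longrightarrow> \<eta> x = 1"
    "\<And>x. R \<le> norm x \<Longrightarrow> \<eta> x = 0"
proof -
  define A where "A x = bump (R\<^sup>2 - (norm (x - 0))\<^sup>2)" for x :: "real^'n"
  define B where "B x = bump ((norm (x - 0))\<^sup>2 - r\<^sup>2)" for x :: "real^'n"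
  have AB: "smooth A" "smooth B" unfolding A_def B_def
    by (intro smooth_bump smooth_diff smooth_const smooth_norm_squared)+
  have nn: "0 \<le> A x" "0 \<le> B x" for x by (auto simp: A_def B_def bump_bounds)
  have "r\<^sup>2 < R\<^sup>2" using assms by (intro power_strict_mono) auto
  then have "A x \<noteq> 0 \<or> B x \<noteq> 0" for x by (auto simp: A_def B_def bump_zero_iff)
  then have pos: "A x + B x > 0" for x using nn[of x] by (metis add_nonneg_eq_0_iff add_nonneg_nonneg less_eq_real_def)
  show ?thesis
  proof (rule that[of "\<lambda>x. A x * inverse (A x + B x)"])
    show "smooth (\<lambda>x. A x * inverse (A x + B x))"
      by (intro smooth_mult smooth_inverse smooth_add AB) (use pos in \<open>metis less_irrefl\<close>)
    show "0 \<le> A x * inverse (A x + B x)" "A x * inverse (A x + B x) \<le> 1" for x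
      using nn[of x] pos[of x] by (auto simp: divide_simps)
    show "A x * inverse (A x + B x) = 1" if "norm x \<le> r" for x
    proof -
      have "B x = 0" using that assms by (auto simp: B_def bump_zero_iff intro: power_mono)
      then show ?thesis using pos[of x] by simp
    qed
    show "A x * inverse (A x + B x) = 0" if "R \<le> norm x" for x
    proof -
      have "A x = 0" using that assms by (auto simp: A_def bump_zero_iff intro: power_mono)
      then show ?thesis by simp
    qed
  qed
qed

lemma bump_tendsto_1: "t > 0 \<Longrightarrow> (\<lambda>k. bump (real (Suc k) * t)) \<longlonglongrightarrow> 1"
proof -
  assume t: "t > 0"
  have "(\<lambda>k. exp (- (inverse (real (Suc k)) * (1 / t)))) \<longlonglongrightarrow> exp (- (0 * (1 / t)))"
    by (intro tendsto_intros LIMSEQ_inverse_real_of_nat)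
  then show ?thesis using t by (simp add: bump_def divide_inverse)
qed

text \<open>A product of bumps \<open>exp(-1/t)\<close> in the distances to the faces of the box; stretching the argument
  by \<open>Suc k\<close> drives every factor to \<open>1\<close> inside.\<close>

lemma box_approximation:
  fixes a b :: "real^'n::finite"
  obtains \<phi> :: "nat \<Rightarrow> real^'n \<Rightarrow> real" where "\<And>k. smooth (\<phi> k)" "\<And>k x. 0 \<le> \<phi> k x" "\<And>k x. \<phi> k x \<le> 1"
    "\<And>k x. x \<notin> cbox a b \<Longrightarrow> \<phi> k x = 0" "\<And>x. x \<in> box a b \<Longrightarrow> (\<lambda>k. \<phi> k x) \<longlonglongrightarrow> 1"
proof
  define \<phi> where "\<phi> k x = (\<Prod>i\<in>UNIV. bump (real (Suc k) * (x $ i - a $ i)) * bump (real (Suc k) * (b $ i - x $ i)))" for k and x :: "real^'n"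
  show "smooth (\<phi> k)" for k unfolding \<phi>_def
    by (intro smooth_prod smooth_mult smooth_bump smooth_diff smooth_component smooth_const) auto
  show "0 \<le> \<phi> k x" for k x unfolding \<phi>_def by (intro prod_nonneg) (auto simp: bump_bounds)
  show "\<phi> k x \<le> 1" for k x unfolding \<phi>_def by (intro prod_le_1) (auto simp: bump_bounds mult_le_one)
  show "\<phi> k x = 0" if "x \<notin> cbox a b" for k x
  proof -
    from that obtain i where "x $ i < a $ i \<or> b $ i < x $ i" by (auto simp: mem_box_cart not_le)
    then have "bump (real (Suc k) * (x $ i - a $ i)) * bump (real (Suc k) * (b $ i - x $ i)) = 0"
      by (auto simp: bump_zero_iff mult_le_0_iff)
    then show ?thesis unfolding \<phi>_def by (intro prod_zero) auto
  qed
  show "(\<lambda>k. \<phi> k x) \<longlonglongrightarrow> 1" if "x \<in> box a b" for x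
  proof -
    have "(\<lambda>k. \<phi> k x) \<longlonglongrightarrow> (\<Prod>i\<in>(UNIV::'n set). 1 * 1)" unfolding \<phi>_def
      using that by (intro tendsto_prod tendsto_mult bump_tendsto_1) (auto simp: mem_box_cart)
    then show ?thesis by simp
  qed
qed

section \<open>Translations and extension by zero\<close>

lemma integral_lebesgue_on_support:
  fixes g :: "'a::euclidean_space \<Rightarrow> 'b::euclidean_space"
  assumes "S \<in> sets lebesgue" "\<And>x. x \<notin> S \<Longrightarrow> g x = 0"
  shows "integral\<^sup>L (lebesgue_on S) g = integral\<^sup>L lebesgue g"
    and "integrable (lebesgue_on S) g \<longleftrightarrow> integrable lebesgue g"
    and "g \<in> borel_measurable (lebesgue_on S) \<longleftrightarrow> g \<in> borel_measurable lebesgue"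
proof -
  have e: "(\<lambda>x. if x \<in> S then g x else 0) = g" using assms(2) by auto
  show "integral\<^sup>L (lebesgue_on S) g = integral\<^sup>L lebesgue g"
    using Lebesgue_Measure.integral_restrict_UNIV[OF assms(1), of g] unfolding e by simp
  show "integrable (lebesgue_on S) g \<longleftrightarrow> integrable lebesgue g"
    using Lebesgue_Measure.integrable_restrict_UNIV[OF assms(1), of g] unfolding e by simp
  show "g \<in> borel_measurable (lebesgue_on S) \<longleftrightarrow> g \<in> borel_measurable lebesgue"
    using borel_measurable_if[OF assms(1), of g] unfolding e by simp
qed

lemma smooth_borel_measurable: "smooth \<phi> \<Longrightarrow> \<phi> \<in> borel_measurable lebesgue"
  using smooth_imp_continuous[of \<phi> UNIV] by (auto intro!: measurable_completion simp: borel_measurable_continuous_onI)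

lemma AE_lebesgue_on_iff: "S \<in> sets lebesgue \<Longrightarrow> (AE x in lebesgue_on S. P x) \<longleftrightarrow> (AE x in lebesgue. x \<in> S \<longrightarrow> P x)"
  by (simp add: AE_restrict_space_iff)

lemma translation_measurable: "(\<lambda>x. x + h) \<in> lebesgue \<rightarrow>\<^sub>M (lebesgue :: 'a::euclidean_space measure)"
  using lebesgue_affine_measurable[of "\<lambda>_. 1" h] by (simp add: euclidean_representation add.commute)

lemma lebesgue_translation: "distr lebesgue lebesgue (\<lambda>x. x + h) = (lebesgue :: 'a::euclidean_space measure)"
proof -
  have "(lebesgue :: 'a measure) = density (distr lebesgue lebesgue (\<lambda>x. x + h)) (\<lambda>_. 1)"
    using lebesgue_affine_euclidean[of "\<lambda>_. 1" h] by (simp add: euclidean_representation add.commute)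
  then show ?thesis by (simp add: density_1)
qed

lemma lebesgue_translate:
  fixes f :: "'a::euclidean_space \<Rightarrow> 'b::{banach,second_countable_topology}"
  shows "integrable lebesgue f \<Longrightarrow> integrable lebesgue (\<lambda>x. f (x + h))"
    and "f \<in> borel_measurable lebesgue \<Longrightarrow> (\<integral>x. f (x + h) \<partial>lebesgue) = (\<integral>x. f x \<partial>lebesgue)"
    and "f \<in> borel_measurable lebesgue \<Longrightarrow> (\<lambda>x. f (x + h)) \<in> borel_measurable lebesgue"
    and "(AE x in lebesgue. P x) \<Longrightarrow> (AE x in lebesgue. P (x + h))"
proof -
  note [measurable] = translation_measurable[of h]
  show "integrable lebesgue f \<Longrightarrow> integrable lebesgue (\<lambda>x. f (x + h))"
    by (rule integrable_distr[of _ lebesgue lebesgue]) (auto simp: lebesgue_translation translation_measurable)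
  show "f \<in> borel_measurable lebesgue \<Longrightarrow> (\<integral>x. f (x + h) \<partial>lebesgue) = (\<integral>x. f x \<partial>lebesgue)"
    using integral_distr[OF translation_measurable, of f h] by (simp add: lebesgue_translation)
  show "f \<in> borel_measurable lebesgue \<Longrightarrow> (\<lambda>x. f (x + h)) \<in> borel_measurable lebesgue"
    using measurable_compose[OF translation_measurable] by blast
  show "(AE x in lebesgue. P x) \<Longrightarrow> (AE x in lebesgue. P (x + h))"
  proof -
    assume "AE x in lebesgue. P x"
    then obtain N where N: "N \<in> null_sets lebesgue" "{x. \<not> P x} \<subseteq> N" by (auto simp: eventually_ae_filter)
    have "(\<lambda>x. x + h) -` N \<inter> space lebesgue \<in> null_sets lebesgue"
      using N(1) null_sets_distr_iff[OF translation_measurable, of N h] by (simp add: lebesgue_translation null_sets_def)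
    then show ?thesis using N(2) by (auto intro!: AE_I' simp: subset_iff)
  qed
qed

text \<open>Extension by zero makes shifted functions and their integrals total, so that translation
  invariance applies on the whole space.\<close>

definition zero_ext :: "'a set \<Rightarrow> ('a \<Rightarrow> 'b::zero) \<Rightarrow> 'a \<Rightarrow> 'b" where
  "zero_ext S f x = (if x \<in> S then f x else 0)"

lemma zero_ext_in [simp]: "x \<in> S \<Longrightarrow> zero_ext S f x = f x" by (simp add: zero_ext_def)

lemma in_Lp_zero_ext:
  fixes f :: "'a::euclidean_space \<Rightarrow> 'b::euclidean_space"
  assumes "S \<in> sets lebesgue" "r > 0"
  shows "in_Lp lebesgue r (zero_ext S f) \<longleftrightarrow> in_Lp (lebesgue_on S) r f"
    and "(\<integral>x. norm (zero_ext S f x) powr r \<partial>lebesgue) = (\<integral>x. norm (f x) powr r \<partial>lebesgue_on S)"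
proof -
  have e: "(\<lambda>x. norm (zero_ext S f x) powr r) = (\<lambda>x. if x \<in> S then norm (f x) powr r else 0)"
    by (auto simp: zero_ext_def fun_eq_iff)
  have m: "zero_ext S f = (\<lambda>x. if x \<in> S then f x else 0)" by (auto simp: zero_ext_def)
  show "in_Lp lebesgue r (zero_ext S f) \<longleftrightarrow> in_Lp (lebesgue_on S) r f"
    unfolding in_Lp_def e unfolding m
    using borel_measurable_if[OF assms(1), of f] Lebesgue_Measure.integrable_restrict_UNIV[OF assms(1), of "\<lambda>x. norm (f x) powr r"] by simp
  show "(\<integral>x. norm (zero_ext S f x) powr r \<partial>lebesgue) = (\<integral>x. norm (f x) powr r \<partial>lebesgue_on S)"
    unfolding e using Lebesgue_Measure.integral_restrict_UNIV[OF assms(1), of "\<lambda>x. norm (f x) powr r"] by simp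
qed

lemma in_Lp_subset:
  fixes f :: "'a::euclidean_space \<Rightarrow> 'b::euclidean_space"
  assumes "S \<in> sets lebesgue" "T \<in> sets lebesgue" "S \<subseteq> T" "r > 0" "in_Lp (lebesgue_on T) r f"
  shows "in_Lp (lebesgue_on S) r f"
    and "(\<integral>x. norm (f x) powr r \<partial>lebesgue_on S) \<le> (\<integral>x. norm (f x) powr r \<partial>lebesgue_on T)"
proof -
  have T: "in_Lp lebesgue r (zero_ext T f)" using assms by (simp add: in_Lp_zero_ext)
  have "f \<in> borel_measurable (lebesgue_on T)" using assms(5) by (rule in_Lp_measurable)
  then have m: "f \<in> borel_measurable (lebesgue_on S)"
    using assms(3) measurable_restrict_mono by blast
  have S: "in_Lp lebesgue r (zero_ext S f)"
  proof (rule in_Lp_bound[OF assms(4) T, where C = 1])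
    show "zero_ext S f \<in> borel_measurable lebesgue"
      using borel_measurable_if_I[OF m assms(1)] by (simp add: zero_ext_def[abs_def])
  qed (use assms(3) in \<open>auto simp: zero_ext_def\<close>)
  then show "in_Lp (lebesgue_on S) r f" using assms by (simp add: in_Lp_zero_ext)
  show "(\<integral>x. norm (f x) powr r \<partial>lebesgue_on S) \<le> (\<integral>x. norm (f x) powr r \<partial>lebesgue_on T)"
    unfolding in_Lp_zero_ext(2)[OF assms(1,4), symmetric] in_Lp_zero_ext(2)[OF assms(2,4), symmetric]
    using S T assms(3) by (intro integral_mono) (auto simp: in_Lp_def zero_ext_def)
qed

lemma in_Lp_translate:
  fixes f :: "'a::euclidean_space \<Rightarrow> 'b::euclidean_space"
  assumes "in_Lp lebesgue r f"
  shows "in_Lp lebesgue r (\<lambda>x. f (x + h))"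
  using assms lebesgue_translate(1)[of "\<lambda>x. norm (f x) powr r" h] lebesgue_translate(3)[of f h]
  by (simp add: in_Lp_def)

lemma finite_lebesgue_on_bounded:
  assumes "bounded S" "S \<in> sets lebesgue" shows "finite_measure (lebesgue_on S)"
  by (rule finite_measure_lebesgue_on[OF bounded_set_imp_lmeasurable[OF assms]])

section \<open>Weak gradients\<close>

lemma locally_integrable_mult:
  fixes f g :: "'a::euclidean_space \<Rightarrow> real"
  assumes "f locally_integrable_on \<Omega>" "compact K" "K \<subseteq> \<Omega>" "continuous_on UNIV g" "\<And>x. x \<notin> K \<Longrightarrow> g x = 0"
  shows "integrable lebesgue (\<lambda>x. f x * g x)"
proof -
  have K: "K \<in> sets lebesgue" by (rule fmeasurableD[OF lmeasurable_compact[OF assms(2)]])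
  have "integrable (lebesgue_on K) f" using assms(1-3) unfolding locally_integrable_on_def by blast
  then have f: "integrable lebesgue (\<lambda>x. if x \<in> K then f x else 0)"
    using Lebesgue_Measure.integrable_restrict_UNIV[OF K, of f] by simp
  obtain B where B: "B > 0" "\<And>x. norm (g x) \<le> B" using compact_support_bounded[OF assms(4,2,5)] by blast
  have [measurable]: "g \<in> borel_measurable lebesgue"
    using assms(4) by (intro measurable_completion) (simp add: borel_measurable_continuous_onI)
  have e: "(\<lambda>x. f x * g x) = (\<lambda>x. (if x \<in> K then f x else 0) * g x)" using assms(5) by auto
  show ?thesis unfolding e
  proof (rule Bochner_Integration.integrable_bound)
    show "integrable lebesgue (\<lambda>x. B * norm (if x \<in> K then f x else 0))" using f by auto
    show "(\<lambda>x. (if x \<in> K then f x else 0) * g x) \<in> borel_measurable lebesgue"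
      using f by (intro borel_measurable_times) auto
    show "AE x in lebesgue. norm ((if x \<in> K then f x else 0) * g x) \<le> norm (B * norm (if x \<in> K then f x else 0))"
      using B by (auto simp: abs_mult mult.commute[of B] intro!: mult_left_mono)
  qed
qed

lemma locally_integrable_component:
  fixes G :: "real^'n::finite \<Rightarrow> real^'n"
  shows "G locally_integrable_on \<Omega> \<Longrightarrow> (\<lambda>x. G x $ i) locally_integrable_on \<Omega>"
  by (auto simp: locally_integrable_on_def intro: integrable_bounded_linear[OF bounded_linear_vec_nth])

lemma locally_integrable_mult_test:
  assumes "f locally_integrable_on \<Omega>" "\<phi> \<in> test_function \<Omega>"
  shows "integrable lebesgue (\<lambda>x. f x * \<phi> x)"
proof -
  obtain K where K: "smooth \<phi>" "compact K" "\<And>x. x \<notin> K \<Longrightarrow> \<phi> x = 0" "K \<subseteq> \<Omega>"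
    using test_functionE[OF assms(2)] by metis
  show ?thesis using locally_integrable_mult[OF assms(1) K(2,4) smooth_imp_continuous[OF K(1)] K(3)] by simp
qed

lemma test_function_zero: "\<phi> \<in> test_function \<Omega> \<Longrightarrow> x \<notin> \<Omega> \<Longrightarrow> \<phi> x = 0"
  by (metis test_functionE subsetD)

lemma has_weak_gradient_integral:
  assumes "open \<Omega>" "has_weak_gradient \<Omega> u G" "\<phi> \<in> test_function \<Omega>"
  shows "(\<integral>x. u x * partial_deriv i \<phi> x \<partial>lebesgue) = - (\<integral>x. G x $ i * \<phi> x \<partial>lebesgue)"
    "integrable lebesgue (\<lambda>x. u x * partial_deriv i \<phi> x)" "integrable lebesgue (\<lambda>x. G x $ i * \<phi> x)"
proof -
  have O: "\<Omega> \<in> sets lebesgue" using assms(1) by auto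
  have p: "partial_deriv i \<phi> \<in> test_function \<Omega>" using assms(3) by (rule test_function_partial)
  have "(\<integral>x. u x * partial_deriv i \<phi> x \<partial>lebesgue_on \<Omega>) = - (\<integral>x. G x $ i * \<phi> x \<partial>lebesgue_on \<Omega>)"
    using assms by (auto simp: has_weak_gradient_def)
  then show "(\<integral>x. u x * partial_deriv i \<phi> x \<partial>lebesgue) = - (\<integral>x. G x $ i * \<phi> x \<partial>lebesgue)"
    using test_function_zero[OF p] test_function_zero[OF assms(3)] by (simp add: integral_lebesgue_on_support[OF O])
  show "integrable lebesgue (\<lambda>x. u x * partial_deriv i \<phi> x)"
    by (rule locally_integrable_mult_test[OF _ p]) (use assms in \<open>auto simp: has_weak_gradient_def\<close>)
  show "integrable lebesgue (\<lambda>x. G x $ i * \<phi> x)"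
    by (rule locally_integrable_mult_test[OF _ assms(3)])
       (use assms in \<open>auto simp: has_weak_gradient_def intro: locally_integrable_component\<close>)
qed

lemma has_weak_gradientI:
  assumes "open \<Omega>" "u locally_integrable_on \<Omega>" "G locally_integrable_on \<Omega>"
    "\<And>\<phi> i. \<phi> \<in> test_function \<Omega> \<Longrightarrow> (\<integral>x. u x * partial_deriv i \<phi> x \<partial>lebesgue) = - (\<integral>x. G x $ i * \<phi> x \<partial>lebesgue)"
  shows "has_weak_gradient \<Omega> u G"
proof -
  have O: "\<Omega> \<in> sets lebesgue" using assms(1) by auto
  have "(\<integral>x. u x * partial_deriv i \<phi> x \<partial>lebesgue_on \<Omega>) = - (\<integral>x. G x $ i * \<phi> x \<partial>lebesgue_on \<Omega>)"
    if "\<phi> \<in> test_function \<Omega>" for \<phi> i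
    using test_function_zero[OF test_function_partial[OF that]] test_function_zero[OF that] assms(4)[OF that]
    by (simp add: integral_lebesgue_on_support[OF O])
  then show ?thesis using assms by (auto simp: has_weak_gradient_def)
qed

lemma integrable_imp_locally_integrable:
  fixes f :: "'a::euclidean_space \<Rightarrow> 'b::euclidean_space"
  assumes "integrable (lebesgue_on \<Omega>) f" "\<Omega> \<in> sets lebesgue" shows "f locally_integrable_on \<Omega>"
  unfolding locally_integrable_on_def
proof safe
  fix K assume K: "compact K" "K \<subseteq> \<Omega>"
  then have Km: "K \<in> sets lebesgue" by (intro fmeasurableD[OF lmeasurable_compact])
  have "integrable lebesgue (\<lambda>x. indicator \<Omega> x *\<^sub>R f x)"
    using assms by (simp add: integrable_restrict_space)
  then have "set_integrable lebesgue \<Omega> f" by (simp add: set_integrable_def)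
  then have "set_integrable lebesgue K f" by (rule set_integrable_subset) (use K Km in auto)
  then show "integrable (lebesgue_on K) f" using Km by (simp add: integrable_restrict_space set_integrable_def)
qed

text \<open>The approximation of boxes by test functions shows that \<open>g\<close> has integral zero over every box in
  \<open>\<Omega>\<close>; differentiating the integral along shrinking cubes gives \<open>g = 0\<close> almost everywhere. An open
  set is a countable union of boxes.\<close>

lemma fundamental_lemma:
  fixes g :: "real^'n::finite \<Rightarrow> real"
  assumes "open \<Omega>" "g locally_integrable_on \<Omega>"
    and 0: "\<And>\<phi>. \<phi> \<in> test_function \<Omega> \<Longrightarrow> (\<integral>x. g x * \<phi> x \<partial>lebesgue) = 0"
  shows "AE x in lebesgue. x \<in> \<Omega> \<longrightarrow> g x = 0"
proof -
  have box0: "integral\<^sup>L (lebesgue_on (cbox a b)) g = 0" if ab: "cbox a b \<subseteq> \<Omega>" for a b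
  proof -
    obtain \<phi> :: "nat \<Rightarrow> real^'n \<Rightarrow> real" where \<phi>: "\<And>k. smooth (\<phi> k)" "\<And>k x. 0 \<le> \<phi> k x" "\<And>k x. \<phi> k x \<le> 1"
      "\<And>k x. x \<notin> cbox a b \<Longrightarrow> \<phi> k x = 0" "\<And>x. x \<in> box a b \<Longrightarrow> (\<lambda>k. \<phi> k x) \<longlonglongrightarrow> 1"
      using box_approximation[of a b] by metis
    have test: "\<phi> k \<in> test_function \<Omega>" for k
      by (rule test_functionI[OF \<phi>(1) compact_cbox \<phi>(4) ab])
    have g: "integrable (lebesgue_on (cbox a b)) g"
      using assms(2) ab by (auto simp: locally_integrable_on_def)
    have "(\<lambda>k. \<integral>x. g x * \<phi> k x \<partial>lebesgue_on (cbox a b)) \<longlonglongrightarrow> integral\<^sup>L (lebesgue_on (cbox a b)) g"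
    proof (rule integral_dominated_convergence)
      show "integrable (lebesgue_on (cbox a b)) (\<lambda>x. norm (g x))" using g by simp
      show "g \<in> borel_measurable (lebesgue_on (cbox a b))" using g by auto
      show "(\<lambda>x. g x * \<phi> k x) \<in> borel_measurable (lebesgue_on (cbox a b))" for k
      proof -
        have "\<phi> k \<in> borel_measurable lebesgue"
          using smooth_imp_continuous[OF \<phi>(1)] by (intro measurable_completion) (simp add: borel_measurable_continuous_onI)
        then have "\<phi> k \<in> borel_measurable (lebesgue_on (cbox a b))" by (rule measurable_restrict_space1)
        then show ?thesis using g by auto
      qed
      have "AE x in lebesgue. x \<notin> cbox a b - box a b"
        using negligible_frontier_interval[of a b] unfolding negligible_iff_null_sets by (rule AE_not_in)
      then have "AE x in lebesgue. x \<in> cbox a b \<longrightarrow> (\<lambda>k. g x * \<phi> k x) \<longlonglongrightarrow> g x"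
      proof eventually_elim
        case (elim x)
        show ?case
        proof
          assume "x \<in> cbox a b"
          then have "x \<in> box a b" using elim by auto
          from tendsto_mult[OF tendsto_const \<phi>(5)[OF this]] show "(\<lambda>k. g x * \<phi> k x) \<longlonglongrightarrow> g x" by simp
        qed
      qed
      then show "AE x in lebesgue_on (cbox a b). (\<lambda>k. g x * \<phi> k x) \<longlonglongrightarrow> g x"
        by (subst AE_lebesgue_on_iff) auto
      show "AE x in lebesgue_on (cbox a b). norm (g x * \<phi> k x) \<le> norm (g x)" for k
        using \<phi>(2,3) by (intro AE_I2) (auto simp: abs_mult mult_left_le)
    qed
    moreover have "(\<integral>x. g x * \<phi> k x \<partial>lebesgue_on (cbox a b)) = 0" for k
      using integral_lebesgue_on_support(1)[of "cbox a b" "\<lambda>x. g x * \<phi> k x"] \<phi>(4) 0[OF test] by auto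
    ultimately show ?thesis by (simp add: LIMSEQ_const_iff)
  qed
  have cube: "AE x in lebesgue. x \<in> cbox a b \<longrightarrow> g x = 0" if ab: "cbox a b \<subseteq> \<Omega>" for a b
  proof -
    define f where "f x = (if x \<in> cbox a b then g x else 0)" for x
    have g: "integrable (lebesgue_on (cbox a b)) g"
      using assms(2) ab by (auto simp: locally_integrable_on_def)
    have f: "integrable lebesgue f" unfolding f_def
      using g Lebesgue_Measure.integrable_restrict_UNIV[of "cbox a b" g] by auto
    have "f integrable_on UNIV" using f integrable_on_lebesgue_on[of UNIV f] by (simp add: lebesgue_on_UNIV_eq)
    then have "f integrable_on cbox c d" for c d by (rule integrable_on_subcbox) auto
    then obtain N where N: "negligible N"
       "\<And>x e. \<lbrakk>x \<notin> N; 0 < e\<rbrakk> \<Longrightarrow> \<exists>d>0. \<forall>h. 0 < h \<and> h < d \<longrightarrow>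
          norm(integral (cbox x (x + h *\<^sub>R One)) f /\<^sub>R h ^ DIM(real^'n) - f x) < e"
      using integrable_ccontinuous_explicit[of f] by blast
    have z: "g x = 0" if x: "x \<in> box a b" "x \<notin> N" for x
    proof (rule ccontr)
      assume "g x \<noteq> 0"
      then have "norm (f x) > 0" using x box_subset_cbox by (auto simp: f_def)
      then obtain d where d: "d > 0" "\<And>h. 0 < h \<and> h < d \<Longrightarrow>
          norm(integral (cbox x (x + h *\<^sub>R One)) f /\<^sub>R h ^ DIM(real^'n) - f x) < norm (f x)"
        using N(2)[OF x(2)] by blast
      obtain r where r: "r > 0" "cball x r \<subseteq> box a b" using open_contains_cball[of "box a b"] open_box x(1) by blast
      define h where "h = min (d / 2) (r / norm (One :: real^'n))"
      have One: "norm (One::real^'n) > 0" using One_neq_0 by (simp only: zero_less_norm_iff not_False_eq_True)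
      have h: "0 < h" "h < d" "h * norm (One :: real^'n) \<le> r"
        using d(1) r(1) One by (auto simp: h_def min_def field_simps)
      have sub: "cbox x (x + h *\<^sub>R One) \<subseteq> cball x r"
      proof
        fix y assume y: "y \<in> cbox x (x + h *\<^sub>R One)"
        have "norm (y - x) \<le> norm (h *\<^sub>R (One::real^'n))"
        proof (rule norm_le_componentwise)
          fix i :: "real^'n" assume i: "i \<in> Basis"
          have "x \<bullet> i \<le> y \<bullet> i" "y \<bullet> i \<le> x \<bullet> i + h * (One \<bullet> i)"
            using y i by (auto simp: mem_box inner_add_left)
          then show "\<bar>(y - x) \<bullet> i\<bar> \<le> \<bar>(h *\<^sub>R One) \<bullet> i\<bar>" by (simp add: inner_diff_left)
        qed
        then show "y \<in> cball x r" using h by (simp add: dist_norm norm_minus_commute)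
      qed
      have sub2: "cbox x (x + h *\<^sub>R One) \<subseteq> cbox a b" using sub r(2) box_subset_cbox by blast
      have "integral (cbox x (x + h *\<^sub>R One)) f = integral (cbox x (x + h *\<^sub>R One)) g"
        using sub2 by (intro integral_cong) (auto simp: f_def)
      also have "\<dots> = integral\<^sup>L (lebesgue_on (cbox x (x + h *\<^sub>R One))) g"
        using assms(2) sub2 ab by (subst lebesgue_integral_eq_integral) (auto simp: locally_integrable_on_def)
      also have "\<dots> = 0" using box0 sub2 ab by blast
      finally show False using d(2)[of h] h by simp
    qed
    have "AE x in lebesgue. x \<notin> N" "AE x in lebesgue. x \<notin> cbox a b - box a b"
      using N(1) negligible_frontier_interval[of a b] unfolding negligible_iff_null_sets by (blast intro: AE_not_in)+
    then show ?thesis by eventually_elim (use z in auto)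
  qed
  obtain \<D> where D: "countable \<D>" "\<D> \<subseteq> Pow \<Omega>" "\<And>X. X \<in> \<D> \<Longrightarrow> \<exists>a b. X = cbox a b" "\<Union>\<D> = \<Omega>"
    using open_countable_Union_open_cbox[OF assms(1)] by blast
  have "\<forall>X\<in>\<D>. AE x in lebesgue. x \<in> X \<longrightarrow> g x = 0" using cube D(2,3) by blast
  then have "AE x in lebesgue. \<forall>X\<in>\<D>. x \<in> X \<longrightarrow> g x = 0" by (simp only: AE_ball_countable[OF D(1)])
  then show ?thesis by eventually_elim (use D(4) in blast)
qed

lemma AE_eq_of_test_integrals:
  fixes f g :: "real^'n::finite \<Rightarrow> real"
  assumes "open \<Omega>" "f locally_integrable_on \<Omega>" "g locally_integrable_on \<Omega>"
    and "\<And>\<phi>. \<phi> \<in> test_function \<Omega> \<Longrightarrow> (\<integral>x. f x * \<phi> x \<partial>lebesgue) = (\<integral>x. g x * \<phi> x \<partial>lebesgue)"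
  shows "AE x in lebesgue. x \<in> \<Omega> \<longrightarrow> f x = g x"
proof -
  have "AE x in lebesgue. x \<in> \<Omega> \<longrightarrow> f x - g x = 0"
  proof (rule fundamental_lemma[OF assms(1)])
    show "(\<lambda>x. f x - g x) locally_integrable_on \<Omega>" using assms(2,3) by (auto simp: locally_integrable_on_def)
    fix \<phi> assume \<phi>: "\<phi> \<in> test_function \<Omega>"
    show "(\<integral>x. (f x - g x) * \<phi> x \<partial>lebesgue) = 0"
      using locally_integrable_mult_test[OF assms(2) \<phi>] locally_integrable_mult_test[OF assms(3) \<phi>] assms(4)[OF \<phi>]
      by (simp add: left_diff_distrib)
  qed
  then show ?thesis by simp
qed

lemma weak_gradient_unique:
  assumes "open \<Omega>" "has_weak_gradient \<Omega> u G" "has_weak_gradient \<Omega> u G'"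
  shows "AE x in lebesgue. x \<in> \<Omega> \<longrightarrow> G x = G' x"
proof -
  have "AE x in lebesgue. x \<in> \<Omega> \<longrightarrow> G x $ i = G' x $ i" for i
  proof (rule AE_eq_of_test_integrals[OF assms(1)])
    show "(\<lambda>x. G x $ i) locally_integrable_on \<Omega>" "(\<lambda>x. G' x $ i) locally_integrable_on \<Omega>"
      using assms by (auto simp: has_weak_gradient_def intro: locally_integrable_component)
    fix \<phi> assume "\<phi> \<in> test_function \<Omega>"
    from has_weak_gradient_integral(1)[OF assms(1,2) this, of i] has_weak_gradient_integral(1)[OF assms(1,3) this, of i]
    show "(\<integral>x. G x $ i * \<phi> x \<partial>lebesgue) = (\<integral>x. G' x $ i * \<phi> x \<partial>lebesgue)" by simp
  qed
  then have "AE x in lebesgue. \<forall>i\<in>UNIV. x \<in> \<Omega> \<longrightarrow> G x $ i = G' x $ i"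
    by (intro AE_finite_allI) auto
  then show ?thesis by eventually_elim (auto simp: vec_eq_iff)
qed

lemma weak_gradient_eq:
  assumes "open \<Omega>" "has_weak_gradient \<Omega> u G"
  shows "has_weak_gradient \<Omega> u (weak_gradient \<Omega> u)"
    "AE x in lebesgue. x \<in> \<Omega> \<longrightarrow> weak_gradient \<Omega> u x = G x"
proof -
  show 1: "has_weak_gradient \<Omega> u (weak_gradient \<Omega> u)"
    unfolding weak_gradient_def by (rule someI[of "has_weak_gradient \<Omega> u", OF assms(2)])
  show "AE x in lebesgue. x \<in> \<Omega> \<longrightarrow> weak_gradient \<Omega> u x = G x"
    by (rule weak_gradient_unique[OF assms(1) 1 assms(2)])
qed

text \<open>Completeness of the Lebesgue measure. The weak gradient is an arbitrary representative, and its
  measurability is inherited in this way from a known one.\<close>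

lemma measurable_lebesgue_on_AE:
  fixes f g :: "'a::euclidean_space \<Rightarrow> 'b::euclidean_space"
  assumes "S \<in> sets lebesgue" "f \<in> borel_measurable (lebesgue_on S)" "AE x in lebesgue. x \<in> S \<longrightarrow> f x = g x"
  shows "g \<in> borel_measurable (lebesgue_on S)"
proof -
  have "(\<lambda>x. if x \<in> S then f x else 0) \<in> borel_measurable lebesgue"
    using assms by (intro borel_measurable_if_I)
  then have "(\<lambda>x. if x \<in> S then g x else 0) \<in> borel_measurable lebesgue"
    by (rule borel_measurable_AE) (use assms(3) in \<open>eventually_elim, auto\<close>)
  then show ?thesis by (rule borel_measurable_if_D)
qed

lemma in_Lp_weak_gradient:
  assumes "open \<Omega>" "has_weak_gradient \<Omega> u G" "S \<in> sets lebesgue" "S \<subseteq> \<Omega>" "in_Lp (lebesgue_on S) r G"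
  shows "in_Lp (lebesgue_on S) r (weak_gradient \<Omega> u)"
proof -
  have ae: "AE x in lebesgue. x \<in> S \<longrightarrow> G x = weak_gradient \<Omega> u x"
    using weak_gradient_eq(2)[OF assms(1,2)] by eventually_elim (use assms(4) in auto)
  have m: "weak_gradient \<Omega> u \<in> borel_measurable (lebesgue_on S)"
    by (rule measurable_lebesgue_on_AE[OF assms(3) _ ae]) (use assms(5) in auto)
  have "AE x in lebesgue_on S. G x = weak_gradient \<Omega> u x" using ae assms(3) by (simp add: AE_lebesgue_on_iff)
  from in_Lp_cong_AE[OF assms(5) m this] show ?thesis .
qed

lemma has_weak_gradient_linear:
  assumes "open \<Omega>" "has_weak_gradient \<Omega> u G" "has_weak_gradient \<Omega> v H"
  shows "has_weak_gradient \<Omega> (\<lambda>x. u x + t * v x) (\<lambda>x. G x + t *\<^sub>R H x)"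
proof (rule has_weak_gradientI[OF assms(1)])
  show "(\<lambda>x. u x + t * v x) locally_integrable_on \<Omega>" "(\<lambda>x. G x + t *\<^sub>R H x) locally_integrable_on \<Omega>"
    using assms by (auto simp: has_weak_gradient_def locally_integrable_on_def)
  fix \<phi> i assume \<phi>: "\<phi> \<in> test_function \<Omega>"
  note u = has_weak_gradient_integral[OF assms(1,2) \<phi>, of i] and v = has_weak_gradient_integral[OF assms(1,3) \<phi>, of i]
  have "(\<integral>x. (u x + t * v x) * partial_deriv i \<phi> x \<partial>lebesgue)
      = (\<integral>x. u x * partial_deriv i \<phi> x \<partial>lebesgue) + t * (\<integral>x. v x * partial_deriv i \<phi> x \<partial>lebesgue)"
    using u(2) v(2) by (simp add: distrib_right mult.assoc)
  also have "\<dots> = - (\<integral>x. (G x + t *\<^sub>R H x) $ i * \<phi> x \<partial>lebesgue)"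
    using u(1,3) v(1,3) by (simp add: distrib_right mult.assoc)
  finally show "(\<integral>x. (u x + t * v x) * partial_deriv i \<phi> x \<partial>lebesgue) = - (\<integral>x. (G x + t *\<^sub>R H x) $ i * \<phi> x \<partial>lebesgue)" .
qed

lemma test_function_shift:
  assumes "smooth \<phi>" "compact K" "\<And>x. x \<notin> K \<Longrightarrow> \<phi> x = 0" "\<And>x. x \<in> K \<Longrightarrow> x + h \<in> \<Omega>"
  shows "(\<lambda>x. \<phi> (x - h)) \<in> test_function \<Omega>"
proof (rule test_functionI[where K = "(\<lambda>x. x + h) ` K"])
  show "smooth (\<lambda>x. \<phi> (x - h))" using smooth_translate[OF assms(1), of "-h"] by simp
  show "compact ((\<lambda>x. x + h) ` K)" using assms(2) by (intro compact_continuous_image continuous_intros)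
  show "\<phi> (x - h) = 0" if "x \<notin> (\<lambda>x. x + h) ` K" for x
    using that assms(3)[of "x - h"] by (force simp: image_iff)
qed (use assms(4) in auto)

lemma integral_translate_test:
  fixes f \<psi> :: "'a::euclidean_space \<Rightarrow> real"
  assumes K: "compact K" "K \<subseteq> \<Omega>" "\<And>x. x \<in> K \<Longrightarrow> x + h \<in> \<Omega>"
    and f: "f locally_integrable_on \<Omega>" and \<psi>: "continuous_on UNIV \<psi>" "\<And>x. x \<notin> K \<Longrightarrow> \<psi> x = 0"
  shows "integrable lebesgue (\<lambda>x. f (x + h) * \<psi> x)"
      "(\<integral>x. f (x + h) * \<psi> x \<partial>lebesgue) = (\<integral>x. f x * \<psi> (x - h) \<partial>lebesgue)"
      "integrable lebesgue (\<lambda>x. f x * \<psi> x)"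
      "integrable lebesgue (\<lambda>x. f x * \<psi> (x - h))"
proof -
  let ?K' = "(\<lambda>x. x + h) ` K"
  have K': "compact ?K'" "?K' \<subseteq> \<Omega>" using K by (auto intro!: compact_continuous_image continuous_intros)
  show i: "integrable lebesgue (\<lambda>x. f x * \<psi> (x - h))"
  proof (rule locally_integrable_mult[OF f K'])
    show "continuous_on UNIV (\<lambda>x. \<psi> (x - h))" using \<psi>(1)
      by (auto intro!: continuous_on_compose2[of UNIV \<psi>] continuous_intros)
    show "\<psi> (x - h) = 0" if "x \<notin> ?K'" for x
      using that \<psi>(2)[of "x - h"] by (force simp: image_iff)
  qed
  show "integrable lebesgue (\<lambda>x. f (x + h) * \<psi> x)" using lebesgue_translate(1)[OF i, of h] by simp
  show "(\<integral>x. f (x + h) * \<psi> x \<partial>lebesgue) = (\<integral>x. f x * \<psi> (x - h) \<partial>lebesgue)"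
    using lebesgue_translate(2)[OF borel_measurable_integrable[OF i], of h] by simp
  show "integrable lebesgue (\<lambda>x. f x * \<psi> x)" by (rule locally_integrable_mult[OF f K(1,2) \<psi>])
qed

text \<open>The product rule and the translation of test functions in one step. The test function
  \<open>\<zeta> \<psi>\<close> and its shift by \<open>h\<close> are both supported in \<open>\<Omega>\<close>, so the weak gradient of \<open>u\<close> may be tested
  with each of them.\<close>

lemma has_weak_gradient_cutoff_difference:
  fixes \<zeta> :: "real^'n::finite \<Rightarrow> real"
  assumes "open \<Omega>" and uG: "has_weak_gradient \<Omega> u G"
    and \<zeta>: "smooth \<zeta>" "compact K" "\<And>x. x \<notin> K \<Longrightarrow> \<zeta> x = 0" "K \<subseteq> \<Omega>" "\<And>x. x \<in> K \<Longrightarrow> x + h \<in> \<Omega>"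
  shows "has_weak_gradient \<Omega> (\<lambda>x. \<zeta> x * (u (x + h) - u x))
      (\<lambda>x. \<zeta> x *\<^sub>R (G (x + h) - G x) + (u (x + h) - u x) *\<^sub>R grad \<zeta> x)"
    (is "has_weak_gradient \<Omega> ?v ?V")
proof -
  have O: "\<Omega> \<in> sets lebesgue" using assms(1) by auto
  have shift: "integrable lebesgue (\<lambda>x. f (x + h) * \<psi> x)"
      "(\<integral>x. f (x + h) * \<psi> x \<partial>lebesgue) = (\<integral>x. f x * \<psi> (x - h) \<partial>lebesgue)"
      "integrable lebesgue (\<lambda>x. f x * \<psi> x)"
    if "f locally_integrable_on \<Omega>" "continuous_on UNIV \<psi>" "\<And>x. x \<notin> K \<Longrightarrow> \<psi> x = 0" for f \<psi> :: "real^'n \<Rightarrow> real"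
    using integral_translate_test[where h = h, OF \<zeta>(2,4,5) that] by blast+
  have u: "u locally_integrable_on \<Omega>" and G: "(\<lambda>x. G x $ i) locally_integrable_on \<Omega>" for i
    using uG by (auto simp: has_weak_gradient_def intro: locally_integrable_component)
  have cont: "continuous_on UNIV \<zeta>" "continuous_on UNIV (partial_deriv i \<zeta>)" for i
    using smooth_imp_continuous smooth_partial \<zeta>(1) by blast+
  have out: "partial_deriv i \<zeta> x = 0" if "x \<notin> K" for i x
    using partial_deriv_outside[OF compact_imp_closed[OF \<zeta>(2)] \<zeta>(3) that] .
  have v_int: "integrable lebesgue ?v"
    using Bochner_Integration.integrable_diff[OF shift(1)[OF u cont(1) \<zeta>(3)] shift(3)[OF u cont(1) \<zeta>(3)]]
    by (simp add: algebra_simps)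
  have V_int_i: "integrable lebesgue (\<lambda>x. ?V x $ i)" for i
  proof -
    have "integrable lebesgue (\<lambda>x. (G (x + h) $ i * \<zeta> x - G x $ i * \<zeta> x) + (u (x + h) * partial_deriv i \<zeta> x - u x * partial_deriv i \<zeta> x))"
      by (intro Bochner_Integration.integrable_add Bochner_Integration.integrable_diff shift(1)[OF G[of i] cont(1) \<zeta>(3)] shift(3)[OF G[of i] cont(1) \<zeta>(3)]
          shift(1)[OF u cont(2) out] shift(3)[OF u cont(2) out])
    moreover have "(\<lambda>x. ?V x $ i) = (\<lambda>x. (G (x + h) $ i * \<zeta> x - G x $ i * \<zeta> x) + (u (x + h) * partial_deriv i \<zeta> x - u x * partial_deriv i \<zeta> x))"
      by (auto simp: grad_def algebra_simps)
    ultimately show ?thesis by simp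
  qed
  have V_int: "integrable lebesgue ?V"
  proof -
    have "integrable lebesgue (\<lambda>x. \<Sum>i\<in>UNIV. ?V x $ i *\<^sub>R (axis i 1 :: real^'n))"
      by (intro Bochner_Integration.integrable_sum integrable_scaleR_left V_int_i)
    moreover have "(\<Sum>i\<in>UNIV. w $ i *\<^sub>R (axis i 1 :: real^'n)) = w" for w :: "real^'n"
      using basis_expansion[of w] by (simp add: scalar_mult_eq_scaleR)
    ultimately show ?thesis by (simp del: vector_add_component vector_scaleR_component)
  qed
  show ?thesis
  proof (rule has_weak_gradientI[OF assms(1)])
    have "?v x = 0" "?V x = 0" if "x \<notin> \<Omega>" for x
    proof -
      have "x \<notin> K" using that \<zeta>(4) by auto
      then show "?v x = 0" "?V x = 0"
        using \<zeta>(3) grad_outside[OF compact_imp_closed[OF \<zeta>(2)] \<zeta>(3)] by auto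
    qed
    then have "integrable (lebesgue_on \<Omega>) ?v" "integrable (lebesgue_on \<Omega>) ?V"
      using integral_lebesgue_on_support(2)[OF O, of ?v] integral_lebesgue_on_support(2)[OF O, of ?V] v_int V_int by auto
    then show "?v locally_integrable_on \<Omega>" "?V locally_integrable_on \<Omega>"
      using O by (auto intro: integrable_imp_locally_integrable)
    fix \<psi> i assume \<psi>: "\<psi> \<in> test_function \<Omega>"
    have s\<psi>: "smooth \<psi>" using \<psi> by (auto simp: test_function_def smooth_def)
    define \<theta> where "\<theta> x = \<zeta> x * \<psi> x" for x
    have s\<theta>: "smooth \<theta>" unfolding \<theta>_def by (intro smooth_mult \<zeta>(1) s\<psi>)
    have \<theta>0: "\<theta> x = 0" if "x \<notin> K" for x using that \<zeta>(3) by (simp add: \<theta>_def)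
    have \<theta>p0: "partial_deriv i \<theta> x = 0" if "x \<notin> K" for x
      using partial_deriv_outside[OF compact_imp_closed[OF \<zeta>(2)] \<theta>0 that] .
    have \<theta>: "\<theta> \<in> test_function \<Omega>" by (rule test_functionI[OF s\<theta> \<zeta>(2) \<theta>0 \<zeta>(4)])
    have \<theta>h: "(\<lambda>x. \<theta> (x - h)) \<in> test_function \<Omega>" by (rule test_function_shift[OF s\<theta> \<zeta>(2) \<theta>0 \<zeta>(5)])
    have pd: "partial_deriv i \<theta> x = \<zeta> x * partial_deriv i \<psi> x + partial_deriv i \<zeta> x * \<psi> x" for x
      unfolding \<theta>_def by (rule partial_deriv_mult[OF \<zeta>(1) s\<psi>])
    have pdh: "partial_deriv i (\<lambda>x. \<theta> (x - h)) x = partial_deriv i \<theta> (x - h)" for x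
      using partial_deriv_translate[of \<theta> x "-h" i] smooth_imp_differentiable[OF s\<theta>] by simp
    have c\<theta>: "continuous_on UNIV \<theta>" "continuous_on UNIV (partial_deriv i \<theta>)"
      using smooth_imp_continuous smooth_partial s\<theta> by blast+
    have pzp: "continuous_on UNIV (\<lambda>x. partial_deriv i \<zeta> x * \<psi> x)" "\<And>x. x \<notin> K \<Longrightarrow> partial_deriv i \<zeta> x * \<psi> x = 0"
      using cont(2) smooth_imp_continuous[OF s\<psi>] out by (auto intro: continuous_intros)
    have "(\<integral>x. u (x + h) * partial_deriv i \<theta> x \<partial>lebesgue) = - (\<integral>x. G (x + h) $ i * \<theta> x \<partial>lebesgue)"
      using has_weak_gradient_integral(1)[OF assms(1) uG \<theta>h, of i] shift(2)[OF u c\<theta>(2) \<theta>p0] shift(2)[OF G[of i] c\<theta>(1) \<theta>0]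
      by (simp add: pdh)
    moreover have "(\<integral>x. u x * partial_deriv i \<theta> x \<partial>lebesgue) = - (\<integral>x. G x $ i * \<theta> x \<partial>lebesgue)"
      by (rule has_weak_gradient_integral(1)[OF assms(1) uG \<theta>])
    ultimately have main: "(\<integral>x. u (x + h) * partial_deriv i \<theta> x - u x * partial_deriv i \<theta> x \<partial>lebesgue)
        = - (\<integral>x. G (x + h) $ i * \<theta> x - G x $ i * \<theta> x \<partial>lebesgue)"
      using shift(1,3)[OF u c\<theta>(2) \<theta>p0] shift(1,3)[OF G[of i] c\<theta>(1) \<theta>0] by simp
    let ?R = "\<lambda>x. u (x + h) * (partial_deriv i \<zeta> x * \<psi> x) - u x * (partial_deriv i \<zeta> x * \<psi> x)"
    have R: "integrable lebesgue ?R"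
      using shift(1,3)[OF u pzp] by auto
    have "(\<integral>x. ?v x * partial_deriv i \<psi> x \<partial>lebesgue)
        = (\<integral>x. (u (x + h) * partial_deriv i \<theta> x - u x * partial_deriv i \<theta> x) - ?R x \<partial>lebesgue)"
      by (intro Bochner_Integration.integral_cong) (auto simp: pd algebra_simps)
    also have "\<dots> = - (\<integral>x. G (x + h) $ i * \<theta> x - G x $ i * \<theta> x \<partial>lebesgue) - (\<integral>x. ?R x \<partial>lebesgue)"
      unfolding main[symmetric] using shift(1,3)[OF u c\<theta>(2) \<theta>p0] R by (intro Bochner_Integration.integral_diff) auto
    also have "\<dots> = - (\<integral>x. (G (x + h) $ i * \<theta> x - G x $ i * \<theta> x) + ?R x \<partial>lebesgue)"
      using R shift(1,3)[OF G[of i] c\<theta>(1) \<theta>0] by simp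
    also have "\<dots> = - (\<integral>x. ?V x $ i * \<psi> x \<partial>lebesgue)"
      by (intro arg_cong[where f = uminus] Bochner_Integration.integral_cong) (auto simp: \<theta>_def grad_def algebra_simps)
    finally show "(\<integral>x. ?v x * partial_deriv i \<psi> x \<partial>lebesgue) = - (\<integral>x. ?V x $ i * \<psi> x \<partial>lebesgue)" .
  qed
qed

section \<open>Difference quotients of Sobolev functions\<close>

abbreviation unit_measure :: "real measure" where "unit_measure \<equiv> restrict_space lborel {0..1}"

lemma prob_unit: "measure unit_measure (space unit_measure) = 1" "finite_measure unit_measure"
  by (auto simp: space_restrict_space measure_restrict_space intro!: finite_measureI simp: emeasure_restrict_space)

lemma jensen_power:
  fixes f :: "'a \<Rightarrow> real"
  assumes "finite_measure M" "measure M (space M) = 1" "r > 1" "in_Lp M r f"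
  shows "\<bar>\<integral>x. f x \<partial>M\<bar> powr r \<le> (\<integral>x. \<bar>f x\<bar> powr r \<partial>M)"
proof -
  have "\<bar>\<integral>x. f x \<partial>M\<bar> \<le> (\<integral>x. norm (f x) \<partial>M)" using integral_abs_bound[of M f] by simp
  also have "\<dots> \<le> norm_Lp M r f" using L1_le_Lp[OF assms(1,3,4)] assms(2) by simp
  finally have "\<bar>\<integral>x. f x \<partial>M\<bar> powr r \<le> norm_Lp M r f powr r" using assms(3) by (intro powr_mono2) auto
  then show ?thesis using norm_Lp_powr[of r M f] assms(3) by simp
qed

lemma lborel_translate:
  fixes g :: "'a::euclidean_space \<Rightarrow> real"
  assumes [measurable]: "g \<in> borel_measurable borel"
  shows "(\<integral>x. g (x + a) \<partial>lborel) = (\<integral>x. g x \<partial>lborel)" "integrable lborel (\<lambda>x. g (x + a)) \<longleftrightarrow> integrable lborel g"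
proof -
  have "(\<integral>x. g x \<partial>distr lborel borel ((+) a)) = (\<integral>x. g (a + x) \<partial>lborel)" by (rule integral_distr) auto
  then show "(\<integral>x. g (x + a) \<partial>lborel) = (\<integral>x. g x \<partial>lborel)" by (simp add: lborel_distr_plus add.commute)
  have "integrable (distr lborel borel ((+) a)) g \<longleftrightarrow> integrable lborel (\<lambda>x. g (a + x))" by (rule integrable_distr_eq) auto
  then show "integrable lborel (\<lambda>x. g (x + a)) \<longleftrightarrow> integrable lborel g" by (simp add: lborel_distr_plus add.commute)
qed

lemma unit_pair: "pair_sigma_finite unit_measure (lborel :: 'a::euclidean_space measure)"
  by (intro pair_sigma_finite.intro finite_measure.axioms(1)[OF prob_unit(2)] lborel.sigma_finite_measure_axioms)

lemma unit_fst_measurable [measurable]: "fst \<in> borel_measurable (unit_measure \<Otimes>\<^sub>M M)"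
  by (rule measurable_compose[OF measurable_fst]) (auto intro: measurable_restrict_space1)

lemma shear_measurable:
  fixes g :: "'a::euclidean_space \<Rightarrow> real"
  assumes [measurable]: "g \<in> borel_measurable borel"
  shows "(\<lambda>z. g (snd z + fst z *\<^sub>R h)) \<in> borel_measurable (unit_measure \<Otimes>\<^sub>M (lborel :: 'a measure))"
proof -
  have [measurable]: "snd \<in> borel_measurable (unit_measure \<Otimes>\<^sub>M (lborel :: 'a measure))"
    using measurable_snd[of unit_measure "lborel :: 'a measure"] by simp
  show ?thesis by measurable
qed

text \<open>Integrability on the product, which is what Fubini's theorem needs in every average over the
  segment from \<open>x\<close> to \<open>x + h\<close>: for fixed \<open>t\<close> the integral in \<open>x\<close> does not depend on \<open>t\<close>.\<close>

lemma shear_integrable: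
  fixes g :: "'a::euclidean_space \<Rightarrow> real"
  assumes g: "integrable lborel g"
  shows "integrable (unit_measure \<Otimes>\<^sub>M (lborel :: 'a measure)) (\<lambda>z. g (snd z + fst z *\<^sub>R h))"
proof -
  interpret pair_sigma_finite unit_measure "lborel :: 'a measure" by (rule unit_pair)
  interpret finite_measure unit_measure by (rule prob_unit)
  have [measurable]: "g \<in> borel_measurable borel" using g by auto
  show ?thesis
  proof (rule Fubini_integrable[OF shear_measurable])
    show "g \<in> borel_measurable borel" by measurable
    have "(\<integral>y. norm (g (y + t *\<^sub>R h)) \<partial>lborel) = (\<integral>y. norm (g y) \<partial>lborel)" for t
      using lborel_translate(1)[of "\<lambda>y. norm (g y)"] by simp
    then show "integrable unit_measure (\<lambda>x. \<integral>y. norm (g (snd (x, y) + fst (x, y) *\<^sub>R h)) \<partial>lborel)" by simp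
    show "AE x in unit_measure. integrable lborel (\<lambda>y. g (snd (x, y) + fst (x, y) *\<^sub>R h))"
      using g by (simp add: lborel_translate(2))
  qed
qed

text \<open>A Borel function composed with \<open>(t, x) \<mapsto> x + t h\<close> is measurable for the product of the two
  Borel structures, which is where Fubini's theorem is applied; this lemma and the next one provide
  Borel representatives.\<close>

lemma borel_representative:
  fixes f :: "'a::euclidean_space \<Rightarrow> real"
  assumes "f \<in> borel_measurable lebesgue"
  obtains g where "g \<in> borel_measurable borel" "AE x in lebesgue. f x = g x"
proof -
  obtain g where g: "g \<in> borel_measurable lborel" "AE x in lborel. f x = g x"
    using completion_ex_borel_measurable_real[OF assms] by blast
  have "AE x in lebesgue. f x = g x" by (rule AE_completion[OF g(2)])
  then show ?thesis using that[of g] g(1) by simp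
qed

lemma integrable_borel_representative:
  fixes f :: "'a::euclidean_space \<Rightarrow> real"
  assumes "integrable lebesgue f"
  obtains g where "g \<in> borel_measurable borel" "AE x in lebesgue. f x = g x" "integrable lborel g"
proof -
  obtain g where g: "g \<in> borel_measurable borel" "AE x in lebesgue. f x = g x"
    using borel_representative[OF borel_measurable_integrable[OF assms]] by blast
  have "integrable lebesgue g"
    by (rule integrable_cong_AE_imp[OF assms _ g(2)]) (use g(1) in \<open>simp add: measurable_completion\<close>)
  then have "integrable lborel g" using g(1) by (simp add: integrable_completion)
  with g show ?thesis by (rule that)
qed

text \<open>Jensen's inequality in \<open>t\<close>, then Fubini and translation invariance in \<open>x\<close>.\<close>

lemma path_average_bound:
  fixes g :: "'a::euclidean_space \<Rightarrow> real"
  assumes [measurable]: "g \<in> borel_measurable borel" and g: "integrable lborel g" and gr: "integrable lborel (\<lambda>x. \<bar>g x\<bar> powr r)" and r: "r > 1"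
  shows "integrable lborel (\<lambda>x. \<integral>t. g (x + t *\<^sub>R h) \<partial>unit_measure)"
    and "integrable lborel (\<lambda>x. \<bar>\<integral>t. g (x + t *\<^sub>R h) \<partial>unit_measure\<bar> powr r)"
    and "(\<integral>x. \<bar>\<integral>t. g (x + t *\<^sub>R h) \<partial>unit_measure\<bar> powr r \<partial>lborel) \<le> (\<integral>x. \<bar>g x\<bar> powr r \<partial>lborel)"
proof -
  interpret pair_sigma_finite unit_measure "lborel :: 'a measure" by (rule unit_pair)
  let ?I = "\<lambda>x. \<integral>t. g (x + t *\<^sub>R h) \<partial>unit_measure"
  have s1: "integrable (unit_measure \<Otimes>\<^sub>M (lborel :: 'a measure)) (\<lambda>(t, x). g (x + t *\<^sub>R h))"
    using shear_integrable[OF g, of h] by (simp add: case_prod_unfold)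
  have s2: "integrable (unit_measure \<Otimes>\<^sub>M (lborel :: 'a measure)) (\<lambda>(t, x). \<bar>g (x + t *\<^sub>R h)\<bar> powr r)"
    using shear_integrable[OF gr, of h] by (simp add: case_prod_unfold)
  show I: "integrable lborel ?I" by (rule integrable_snd[OF s1])
  have J: "integrable lborel (\<lambda>x. \<integral>t. \<bar>g (x + t *\<^sub>R h)\<bar> powr r \<partial>unit_measure)" by (rule integrable_snd[OF s2])
  have ae: "AE x in lborel. \<bar>?I x\<bar> powr r \<le> (\<integral>t. \<bar>g (x + t *\<^sub>R h)\<bar> powr r \<partial>unit_measure)"
    using AE_integrable_snd[OF s1] AE_integrable_snd[OF s2]
  proof eventually_elim
    case (elim x)
    then have "in_Lp unit_measure r (\<lambda>t. g (x + t *\<^sub>R h))" by (simp add: in_Lp_def)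
    then show ?case by (intro jensen_power prob_unit r)
  qed
  have [measurable]: "?I \<in> borel_measurable borel" using I by auto
  show Ir: "integrable lborel (\<lambda>x. \<bar>?I x\<bar> powr r)"
  proof (rule Bochner_Integration.integrable_bound[OF J])
    show "AE x in lborel. norm (\<bar>?I x\<bar> powr r) \<le> norm (\<integral>t. \<bar>g (x + t *\<^sub>R h)\<bar> powr r \<partial>unit_measure)"
      using ae by eventually_elim auto
  qed measurable
  have "(\<integral>x. \<bar>?I x\<bar> powr r \<partial>lborel) \<le> (\<integral>x. \<integral>t. \<bar>g (x + t *\<^sub>R h)\<bar> powr r \<partial>unit_measure \<partial>lborel)"
    by (rule integral_mono_AE[OF Ir J ae])
  also have "\<dots> = (\<integral>t. \<integral>x. \<bar>g (x + t *\<^sub>R h)\<bar> powr r \<partial>lborel \<partial>unit_measure)"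
    using Fubini_integral[OF s2] by simp
  also have "\<dots> = (\<integral>t. \<integral>x. \<bar>g x\<bar> powr r \<partial>lborel \<partial>unit_measure)"
    using lborel_translate(1)[of "\<lambda>y. \<bar>g y\<bar> powr r"] by simp
  also have "\<dots> = (\<integral>x. \<bar>g x\<bar> powr r \<partial>lborel)" using prob_unit by simp
  finally show "(\<integral>x. \<bar>?I x\<bar> powr r \<partial>lborel) \<le> (\<integral>x. \<bar>g x\<bar> powr r \<partial>lborel)" .
qed

lemma smooth_segment_integral:
  assumes "smooth \<phi>"
  shows "(\<integral>t. grad \<phi> (x - t *\<^sub>R h) \<bullet> h \<partial>unit_measure) = \<phi> x - \<phi> (x - h)"
proof -
  have "(\<integral>t. (grad \<phi> (x - t *\<^sub>R h) \<bullet> h) * indicator {0..1} t \<partial>lborel) = - \<phi> (x - 1 *\<^sub>R h) - (- \<phi> (x - 0 *\<^sub>R h))"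
  proof (rule integral_FTC_Icc_real)
    fix t :: real
    have "((\<lambda>t. x - t *\<^sub>R h) has_derivative (\<lambda>s. - s *\<^sub>R h)) (at t)" by (auto intro!: derivative_eq_intros)
    from has_derivative_compose[OF this smooth_has_derivative[OF assms]]
    have "((\<lambda>t. \<phi> (x - t *\<^sub>R h)) has_derivative (\<lambda>s. - (grad \<phi> (x - t *\<^sub>R h) \<bullet> h) * s)) (at t)"
      by (simp add: mult.commute)
    then have "((\<lambda>t. \<phi> (x - t *\<^sub>R h)) has_real_derivative - (grad \<phi> (x - t *\<^sub>R h) \<bullet> h)) (at t)"
      by (rule has_derivative_imp_has_field_derivative) simp
    from DERIV_minus[OF this] show "((\<lambda>t. - \<phi> (x - t *\<^sub>R h)) has_real_derivative grad \<phi> (x - t *\<^sub>R h) \<bullet> h) (at t)" by simp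
    have "continuous_on UNIV (\<lambda>t. grad \<phi> (x - t *\<^sub>R h) \<bullet> h)"
      by (intro continuous_on_inner continuous_on_const continuous_on_compose2[OF continuous_grad[OF assms, of UNIV]]
          continuous_on_diff continuous_on_scaleR continuous_on_id) auto
    then show "isCont (\<lambda>t. grad \<phi> (x - t *\<^sub>R h) \<bullet> h) t"
      by (simp add: continuous_on_eq_continuous_at)
  qed auto
  then show ?thesis by (simp add: integral_restrict_space mult.commute)
qed

text \<open>The difference is moved to the test function and written as an integral of \<open>\<nabla>\<phi>\<close> along the
  segment. For each \<open>t\<close> the shifted test function is admissible for the weak gradient, and a second
  application of Fubini moves the average to \<open>g\<close>, a Borel representative of \<open>\<langle>G, h\<rangle>\<close> on \<open>E\<close>.\<close>

lemma difference_test_integral: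
  fixes u :: "real^'n::finite \<Rightarrow> real"
  assumes O: "open \<Omega>" and uG: "has_weak_gradient \<Omega> u G"
    and E: "E \<subseteq> \<Omega>"
    and g: "integrable lborel g" "AE x in lebesgue. zero_ext E (\<lambda>x. G x \<bullet> h) x = g x"
    and \<phi>: "smooth \<phi>" "compact K" "\<And>x. x \<notin> K \<Longrightarrow> \<phi> x = 0"
    and KE: "\<And>x t. x \<in> K \<Longrightarrow> 0 \<le> t \<Longrightarrow> t \<le> 1 \<Longrightarrow> x + t *\<^sub>R h \<in> E"
  shows "(\<integral>x. (u (x + h) - u x) * \<phi> x \<partial>lebesgue) = (\<integral>x. (\<integral>t. g (x + t *\<^sub>R h) \<partial>unit_measure) * \<phi> x \<partial>lebesgue)"
proof -
  interpret pair_sigma_finite unit_measure "lborel :: (real^'n) measure" by (rule unit_pair)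
  have [measurable]: "g \<in> borel_measurable borel" using g(1) by auto
  have u: "u locally_integrable_on \<Omega>" and G: "(\<lambda>x. G x $ i) locally_integrable_on \<Omega>" for i
    using uG by (auto simp: has_weak_gradient_def intro: locally_integrable_component)
  \<comment> \<open>the compact set swept out by the segments that start in \<open>K\<close>\<close>
  define L where "L = (\<lambda>(t, x). x + t *\<^sub>R h) ` ({0..1::real} \<times> K)"
  have L: "compact L" unfolding L_def
    using \<phi>(2) by (intro compact_continuous_image compact_Times) (auto intro!: continuous_intros simp: case_prod_unfold)
  have LE: "L \<subseteq> E" using KE by (auto simp: L_def)
  have Lm: "L \<in> sets lebesgue" by (rule fmeasurableD[OF lmeasurable_compact[OF L]])
  have LO: "L \<subseteq> \<Omega>" using LE E by auto
  have inL: "x + t *\<^sub>R h \<in> L" if "x \<in> K" "0 \<le> t" "t \<le> 1" for x t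
  proof -
    have "(t, x) \<in> {0..1} \<times> K" using that by auto
    then show ?thesis unfolding L_def by force
  qed
  have KO: "K \<subseteq> \<Omega>" "\<And>x. x \<in> K \<Longrightarrow> x + h \<in> \<Omega>" using inL[of _ 0] inL[of _ 1] LO by auto
  have vanish: "\<phi> (x - t *\<^sub>R h) = 0" "grad \<phi> (x - t *\<^sub>R h) = 0" if "x \<notin> L" "0 \<le> t" "t \<le> 1" for x t
  proof -
    have "x - t *\<^sub>R h \<notin> K" using inL[of "x - t *\<^sub>R h" t] that by auto
    then show "\<phi> (x - t *\<^sub>R h) = 0" "grad \<phi> (x - t *\<^sub>R h) = 0"
      using \<phi>(3) grad_outside[OF compact_imp_closed[OF \<phi>(2)] \<phi>(3)] by auto
  qed
  have "integrable (lebesgue_on L) u" using u L LO unfolding locally_integrable_on_def by blast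
  then have "integrable lebesgue (zero_ext L u)"
    using Lebesgue_Measure.integrable_restrict_UNIV[OF Lm, of u] by (simp add: zero_ext_def[abs_def])
  then obtain v where v: "v \<in> borel_measurable borel" "AE x in lebesgue. zero_ext L u x = v x" "integrable lborel v"
    using integrable_borel_representative by blast
  note [measurable] = v(1)
  have c\<phi>: "continuous_on UNIV \<phi>" using smooth_imp_continuous[OF \<phi>(1)] .
  have cg: "continuous_on UNIV (grad \<phi>)" using continuous_grad[OF \<phi>(1)] .
  have [measurable]: "\<phi> \<in> borel_measurable borel" "grad \<phi> \<in> borel_measurable borel"
    using borel_measurable_continuous_onI c\<phi> cg by blast+
  obtain B where B: "B > 0" "\<And>x. norm (grad \<phi> x) \<le> B"
    using compact_support_bounded[OF cg \<phi>(2) grad_outside[OF compact_imp_closed[OF \<phi>(2)] \<phi>(3)]] by blast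
  obtain B' where B': "B' > 0" "\<And>x. norm (\<phi> x) \<le> B'"
    using compact_support_bounded[OF c\<phi> \<phi>(2,3)] by blast
  have snd[measurable]: "snd \<in> borel_measurable (unit_measure \<Otimes>\<^sub>M (lborel :: (real^'n) measure))"
    using measurable_snd[of unit_measure "lborel :: (real^'n) measure"] by simp
  have p1: "integrable (unit_measure \<Otimes>\<^sub>M (lborel :: (real^'n) measure)) (\<lambda>(t, x). v x * (grad \<phi> (x - t *\<^sub>R h) \<bullet> h))"
  proof (rule Bochner_Integration.integrable_bound)
    show "integrable (unit_measure \<Otimes>\<^sub>M (lborel :: (real^'n) measure)) (\<lambda>z. (B * norm h) * norm (v (snd z + fst z *\<^sub>R 0)))"
      by (intro integrable_mult_right integrable_norm shear_integrable v(3))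
    show "(\<lambda>(t, x). v x * (grad \<phi> (x - t *\<^sub>R h) \<bullet> h)) \<in> borel_measurable (unit_measure \<Otimes>\<^sub>M (lborel :: (real^'n) measure))"
      unfolding case_prod_unfold by measurable
    have "\<bar>v x * (grad \<phi> y \<bullet> h)\<bar> \<le> B * norm h * \<bar>v x\<bar>" for x y
    proof -
      have "\<bar>grad \<phi> y \<bullet> h\<bar> \<le> norm (grad \<phi> y) * norm h" by (rule Cauchy_Schwarz_ineq2)
      also have "\<dots> \<le> B * norm h" using B by (intro mult_right_mono) auto
      finally show ?thesis by (simp add: abs_mult mult.commute mult_left_mono)
    qed
    then show "AE z in unit_measure \<Otimes>\<^sub>M (lborel :: (real^'n) measure). norm (case z of (t, x) \<Rightarrow> v x * (grad \<phi> (x - t *\<^sub>R h) \<bullet> h))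
        \<le> norm (B * norm h * norm (v (snd z + fst z *\<^sub>R 0)))"
      using B by (intro AE_I2) (auto simp: case_prod_unfold abs_mult)
  qed
  have p2: "integrable (unit_measure \<Otimes>\<^sub>M (lborel :: (real^'n) measure)) (\<lambda>(t, x). g (x + t *\<^sub>R h) * \<phi> x)"
  proof (rule Bochner_Integration.integrable_bound)
    show "integrable (unit_measure \<Otimes>\<^sub>M (lborel :: (real^'n) measure)) (\<lambda>z. B' * norm (g (snd z + fst z *\<^sub>R h)))"
      by (intro integrable_mult_right integrable_norm shear_integrable g(1))
    show "(\<lambda>(t, x). g (x + t *\<^sub>R h) * \<phi> x) \<in> borel_measurable (unit_measure \<Otimes>\<^sub>M (lborel :: (real^'n) measure))"
      unfolding case_prod_unfold by measurable
    show "AE z in unit_measure \<Otimes>\<^sub>M (lborel :: (real^'n) measure). norm (case z of (t, x) \<Rightarrow> g (x + t *\<^sub>R h) * \<phi> x)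
        \<le> norm (B' * norm (g (snd z + fst z *\<^sub>R h)))"
      using B' by (intro AE_I2) (auto simp: case_prod_unfold abs_mult mult.commute[of B'] intro!: mult_left_mono)
  qed
  have slice: "(\<integral>x. v x * (grad \<phi> (x - t *\<^sub>R h) \<bullet> h) \<partial>lborel) = - (\<integral>x. g (x + t *\<^sub>R h) * \<phi> x \<partial>lborel)" if t: "0 \<le> t" "t \<le> 1" for t
  proof -
    define \<psi> where "\<psi> x = \<phi> (x - t *\<^sub>R h)" for x
    have \<psi>: "\<psi> \<in> test_function \<Omega>" unfolding \<psi>_def
      by (rule test_function_shift[OF \<phi>]) (use KE t E in auto)
    have gr: "grad \<phi> (x - t *\<^sub>R h) $ i = partial_deriv i \<psi> x" for x i
      using partial_deriv_translate[of \<phi> x "- t *\<^sub>R h" i] smooth_imp_differentiable[OF \<phi>(1)]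
      by (simp add: grad_def \<psi>_def[abs_def])
    note w = has_weak_gradient_integral[OF O uG \<psi>]
    have "(\<integral>x. v x * (grad \<phi> (x - t *\<^sub>R h) \<bullet> h) \<partial>lborel) = (\<integral>x. v x * (grad \<phi> (x - t *\<^sub>R h) \<bullet> h) \<partial>lebesgue)"
      by (rule integral_completion[symmetric]) measurable
    also have "\<dots> = (\<integral>x. zero_ext L u x * (grad \<phi> (x - t *\<^sub>R h) \<bullet> h) \<partial>lebesgue)"
    proof (rule integral_cong_AE)
      show "(\<lambda>x. v x * (grad \<phi> (x - t *\<^sub>R h) \<bullet> h)) \<in> borel_measurable lebesgue" by (rule measurable_completion) measurable
      show "(\<lambda>x. zero_ext L u x * (grad \<phi> (x - t *\<^sub>R h) \<bullet> h)) \<in> borel_measurable lebesgue"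
        using \<open>integrable lebesgue (zero_ext L u)\<close>
        by (intro borel_measurable_times measurable_completion[of "\<lambda>x. grad \<phi> (x - t *\<^sub>R h) \<bullet> h"]) (simp_all add: borel_measurable_integrable)
      show "AE x in lebesgue. v x * (grad \<phi> (x - t *\<^sub>R h) \<bullet> h) = zero_ext L u x * (grad \<phi> (x - t *\<^sub>R h) \<bullet> h)"
        using v(2) by eventually_elim simp
    qed
    also have "\<dots> = (\<integral>x. (\<Sum>i\<in>UNIV. h $ i * (u x * partial_deriv i \<psi> x)) \<partial>lebesgue)"
    proof (rule Bochner_Integration.integral_cong)
      fix x
      have "zero_ext L u x * (grad \<phi> (x - t *\<^sub>R h) \<bullet> h) = u x * (grad \<phi> (x - t *\<^sub>R h) \<bullet> h)"
        using vanish(2)[OF _ t, of x] by (cases "x \<in> L") auto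
      then show "zero_ext L u x * (grad \<phi> (x - t *\<^sub>R h) \<bullet> h) = (\<Sum>i\<in>UNIV. h $ i * (u x * partial_deriv i \<psi> x))"
        by (simp add: inner_vec_def gr sum_distrib_left algebra_simps)
    qed simp
    also have "\<dots> = (\<Sum>i\<in>UNIV. h $ i * (\<integral>x. u x * partial_deriv i \<psi> x \<partial>lebesgue))"
      using w(2) by (subst Bochner_Integration.integral_sum) auto
    also have "\<dots> = - (\<Sum>i\<in>UNIV. h $ i * (\<integral>x. G x $ i * \<psi> x \<partial>lebesgue))"
      by (simp add: w(1) sum_negf)
    also have "\<dots> = - (\<integral>x. (\<Sum>i\<in>UNIV. h $ i * (G x $ i * \<psi> x)) \<partial>lebesgue)"
      using w(3) by (subst Bochner_Integration.integral_sum) auto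
    also have "(\<integral>x. (\<Sum>i\<in>UNIV. h $ i * (G x $ i * \<psi> x)) \<partial>lebesgue) = (\<integral>x. g x * \<psi> x \<partial>lebesgue)"
    proof (rule integral_cong_AE)
      show "(\<lambda>x. (\<Sum>i\<in>UNIV. h $ i * (G x $ i * \<psi> x))) \<in> borel_measurable lebesgue"
        by (intro borel_measurable_integrable Bochner_Integration.integrable_sum integrable_mult_right w(3))
      show "(\<lambda>x. g x * \<psi> x) \<in> borel_measurable lebesgue" unfolding \<psi>_def by (rule measurable_completion) measurable
      show "AE x in lebesgue. (\<Sum>i\<in>UNIV. h $ i * (G x $ i * \<psi> x)) = g x * \<psi> x"
        using g(2)
      proof eventually_elim
        case (elim x)
        show ?case
        proof (cases "x \<in> L")
          case True
          then have "g x = G x \<bullet> h" using elim LE by (auto simp: zero_ext_def)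
          then show ?thesis by (simp add: inner_vec_def sum_distrib_left algebra_simps)
        qed (use vanish(1)[OF _ t] in \<open>simp add: \<psi>_def\<close>)
      qed
    qed
    also have "(\<integral>x. g x * \<psi> x \<partial>lebesgue) = (\<integral>x. g x * \<psi> x \<partial>lborel)"
      unfolding \<psi>_def by (rule integral_completion) measurable
    also have "\<dots> = (\<integral>x. g (x + t *\<^sub>R h) * \<psi> (x + t *\<^sub>R h) \<partial>lborel)"
      unfolding \<psi>_def by (rule lborel_translate(1)[symmetric]) measurable
    finally show ?thesis by (simp add: \<psi>_def)
  qed
  have "(\<integral>x. (u (x + h) - u x) * \<phi> x \<partial>lebesgue) = (\<integral>x. u x * \<phi> (x - h) - u x * \<phi> x \<partial>lebesgue)"
    using integral_translate_test[where h = h, OF \<phi>(2) KO u c\<phi> \<phi>(3)] by (simp add: left_diff_distrib)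
  also have "\<dots> = (\<integral>x. v x * (\<phi> (x - h) - \<phi> x) \<partial>lebesgue)"
  proof (rule integral_cong_AE)
    show "(\<lambda>x. u x * \<phi> (x - h) - u x * \<phi> x) \<in> borel_measurable lebesgue"
      using integral_translate_test(3,4)[where h = h, OF \<phi>(2) KO u c\<phi> \<phi>(3)] by (intro borel_measurable_diff) auto
    show "(\<lambda>x. v x * (\<phi> (x - h) - \<phi> x)) \<in> borel_measurable lebesgue" by (rule measurable_completion) measurable
    show "AE x in lebesgue. u x * \<phi> (x - h) - u x * \<phi> x = v x * (\<phi> (x - h) - \<phi> x)"
      using v(2)
    proof eventually_elim
      case (elim x)
      then show ?case using vanish(1)[of x 0] vanish(1)[of x 1]
        by (cases "x \<in> L") (auto simp: zero_ext_def algebra_simps)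
    qed
  qed
  also have "\<dots> = (\<integral>x. v x * (\<phi> (x - h) - \<phi> x) \<partial>lborel)" by (rule integral_completion) measurable
  also have "\<dots> = (\<integral>x. - (\<integral>t. v x * (grad \<phi> (x - t *\<^sub>R h) \<bullet> h) \<partial>unit_measure) \<partial>lborel)"
    by (simp add: smooth_segment_integral[OF \<phi>(1)] right_diff_distrib)
  also have "\<dots> = - (\<integral>x. \<integral>t. v x * (grad \<phi> (x - t *\<^sub>R h) \<bullet> h) \<partial>unit_measure \<partial>lborel)" by simp
  also have "\<dots> = - (\<integral>t. \<integral>x. v x * (grad \<phi> (x - t *\<^sub>R h) \<bullet> h) \<partial>lborel \<partial>unit_measure)"
    using Fubini_integral[OF p1] by simp
  also have "(\<integral>t. \<integral>x. v x * (grad \<phi> (x - t *\<^sub>R h) \<bullet> h) \<partial>lborel \<partial>unit_measure)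
      = (\<integral>t. - (\<integral>x. g (x + t *\<^sub>R h) * \<phi> x \<partial>lborel) \<partial>unit_measure)"
    by (intro Bochner_Integration.integral_cong slice) (auto simp: space_restrict_space)
  also have "- \<dots> = (\<integral>t. \<integral>x. g (x + t *\<^sub>R h) * \<phi> x \<partial>lborel \<partial>unit_measure)" by simp
  also have "\<dots> = (\<integral>x. \<integral>t. g (x + t *\<^sub>R h) * \<phi> x \<partial>unit_measure \<partial>lborel)"
    using Fubini_integral[OF p2] by simp
  also have "\<dots> = (\<integral>x. (\<integral>t. g (x + t *\<^sub>R h) \<partial>unit_measure) * \<phi> x \<partial>lborel)" by simp
  also have "\<dots> = (\<integral>x. (\<integral>t. g (x + t *\<^sub>R h) \<partial>unit_measure) * \<phi> x \<partial>lebesgue)"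
  proof (rule integral_completion[symmetric])
    have "(\<lambda>x. \<integral>t. g (x + t *\<^sub>R h) \<partial>unit_measure) \<in> borel_measurable lborel"
      by (rule borel_measurable_integrable, rule integrable_snd)
         (use shear_integrable[OF g(1), of h] in \<open>simp add: case_prod_unfold\<close>)
    then show "(\<lambda>x. (\<integral>t. g (x + t *\<^sub>R h) \<partial>unit_measure) * \<phi> x) \<in> borel_measurable lborel" by (intro borel_measurable_times) auto
  qed
  finally show ?thesis .
qed

text \<open>By the fundamental lemma the difference of \<open>u\<close> equals the average of \<open>\<langle>G, h\<rangle>\<close> along the segment
  almost everywhere on \<open>D\<close>. Keeping \<open>E\<close> separate from \<open>\<Omega>\<close> localises the bound to the
  neighbourhood of \<open>D\<close> that the segments actually meet.\<close>

lemma difference_quotient_bound: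
  fixes u :: "real^'n::finite \<Rightarrow> real"
  assumes O: "open \<Omega>" and uG: "has_weak_gradient \<Omega> u G"
    and E: "E \<subseteq> \<Omega>" "E \<in> sets lebesgue" "bounded E" and r: "r > 1" and G: "in_Lp (lebesgue_on E) r G"
    and D: "open D" "\<And>x t. x \<in> D \<Longrightarrow> 0 \<le> t \<Longrightarrow> t \<le> 1 \<Longrightarrow> x + t *\<^sub>R h \<in> E"
  shows "in_Lp (lebesgue_on D) r (\<lambda>x. u (x + h) - u x)"
    and "(\<integral>x. \<bar>u (x + h) - u x\<bar> powr r \<partial>lebesgue_on D) \<le> norm h powr r * (\<integral>x. norm (G x) powr r \<partial>lebesgue_on E)"
proof -
  let ?g0 = "zero_ext E (\<lambda>x. G x \<bullet> h)"
  have Dm: "D \<in> sets lebesgue" using D(1) by auto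
  have Gh: "in_Lp (lebesgue_on E) r (\<lambda>x. G x \<bullet> h)"
    by (rule in_Lp_bound[OF _ G, where C = "norm h"]) (use r G Cauchy_Schwarz_ineq2 in \<open>auto simp: mult.commute[of "norm h"]\<close>)
  have "integrable (lebesgue_on E) (\<lambda>x. G x \<bullet> h)"
    by (rule in_Lp_imp_integrable[OF finite_lebesgue_on_bounded[OF E(3,2)] _ Gh]) (use r in simp)
  then have "integrable lebesgue ?g0"
    using Lebesgue_Measure.integrable_restrict_UNIV[OF E(2), of "\<lambda>x. G x \<bullet> h"] by (simp add: zero_ext_def[abs_def])
  then obtain g where g: "g \<in> borel_measurable borel" "AE x in lebesgue. ?g0 x = g x" "integrable lborel g"
    using integrable_borel_representative by blast
  note [measurable] = g(1)
  have g0r: "in_Lp lebesgue r ?g0" using in_Lp_zero_ext(1)[OF E(2), of r "\<lambda>x. G x \<bullet> h"] Gh r by simp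
  have gL: "in_Lp lebesgue r g" by (rule in_Lp_cong_AE[OF g0r _ g(2)]) (use g(1) in \<open>simp add: measurable_completion\<close>)
  then have gr: "integrable lborel (\<lambda>x. \<bar>g x\<bar> powr r)"
    by (simp add: in_Lp_def integrable_completion)
  let ?I = "\<lambda>x. \<integral>t. g (x + t *\<^sub>R h) \<partial>unit_measure"
  note I = path_average_bound[OF g(1,3) gr r, of h]
  have Im: "?I \<in> borel_measurable lebesgue" using I(1) by (intro measurable_completion) auto
  have IL: "in_Lp lebesgue r ?I" using I(2) Im
    by (simp add: in_Lp_def integrable_completion borel_measurable_integrable)
  have ae: "AE x in lebesgue. x \<in> D \<longrightarrow> ?I x = u (x + h) - u x"
  proof (rule AE_eq_of_test_integrals[OF D(1)])
    have Iint: "integrable lebesgue ?I" using I(1) by (simp add: integrable_completion borel_measurable_integrable)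
    have "integrable (lebesgue_on UNIV) ?I" using Iint by (simp add: lebesgue_on_UNIV_eq)
    then have "?I locally_integrable_on UNIV" by (rule integrable_imp_locally_integrable) auto
    then show "?I locally_integrable_on D" unfolding locally_integrable_on_def by blast
    have u: "u locally_integrable_on \<Omega>" using uG by (auto simp: has_weak_gradient_def)
    show "(\<lambda>x. u (x + h) - u x) locally_integrable_on D"
      unfolding locally_integrable_on_def
    proof safe
      fix K assume K: "compact K" "K \<subseteq> D"
      let ?K' = "(\<lambda>x. x + h) ` K"
      have K': "compact ?K'" using K by (auto intro!: compact_continuous_image continuous_intros)
      have sub: "?K' \<subseteq> \<Omega>" "K \<subseteq> \<Omega>" using D(2)[of _ 1] D(2)[of _ 0] K(2) E(1) by fastforce+
      have "integrable (lebesgue_on ?K') u" "integrable (lebesgue_on K) u"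
        using u K(1) K' sub unfolding locally_integrable_on_def by blast+
      have m: "K \<in> sets lebesgue" "?K' \<in> sets lebesgue"
        by (rule fmeasurableD[OF lmeasurable_compact[OF K(1)]], rule fmeasurableD[OF lmeasurable_compact[OF K']])
      have "integrable lebesgue (\<lambda>x. if x \<in> ?K' then u x else 0)"
        using \<open>integrable (lebesgue_on ?K') u\<close> m(2) by (simp only: Lebesgue_Measure.integrable_restrict_UNIV)
      from lebesgue_translate(1)[OF this, of h]
      have "integrable lebesgue (\<lambda>x. if x \<in> K then u (x + h) else 0)" by (simp add: image_iff)
      then have "integrable (lebesgue_on K) (\<lambda>x. u (x + h))"
        using m(1) by (simp only: Lebesgue_Measure.integrable_restrict_UNIV)
      then show "integrable (lebesgue_on K) (\<lambda>x. u (x + h) - u x)"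
        using \<open>integrable (lebesgue_on K) u\<close> by simp
    qed
    fix \<phi> assume "\<phi> \<in> test_function D"
    then obtain K where K: "smooth \<phi>" "compact K" "\<And>x. x \<notin> K \<Longrightarrow> \<phi> x = 0" "K \<subseteq> D"
      using test_functionE by metis
    show "(\<integral>x. ?I x * \<phi> x \<partial>lebesgue) = (\<integral>x. (u (x + h) - u x) * \<phi> x \<partial>lebesgue)"
      by (rule difference_test_integral[OF O uG E(1) g(3,2) K(1-3), symmetric]) (assumption | (rule D(2), rule subsetD[OF K(4)], assumption+))+
  qed
  have ae': "AE x in lebesgue_on D. ?I x = u (x + h) - u x" using ae Dm by (simp add: AE_lebesgue_on_iff)
  have ID: "in_Lp (lebesgue_on D) r ?I"
    by (rule in_Lp_subset[of D UNIV]) (use Dm r IL in \<open>auto simp: lebesgue_on_UNIV_eq\<close>)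
  have wm: "(\<lambda>x. u (x + h) - u x) \<in> borel_measurable (lebesgue_on D)"
    by (rule measurable_lebesgue_on_AE[OF Dm _ ae]) (use ID in auto)
  show w: "in_Lp (lebesgue_on D) r (\<lambda>x. u (x + h) - u x)"
    by (rule in_Lp_cong_AE[OF ID wm ae'])
  have "(\<integral>x. \<bar>u (x + h) - u x\<bar> powr r \<partial>lebesgue_on D) = (\<integral>x. norm (?I x) powr r \<partial>lebesgue_on D)"
  proof (rule integral_cong_AE)
    show "(\<lambda>x. \<bar>u (x + h) - u x\<bar> powr r) \<in> borel_measurable (lebesgue_on D)"
      using borel_measurable_integrable[OF in_Lp_integrable[OF w]] by simp
    show "(\<lambda>x. norm (?I x) powr r) \<in> borel_measurable (lebesgue_on D)"
      by (rule borel_measurable_integrable[OF in_Lp_integrable[OF ID]])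
    show "AE x in lebesgue_on D. \<bar>u (x + h) - u x\<bar> powr r = norm (?I x) powr r"
      using ae' by eventually_elim simp
  qed
  also have "\<dots> \<le> (\<integral>x. norm (?I x) powr r \<partial>lebesgue_on UNIV)"
    by (rule in_Lp_subset(2)) (use Dm r IL in \<open>auto simp: lebesgue_on_UNIV_eq\<close>)
  also have "\<dots> = (\<integral>x. \<bar>?I x\<bar> powr r \<partial>lborel)"
    using I(2) by (simp add: lebesgue_on_UNIV_eq integral_completion borel_measurable_integrable)
  also have "\<dots> \<le> (\<integral>x. \<bar>g x\<bar> powr r \<partial>lborel)" by (rule I(3))
  also have "\<dots> = (\<integral>x. \<bar>g x\<bar> powr r \<partial>lebesgue)"
    by (rule integral_completion[symmetric]) measurable
  also have "\<dots> = (\<integral>x. norm (?g0 x) powr r \<partial>lebesgue)"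
  proof (rule integral_cong_AE)
    show "(\<lambda>x. \<bar>g x\<bar> powr r) \<in> borel_measurable lebesgue" by (rule measurable_completion) measurable
    show "(\<lambda>x. norm (?g0 x) powr r) \<in> borel_measurable lebesgue" using in_Lp_integrable[OF g0r] by (rule borel_measurable_integrable)
    show "AE x in lebesgue. \<bar>g x\<bar> powr r = norm (?g0 x) powr r" using g(2) by eventually_elim simp
  qed
  also have "\<dots> = (\<integral>x. norm (G x \<bullet> h) powr r \<partial>lebesgue_on E)" using E(2) r by (intro in_Lp_zero_ext(2)) auto
  also have "\<dots> \<le> (\<integral>x. norm h powr r * norm (G x) powr r \<partial>lebesgue_on E)"
  proof (rule integral_mono)
    show "integrable (lebesgue_on E) (\<lambda>x. norm (G x \<bullet> h) powr r)" using Gh by (rule in_Lp_integrable)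
    show "integrable (lebesgue_on E) (\<lambda>x. norm h powr r * norm (G x) powr r)" using in_Lp_integrable[OF G] by simp
    show "norm (G x \<bullet> h) powr r \<le> norm h powr r * norm (G x) powr r" for x
      unfolding powr_mult[symmetric]
      using Cauchy_Schwarz_ineq2[of "G x" h] r by (intro powr_mono2) (auto simp: mult.commute)
  qed
  finally show "(\<integral>x. \<bar>u (x + h) - u x\<bar> powr r \<partial>lebesgue_on D) \<le> norm h powr r * (\<integral>x. norm (G x) powr r \<partial>lebesgue_on E)"
    by simp
qed

section \<open>Maximising sequences of the dual problem\<close>

context exponents
begin

lemma flux_measurable [measurable]: "(flux :: 'a::euclidean_space \<Rightarrow> 'a) \<in> borel_measurable borel"
  unfolding flux_def[abs_def] by measurable

lemma energy_measurable [measurable]: "(energy :: 'a::euclidean_space \<Rightarrow> real) \<in> borel_measurable borel"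
  unfolding energy_def[abs_def] by measurable

lemma conj_energy_measurable [measurable]: "(conj_energy :: 'a::euclidean_space \<Rightarrow> real) \<in> borel_measurable borel"
  unfolding conj_energy_def[abs_def] by measurable

lemma in_Lp_flux:
  fixes g :: "'a \<Rightarrow> 'b::euclidean_space"
  assumes "in_Lp M q g" shows "in_Lp M p (\<lambda>x. flux (g x))"
proof -
  have [measurable]: "g \<in> borel_measurable M" using assms by auto
  have "integrable M (\<lambda>x. norm (flux (g x)) powr p)"
    by (rule Bochner_Integration.integrable_bound[OF in_Lp_integrable[OF assms]]) (auto simp: norm_flux_powr_le)
  then show ?thesis by (simp add: in_Lp_def)
qed

lemma integrable_energy:
  fixes s :: "'a \<Rightarrow> 'b::euclidean_space"
  assumes "finite_measure M" "in_Lp M p s" shows "integrable M (\<lambda>x. energy (s x))"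
  using in_Lp_integrable[OF assms(2)] in_Lp_imp_integrable[OF assms(1) _ assms(2)] p_gt_2
  by (auto simp: energy_def)

lemma integrable_conj_energy:
  fixes g :: "'a \<Rightarrow> 'b::euclidean_space"
  assumes "in_Lp M q g" shows "integrable M (\<lambda>x. conj_energy (g x))"
proof -
  have [measurable]: "g \<in> borel_measurable M" using assms by auto
  show ?thesis
  proof (rule Bochner_Integration.integrable_bound[OF in_Lp_integrable[OF assms]])
    have "conj_energy z \<le> norm z powr q" for z :: 'b
    proof -
      have "max 0 (norm z - 1) powr q \<le> norm z powr q" using q by (intro powr_mono2) auto
      moreover have "conj_energy z \<le> max 0 (norm z - 1) powr q"
        using q mult_right_mono[of 1 q "max 0 (norm z - 1) powr q"] by (simp add: conj_energy_def divide_le_eq mult.commute)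
      ultimately show ?thesis by linarith
    qed
    then show "AE x in M. norm (conj_energy (g x)) \<le> norm (norm (g x) powr q)" by (intro AE_I2) (simp add: abs_of_nonneg conj_energy_nonneg)
  qed measurable
qed

lemma Holder_pq:
  fixes f g :: "'a \<Rightarrow> 'b::euclidean_space"
  assumes "in_Lp M p f" "in_Lp M q g"
  shows "integrable M (\<lambda>x. f x \<bullet> g x)" "integrable M (\<lambda>x. norm (f x) * norm (g x))"
    and "(\<integral>x. norm (f x) * norm (g x) \<partial>M) \<le> norm_Lp M p f * norm_Lp M q g"
    and "\<bar>\<integral>x. f x \<bullet> g x \<partial>M\<bar> \<le> norm_Lp M p f * norm_Lp M q g"
  using Holder_inner[OF _ _ conj_pq assms] p_gt_2 q by auto

text \<open>The tangent inequality in the reverse role: it bounds the energy of a limit by the energies of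
  its approximants.\<close>

lemma energy_diff_le: "energy t - energy s \<le> (norm t powr (p - 2) *\<^sub>R t) \<bullet> (t - s) + norm (t - s)"
  using power_gradient_ineq[of t s] norm_triangle_ineq2[of t s]
  by (simp add: energy_def inner_diff_right)

end

locale variational = exponents p q for p q :: real +
  fixes \<Omega> :: "(real^'n::finite) set" and f :: "real^'n \<Rightarrow> real" and \<sigma> :: "real^'n \<Rightarrow> real^'n"
  assumes open_\<Omega>: "open \<Omega>" and bounded_\<Omega>: "bounded \<Omega>" and f_Lp: "f \<in> Lp p \<Omega>"
    and solution: "P1_solution q \<Omega> f \<sigma>"
begin

abbreviation "M \<equiv> lebesgue_on \<Omega>"
abbreviation "D u \<equiv> weak_gradient \<Omega> u"
abbreviation "J \<equiv> P2_functional q \<Omega> f"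

lemma \<Omega>_sets: "\<Omega> \<in> sets lebesgue" using open_\<Omega> by auto

lemma finite_M: "finite_measure M" by (rule finite_lebesgue_on_bounded[OF bounded_\<Omega> \<Omega>_sets])

lemma W1_weak_gradient:
  assumes "u \<in> W1 q \<Omega>"
  shows "in_Lp M q u" "has_weak_gradient \<Omega> u (D u)" "in_Lp M q (D u)"
proof -
  obtain G where G: "in_Lp M q u" "in_Lp M q G" "has_weak_gradient \<Omega> u G"
    using assms by (auto simp: W1_def Lp_iff)
  show "in_Lp M q u" by fact
  show "has_weak_gradient \<Omega> u (D u)" by (rule weak_gradient_eq(1)[OF open_\<Omega> G(3)])
  show "in_Lp M q (D u)" by (rule in_Lp_weak_gradient[OF open_\<Omega> G(3) \<Omega>_sets _ G(2)]) simp
qed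

lemma W1_intro:
  assumes "in_Lp M q u" "has_weak_gradient \<Omega> u G" "in_Lp M q G"
  shows "u \<in> W1 q \<Omega>" "AE x in M. D u x = G x"
  using assms weak_gradient_eq(2)[OF open_\<Omega> assms(2)] by (auto simp: W1_def Lp_iff AE_lebesgue_on_iff[OF \<Omega>_sets])

lemma W1_linear:
  assumes "u \<in> W1 q \<Omega>" "v \<in> W1 q \<Omega>"
  shows "(\<lambda>x. u x + t * v x) \<in> W1 q \<Omega>" "AE x in M. D (\<lambda>x. u x + t * v x) x = D u x + t *\<^sub>R D v x"
proof -
  note u = W1_weak_gradient[OF assms(1)] and v = W1_weak_gradient[OF assms(2)]
  have 1: "in_Lp M q (\<lambda>x. u x + t * v x)"
    using in_Lp_add[OF _ u(1) in_Lp_scaleR[OF v(1)], of t] q by simp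
  have 2: "in_Lp M q (\<lambda>x. D u x + t *\<^sub>R D v x)"
    using in_Lp_add[OF _ u(3) in_Lp_scaleR[OF v(3)], of t] q by simp
  have 3: "has_weak_gradient \<Omega> (\<lambda>x. u x + t * v x) (\<lambda>x. D u x + t *\<^sub>R D v x)"
    by (rule has_weak_gradient_linear[OF open_\<Omega> u(2) v(2)])
  show "(\<lambda>x. u x + t * v x) \<in> W1 q \<Omega>" "AE x in M. D (\<lambda>x. u x + t * v x) x = D u x + t *\<^sub>R D v x"
    by (rule W1_intro[OF 1 3 2])+
qed

lemma zero_W1: "(\<lambda>x. 0) \<in> W1 q \<Omega>"
proof (rule W1_intro)
  show "has_weak_gradient \<Omega> (\<lambda>x. 0) (\<lambda>x. 0)" by (auto simp: has_weak_gradient_def locally_integrable_on_def)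
qed (auto intro: in_Lp_const finite_M)

lemma \<sigma>_Lp: "in_Lp M p \<sigma>"
  and \<sigma>_eq: "\<phi> \<in> W1 q \<Omega> \<Longrightarrow> (\<integral>x. \<sigma> x \<bullet> D \<phi> x \<partial>M) = (\<integral>x. f x * \<phi> x \<partial>M)"
  and \<sigma>_min: "in_Lp M p \<tau> \<Longrightarrow> (\<And>\<phi>. \<phi> \<in> W1 q \<Omega> \<Longrightarrow> (\<integral>x. \<tau> x \<bullet> D \<phi> x \<partial>M) = (\<integral>x. f x * \<phi> x \<partial>M))
      \<Longrightarrow> (\<integral>x. energy (\<sigma> x) \<partial>M) \<le> (\<integral>x. energy (\<tau> x) \<partial>M)"
proof -
  have adm: "P1_admissible q \<Omega> f \<tau> \<longleftrightarrow> in_Lp M p \<tau> \<and> (\<forall>\<phi>\<in>W1 q \<Omega>. (\<integral>x. \<tau> x \<bullet> D \<phi> x \<partial>M) = (\<integral>x. f x * \<phi> x \<partial>M))" for \<tau>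
    by (simp add: P1_admissible_def Lp_iff flip: p_def)
  have en: "P1_energy p \<Omega> \<tau> = (\<integral>x. energy (\<tau> x) \<partial>M)" for \<tau> by (simp add: P1_energy_def energy_def)
  have s: "P1_admissible q \<Omega> f \<sigma>" "P1_admissible q \<Omega> f \<tau> \<Longrightarrow> P1_energy p \<Omega> \<sigma> \<le> P1_energy p \<Omega> \<tau>" for \<tau>
    using solution by (auto simp: P1_solution_def is_arg_min_def not_less simp flip: p_def)
  show "in_Lp M p \<sigma>" "\<phi> \<in> W1 q \<Omega> \<Longrightarrow> (\<integral>x. \<sigma> x \<bullet> D \<phi> x \<partial>M) = (\<integral>x. f x * \<phi> x \<partial>M)" using s(1) by (auto simp: adm)
  show "in_Lp M p \<tau> \<Longrightarrow> (\<And>\<phi>. \<phi> \<in> W1 q \<Omega> \<Longrightarrow> (\<integral>x. \<tau> x \<bullet> D \<phi> x \<partial>M) = (\<integral>x. f x * \<phi> x \<partial>M))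
      \<Longrightarrow> (\<integral>x. energy (\<sigma> x) \<partial>M) \<le> (\<integral>x. energy (\<tau> x) \<partial>M)"
    using s(2)[of \<tau>] by (auto simp: adm en)
qed

text \<open>Admissibility of \<open>\<sigma>\<close> turns the linear term \<open>\<integral> u f\<close> into \<open>\<integral> \<langle>\<sigma>, \<nabla>u\<rangle>\<close>, so that the functional
  depends on the gradient only.\<close>

lemma P2_via_flux: "u \<in> W1 q \<Omega> \<Longrightarrow> J u = (\<integral>x. \<sigma> x \<bullet> D u x \<partial>M) - (\<integral>x. conj_energy (D u x) \<partial>M)"
  by (simp add: P2_functional_def \<sigma>_eq conj_energy_def mult.commute)

text \<open>Both bounds come from the Fenchel-Young inequality, applied to \<open>\<sigma>\<close> for the upper bound and
  to \<open>2 \<sigma>\<close> for coercivity.\<close>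

lemma P2_bounds:
  assumes "u \<in> W1 q \<Omega>"
  shows "J u \<le> (\<integral>x. energy (\<sigma> x) \<partial>M)"
    and "(\<integral>x. norm (D u x) powr q \<partial>M) \<le> 2 powr q * (measure M (space M) + q * ((\<integral>x. energy (2 *\<^sub>R \<sigma> x) \<partial>M) - 2 * J u))"
proof -
  note u = W1_weak_gradient[OF assms]
  note i = Holder_pq(1)[OF \<sigma>_Lp u(3)] integrable_conj_energy[OF u(3)] integrable_energy[OF finite_M \<sigma>_Lp]
    integrable_energy[OF finite_M in_Lp_scaleR[OF \<sigma>_Lp, of 2]]
  interpret finite_measure M by (rule finite_M)
  have "(\<integral>x. \<sigma> x \<bullet> D u x \<partial>M) \<le> (\<integral>x. energy (\<sigma> x) + conj_energy (D u x) \<partial>M)"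
    using i Fenchel_Young[of "D u _" "\<sigma> _"] by (intro integral_mono) (auto simp: inner_commute)
  then show "J u \<le> (\<integral>x. energy (\<sigma> x) \<partial>M)" using i by (simp add: P2_via_flux[OF assms])
  have "(\<integral>x. 2 * (\<sigma> x \<bullet> D u x) \<partial>M) \<le> (\<integral>x. energy (2 *\<^sub>R \<sigma> x) + conj_energy (D u x) \<partial>M)"
    using i Fenchel_Young[of "D u _" "2 *\<^sub>R \<sigma> _"] by (intro integral_mono) (auto simp: inner_commute)
  then have "(\<integral>x. conj_energy (D u x) \<partial>M) \<le> (\<integral>x. energy (2 *\<^sub>R \<sigma> x) \<partial>M) - 2 * J u" using i by (simp add: P2_via_flux[OF assms])
  moreover have "(\<integral>x. norm (D u x) powr q \<partial>M) \<le> (\<integral>x. 2 powr q * (1 + q * conj_energy (D u x)) \<partial>M)"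
    using i in_Lp_integrable[OF u(3)] norm_powr_le_conj_energy by (intro integral_mono) auto
  moreover have "\<dots> = 2 powr q * (measure M (space M) + q * (\<integral>x. conj_energy (D u x) \<partial>M))" using i by simp
  ultimately show "(\<integral>x. norm (D u x) powr q \<partial>M) \<le> 2 powr q * (measure M (space M) + q * ((\<integral>x. energy (2 *\<^sub>R \<sigma> x) \<partial>M) - 2 * J u))"
    using q by (smt (verit) mult_left_mono powr_ge_zero)
qed

text \<open>Comparison with the competitor \<open>u + t v\<close>; the expansion of \<open>conj_energy\<close> bounds its value from
  below.\<close>

lemma first_variation:
  assumes "u \<in> W1 q \<Omega>" "v \<in> W1 q \<Omega>" and S: "\<And>w. w \<in> W1 q \<Omega> \<Longrightarrow> J w \<le> S" and "S - \<delta> \<le> J u"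
  shows "t * (\<integral>x. (\<sigma> x - flux (D u x)) \<bullet> D v x \<partial>M) \<le> \<delta> + growth_const * \<bar>t\<bar> powr q * (\<integral>x. norm (D v x) powr q \<partial>M)"
proof -
  let ?w = "\<lambda>x. u x + t * v x"
  note u = W1_weak_gradient[OF assms(1)] and v = W1_weak_gradient[OF assms(2)] and w = W1_linear[OF assms(1,2), of t]
  note wD = W1_weak_gradient[OF w(1)]
  have Fu: "in_Lp M p (\<lambda>x. flux (D u x))" by (rule in_Lp_flux[OF u(3)])
  note i = Holder_pq(1)[OF \<sigma>_Lp u(3)] Holder_pq(1)[OF \<sigma>_Lp v(3)] Holder_pq(1)[OF \<sigma>_Lp wD(3)]
    Holder_pq(1)[OF Fu v(3)] integrable_conj_energy[OF u(3)] integrable_conj_energy[OF wD(3)] in_Lp_integrable[OF v(3)]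
  have "J u + t * (\<integral>x. (\<sigma> x - flux (D u x)) \<bullet> D v x \<partial>M) - growth_const * \<bar>t\<bar> powr q * (\<integral>x. norm (D v x) powr q \<partial>M)
     = (\<integral>x. (\<sigma> x \<bullet> D u x - conj_energy (D u x)) + t * (\<sigma> x \<bullet> D v x - flux (D u x) \<bullet> D v x) - growth_const * \<bar>t\<bar> powr q * norm (D v x) powr q \<partial>M)"
    using i by (simp add: P2_via_flux[OF assms(1)] inner_diff_left)
  also have "\<dots> \<le> (\<integral>x. \<sigma> x \<bullet> D ?w x - conj_energy (D ?w x) \<partial>M)"
  proof (rule integral_mono_AE)
    show "AE x in M. (\<sigma> x \<bullet> D u x - conj_energy (D u x)) + t * (\<sigma> x \<bullet> D v x - flux (D u x) \<bullet> D v x) - growth_const * \<bar>t\<bar> powr q * norm (D v x) powr q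
        \<le> \<sigma> x \<bullet> D ?w x - conj_energy (D ?w x)"
      using w(2)
    proof eventually_elim
      case (elim x)
      have "conj_energy (D u x + t *\<^sub>R D v x) \<le> conj_energy (D u x) + t * (flux (D u x) \<bullet> D v x) + growth_const * \<bar>t\<bar> powr q * norm (D v x) powr q"
        using conj_energy_expansion[of "D u x" "t *\<^sub>R D v x"] by (simp add: powr_mult inner_commute mult.assoc)
      then show ?case unfolding elim by (simp add: inner_add_right algebra_simps)
    qed
  qed (use i in auto)
  also have "\<dots> = J ?w" using i by (simp add: P2_via_flux[OF w(1)])
  also have "\<dots> \<le> S" by (rule S[OF w(1)])
  finally show ?thesis using assms(4) by linarith
qed

text \<open>In the first variation choose \<open>t\<close> so small that the \<open>q\<close>-th order term, which is \<open>o(t)\<close>, is below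
  \<open>t \<epsilon> / 2\<close>, and then \<open>\<delta> = t \<epsilon> / 2\<close>. The choice depends on \<open>v\<close> only through the bound \<open>B\<close>.\<close>

lemma almost_maximal_almost_critical:
  assumes S: "\<And>w. w \<in> W1 q \<Omega> \<Longrightarrow> J w \<le> S" and "\<epsilon> > 0"
  shows "\<exists>\<delta>>0. \<forall>u\<in>W1 q \<Omega>. \<forall>v\<in>W1 q \<Omega>. S - \<delta> \<le> J u \<longrightarrow> (\<integral>x. norm (D v x) powr q \<partial>M) \<le> B
     \<longrightarrow> \<bar>\<integral>x. (\<sigma> x - flux (D u x)) \<bullet> D v x \<partial>M\<bar> \<le> \<epsilon>"
proof -
  define b where "b = \<bar>B\<bar> + 1"
  have b: "b > 0" "B \<le> b" by (auto simp: b_def)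
  \<comment> \<open>the solution of \<open>growth_const * t powr q * b = t * \<epsilon> / 2\<close>\<close>
  define t where "t = (\<epsilon> / (2 * growth_const * b)) powr (1 / (q - 1))"
  have t: "t > 0" using assms(2) b growth_const_pos by (simp add: t_def)
  have tq: "t powr q = t * (\<epsilon> / (2 * growth_const * b))"
  proof -
    have "t powr (q - 1) = \<epsilon> / (2 * growth_const * b)" using assms(2) b growth_const_pos q by (simp add: t_def powr_powr)
    then show ?thesis using powr_mult_self[of t q] t by simp
  qed
  show ?thesis
  proof (intro exI[of _ "t * \<epsilon> / 2"] conjI ballI impI)
    show "t * \<epsilon> / 2 > 0" using t assms(2) by simp
    fix u v assume uv: "u \<in> W1 q \<Omega>" "v \<in> W1 q \<Omega>" and uv': "S - t * \<epsilon> / 2 \<le> J u" "(\<integral>x. norm (D v x) powr q \<partial>M) \<le> B"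
    note uv = uv uv'
    let ?A = "\<integral>x. (\<sigma> x - flux (D u x)) \<bullet> D v x \<partial>M"
    have *: "growth_const * t powr q * (\<integral>x. norm (D v x) powr q \<partial>M) \<le> t * \<epsilon> / 2"
    proof -
      have "growth_const * t powr q * (\<integral>x. norm (D v x) powr q \<partial>M) \<le> growth_const * t powr q * b"
        using uv(4) b growth_const_pos by (intro mult_left_mono) auto
      also have "\<dots> = t * \<epsilon> / 2" using b growth_const_pos by (simp add: tq)
      finally show ?thesis .
    qed
    have 1: "t * ?A \<le> t * \<epsilon> / 2 + growth_const * t powr q * (\<integral>x. norm (D v x) powr q \<partial>M)"
      using first_variation[OF uv(1,2) S uv(3), of t] t by simp
    have 2: "t * - ?A \<le> t * \<epsilon> / 2 + growth_const * t powr q * (\<integral>x. norm (D v x) powr q \<partial>M)"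
      using first_variation[OF uv(1,2) S uv(3), of "-t"] t by simp
    have "t * ?A \<le> t * \<epsilon>" "t * - ?A \<le> t * \<epsilon>" using 1 2 * by linarith+
    then have "?A \<le> \<epsilon>" "- ?A \<le> \<epsilon>" by (simp_all only: mult_le_cancel_left_pos[OF t])
    then show "\<bar>?A\<bar> \<le> \<epsilon>" by linarith
  qed
qed

lemma norm_Lp_tendsto_0:
  assumes "r > 0" "(\<lambda>n. \<integral>x. norm (s n x) powr r \<partial>M) \<longlonglongrightarrow> 0" shows "(\<lambda>n. norm_Lp M r (s n)) \<longlonglongrightarrow> 0"
  using tendsto_powr'[OF assms(2) tendsto_const[of "1/r"]] assms(1) by (simp add: norm_Lp_def)

text \<open>The fluxes are compared with each other by monotonicity, which gives a limit \<open>t\<close> in \<open>L^p\<close>. Almost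
  criticality makes \<open>t\<close> admissible, hence \<open>\<integral> H(\<sigma>) \<le> \<integral> H(t)\<close>; with uniform convexity at the
  flux of \<open>u\<^sub>k\<close> this forces the fluxes to converge to \<open>\<sigma>\<close>.\<close>

theorem flux_convergence:
  assumes u: "\<And>k. u k \<in> W1 q \<Omega>" and S: "\<And>w. w \<in> W1 q \<Omega> \<Longrightarrow> J w \<le> S" and lim: "(\<lambda>k. J (u k)) \<longlonglongrightarrow> S"
  shows "(\<lambda>k. \<integral>x. norm (\<sigma> x - flux (D (u k) x)) powr p \<partial>M) \<longlonglongrightarrow> 0"
    and "\<exists>B. \<forall>k. (\<integral>x. norm (D (u k) x) powr q \<partial>M) \<le> B"
proof -
  define s where "s k x = flux (D (u k) x)" for k x
  note uD = W1_weak_gradient[OF u]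
  have s: "in_Lp M p (s k)" for k unfolding s_def by (rule in_Lp_flux[OF uD(3)])
  have p1: "p \<ge> 1" "p > 1" using p_gt_2 by auto
  have near: "\<exists>N. \<forall>k\<ge>N. S - \<delta> \<le> J (u k)" if "\<delta> > 0" for \<delta>
    using LIMSEQ_D[OF lim that] by (force simp: abs_le_iff)
  obtain b where b: "\<And>k. - b \<le> J (u k)"
  proof -
    from lim have "Bseq (\<lambda>k. J (u k))" by (intro convergent_imp_Bseq convergentI)
    then obtain b where "\<And>k. norm (J (u k)) \<le> b" by (auto simp: Bseq_def)
    then have "- b \<le> J (u k)" for k by (metis abs_le_iff minus_le_iff real_norm_def)
    then show ?thesis by (rule that)
  qed
  define B where "B = 2 powr q * (measure M (space M) + q * ((\<integral>x. energy (2 *\<^sub>R \<sigma> x) \<partial>M) + 2 * b))"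
  have B: "(\<integral>x. norm (D (u k) x) powr q \<partial>M) \<le> B" for k
  proof -
    have "2 powr q * (measure M (space M) + q * ((\<integral>x. energy (2 *\<^sub>R \<sigma> x) \<partial>M) - 2 * J (u k))) \<le> B"
      unfolding B_def using b[of k] q by (intro mult_left_mono add_left_mono) auto
    with P2_bounds(2)[OF u, of k] show ?thesis by linarith
  qed
  then show "\<exists>B. \<forall>k. (\<integral>x. norm (D (u k) x) powr q \<partial>M) \<le> B" by blast
  \<comment> \<open>the first variation vanishes in the limit, uniformly for test functions with bounded gradient\<close>
  have c: "\<exists>N. \<forall>k\<ge>N. \<forall>v\<in>W1 q \<Omega>. (\<integral>x. norm (D v x) powr q \<partial>M) \<le> B' \<longrightarrow> \<bar>\<integral>x. (\<sigma> x - s k x) \<bullet> D v x \<partial>M\<bar> \<le> \<epsilon>"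
    if e: "\<epsilon> > 0" for \<epsilon> B'
  proof -
    have "\<exists>\<delta>>0. \<forall>u\<in>W1 q \<Omega>. \<forall>v\<in>W1 q \<Omega>. S - \<delta> \<le> J u \<longrightarrow> (\<integral>x. norm (D v x) powr q \<partial>M) \<le> B'
     \<longrightarrow> \<bar>\<integral>x. (\<sigma> x - flux (D u x)) \<bullet> D v x \<partial>M\<bar> \<le> \<epsilon>"
      by (rule almost_maximal_almost_critical[OF _ e]) (rule S)
    then obtain \<delta> where d: "\<delta> > 0" "\<forall>u\<in>W1 q \<Omega>. \<forall>v\<in>W1 q \<Omega>. S - \<delta> \<le> J u \<longrightarrow> (\<integral>x. norm (D v x) powr q \<partial>M) \<le> B'
     \<longrightarrow> \<bar>\<integral>x. (\<sigma> x - flux (D u x)) \<bullet> D v x \<partial>M\<bar> \<le> \<epsilon>" by blast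
    from near[OF d(1)] obtain N where "\<forall>k\<ge>N. S - \<delta> \<le> J (u k)" by blast
    then show ?thesis unfolding s_def using d(2) u by blast
  qed
  have diff: "in_Lp M p (\<lambda>x. \<sigma> x - s k x)" "in_Lp M p (\<lambda>x. s k x - s l x)" for k l
    using in_Lp_diff[OF p1(1)] \<sigma>_Lp s by blast+
  have Cauchy: "\<exists>N. \<forall>i\<ge>N. \<forall>j\<ge>N. (\<integral>x. norm (s i x - s j x) powr p \<partial>M) < e" if e: "e > 0" for e
  proof -
    have "conv_const * e / 4 > 0" using e conv_const_pos by simp
    from c[OF this, of B] obtain N where N: "\<And>k v. k \<ge> N \<Longrightarrow> v \<in> W1 q \<Omega> \<Longrightarrow> (\<integral>x. norm (D v x) powr q \<partial>M) \<le> B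
        \<Longrightarrow> \<bar>\<integral>x. (\<sigma> x - s k x) \<bullet> D v x \<partial>M\<bar> \<le> conv_const * e / 4" by blast
    have "(\<integral>x. norm (s i x - s j x) powr p \<partial>M) < e" if ij: "i \<ge> N" "j \<ge> N" for i j
    proof -
      have i1: "integrable M (\<lambda>x. (\<sigma> x - s k x) \<bullet> D (u l) x)" for k l by (rule Holder_pq(1)[OF diff(1) uD(3)])
      have "2 * conv_const * (\<integral>x. norm (s i x - s j x) powr p \<partial>M) = (\<integral>x. 2 * conv_const * norm (s i x - s j x) powr p \<partial>M)" by simp
      also have "\<dots> \<le> (\<integral>x. ((\<sigma> x - s j x) \<bullet> D (u i) x - (\<sigma> x - s i x) \<bullet> D (u i) x) - ((\<sigma> x - s j x) \<bullet> D (u j) x - (\<sigma> x - s i x) \<bullet> D (u j) x) \<partial>M)"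
      proof (rule integral_mono)
        fix x
        show "2 * conv_const * norm (s i x - s j x) powr p \<le> ((\<sigma> x - s j x) \<bullet> D (u i) x - (\<sigma> x - s i x) \<bullet> D (u i) x) - ((\<sigma> x - s j x) \<bullet> D (u j) x - (\<sigma> x - s i x) \<bullet> D (u j) x)"
          using flux_monotone[of "D (u i) x" "D (u j) x"] by (simp add: s_def inner_diff_left inner_diff_right)
      qed (use i1 in_Lp_integrable[OF diff(2)] in auto)
      also have "\<dots> = ((\<integral>x. (\<sigma> x - s j x) \<bullet> D (u i) x \<partial>M) - (\<integral>x. (\<sigma> x - s i x) \<bullet> D (u i) x \<partial>M))
          - ((\<integral>x. (\<sigma> x - s j x) \<bullet> D (u j) x \<partial>M) - (\<integral>x. (\<sigma> x - s i x) \<bullet> D (u j) x \<partial>M))"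
        using i1 by simp
      also have "\<dots> \<le> 4 * (conv_const * e / 4)"
        using N[OF ij(1) u B, of i] N[OF ij(1) u B, of j] N[OF ij(2) u B, of i] N[OF ij(2) u B, of j] by linarith
      finally have "2 * (\<integral>x. norm (s i x - s j x) powr p \<partial>M) \<le> e" using conv_const_pos by simp
      then show ?thesis using e by linarith
    qed
    then show ?thesis by blast
  qed
  obtain t where t: "in_Lp M p t" "(\<lambda>n. \<integral>x. norm (s n x - t x) powr p \<partial>M) \<longlonglongrightarrow> 0"
    using Lp_complete[OF finite_M p1(2) s Cauchy] by blast
  have dt: "in_Lp M p (\<lambda>x. s k x - t x)" "in_Lp M p (\<lambda>x. t x - s k x)" for k using in_Lp_diff[OF p1(1)] s t(1) by blast+
  have n0: "(\<lambda>n. norm_Lp M p (\<lambda>x. s n x - t x)) \<longlonglongrightarrow> 0"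
    using p1 t(2) by (intro norm_Lp_tendsto_0) auto
  have flip: "norm_Lp M p (\<lambda>x. t x - s n x) = norm_Lp M p (\<lambda>x. s n x - t x)" for n
    by (simp add: norm_Lp_def norm_minus_commute)
  have t_adm: "(\<integral>x. t x \<bullet> D \<phi> x \<partial>M) = (\<integral>x. f x * \<phi> x \<partial>M)" if \<phi>: "\<phi> \<in> W1 q \<Omega>" for \<phi>
  proof -
    note \<phi>D = W1_weak_gradient[OF \<phi>]
    have "(\<lambda>k. \<integral>x. (s k x - t x) \<bullet> D \<phi> x \<partial>M) \<longlonglongrightarrow> 0"
    proof (rule tendsto_rabs_zero_cancel, rule tendsto_sandwich[OF _ _ tendsto_const])
      show "\<forall>\<^sub>F n in sequentially. 0 \<le> \<bar>\<integral>x. (s n x - t x) \<bullet> D \<phi> x \<partial>M\<bar>" by simp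
      show "\<forall>\<^sub>F n in sequentially. \<bar>\<integral>x. (s n x - t x) \<bullet> D \<phi> x \<partial>M\<bar> \<le> norm_Lp M p (\<lambda>x. s n x - t x) * norm_Lp M q (D \<phi>)"
        using Holder_pq(4)[OF dt(1) \<phi>D(3)] by (intro always_eventually) auto
      show "(\<lambda>n. norm_Lp M p (\<lambda>x. s n x - t x) * norm_Lp M q (D \<phi>)) \<longlonglongrightarrow> 0" using tendsto_mult_left_zero[OF n0] .
    qed
    moreover have "(\<lambda>k. \<integral>x. (\<sigma> x - s k x) \<bullet> D \<phi> x \<partial>M) \<longlonglongrightarrow> 0"
    proof (rule LIMSEQ_I)
      fix r :: real assume "r > 0"
      then have "r / 2 > 0" by simp
      from c[OF this, of "\<integral>x. norm (D \<phi> x) powr q \<partial>M"] obtain N where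
        "\<And>k. k \<ge> N \<Longrightarrow> \<bar>\<integral>x. (\<sigma> x - s k x) \<bullet> D \<phi> x \<partial>M\<bar> \<le> r / 2" using \<phi> by blast
      then show "\<exists>N. \<forall>k\<ge>N. norm ((\<integral>x. (\<sigma> x - s k x) \<bullet> D \<phi> x \<partial>M) - 0) < r" using \<open>r > 0\<close> by fastforce
    qed
    ultimately have "(\<lambda>k. (\<integral>x. (s k x - t x) \<bullet> D \<phi> x \<partial>M) + (\<integral>x. (\<sigma> x - s k x) \<bullet> D \<phi> x \<partial>M)) \<longlonglongrightarrow> 0"
      using tendsto_add_zero by blast
    moreover have "(\<integral>x. (s k x - t x) \<bullet> D \<phi> x \<partial>M) + (\<integral>x. (\<sigma> x - s k x) \<bullet> D \<phi> x \<partial>M)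
        = (\<integral>x. \<sigma> x \<bullet> D \<phi> x \<partial>M) - (\<integral>x. t x \<bullet> D \<phi> x \<partial>M)" for k
      using Holder_pq(1)[OF s \<phi>D(3), of k] Holder_pq(1)[OF t(1) \<phi>D(3)] Holder_pq(1)[OF \<sigma>_Lp \<phi>D(3)]
      by (simp add: inner_diff_left)
    ultimately show ?thesis using \<sigma>_eq[OF \<phi>] by (simp add: LIMSEQ_const_iff)
  qed
  have min: "(\<integral>x. energy (\<sigma> x) \<partial>M) \<le> (\<integral>x. energy (t x) \<partial>M)" by (rule \<sigma>_min[OF t(1) t_adm])
  \<comment> \<open>the gradient of \<open>|s|^p / p\<close> at the limit; it lies in the dual space \<open>L^q\<close>\<close>
  define z where "z x = norm (t x) powr (p - 2) *\<^sub>R t x" for x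
  have z: "in_Lp M q z"
  proof -
    have [measurable]: "t \<in> borel_measurable M" using t(1) by auto
    have "norm (z x) powr q = norm (t x) powr p" for x
    proof -
      have "norm (z x) = norm (t x) * norm (t x) powr (p - 1 - 1)" by (simp add: z_def mult.commute)
      also have "\<dots> = norm (t x) powr (p - 1)" by (rule powr_mult_self) simp
      finally show ?thesis using q_p1 by (simp add: powr_powr mult.commute)
    qed
    then show ?thesis using in_Lp_integrable[OF t(1)] unfolding in_Lp_def by (simp add: z_def[abs_def])
  qed
  define m where "m = measure M (space M) powr (1 - 1/p)"
  have bound: "conv_const * (\<integral>x. norm (\<sigma> x - s k x) powr p \<partial>M)
      \<le> (norm_Lp M p (\<lambda>x. s k x - t x) * norm_Lp M q z + m * norm_Lp M p (\<lambda>x. s k x - t x)) + \<bar>\<integral>x. (\<sigma> x - s k x) \<bullet> D (u k) x \<partial>M\<bar>" for k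
  proof -
    note i = integrable_energy[OF finite_M \<sigma>_Lp] integrable_energy[OF finite_M s[of k]] integrable_energy[OF finite_M t(1)]
      Holder_pq(1)[OF diff(1) uD(3), of k k] in_Lp_integrable[OF diff(1), of k] Holder_pq(1)[OF dt(2) z, of k]
      in_Lp_imp_integrable[OF finite_M p1(1) dt(2), of k]
    have "(\<integral>x. conv_const * norm (\<sigma> x - s k x) powr p \<partial>M) \<le> (\<integral>x. energy (\<sigma> x) - energy (s k x) - (\<sigma> x - s k x) \<bullet> D (u k) x \<partial>M)"
    proof (rule integral_mono)
      show "conv_const * norm (\<sigma> x - s k x) powr p \<le> energy (\<sigma> x) - energy (s k x) - (\<sigma> x - s k x) \<bullet> D (u k) x" for x
        using energy_uniformly_convex[of "D (u k) x" "\<sigma> x"] by (simp add: s_def inner_commute)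
    qed (use i in auto)
    also have "\<dots> = (\<integral>x. energy (\<sigma> x) \<partial>M) - (\<integral>x. energy (s k x) \<partial>M) - (\<integral>x. (\<sigma> x - s k x) \<bullet> D (u k) x \<partial>M)" using i by simp
    also have "\<dots> \<le> ((\<integral>x. energy (t x) \<partial>M) - (\<integral>x. energy (s k x) \<partial>M)) + \<bar>\<integral>x. (\<sigma> x - s k x) \<bullet> D (u k) x \<partial>M\<bar>" using min by linarith
    also have "(\<integral>x. energy (t x) \<partial>M) - (\<integral>x. energy (s k x) \<partial>M) = (\<integral>x. energy (t x) - energy (s k x) \<partial>M)" using i by simp
    also have "\<dots> \<le> (\<integral>x. (t x - s k x) \<bullet> z x + norm (t x - s k x) \<partial>M)"
    proof (rule integral_mono)
      show "energy (t x) - energy (s k x) \<le> (t x - s k x) \<bullet> z x + norm (t x - s k x)" for x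
        using energy_diff_le[of "t x" "s k x"] by (simp add: z_def inner_commute)
    qed (use i in auto)
    also have "\<dots> = (\<integral>x. (t x - s k x) \<bullet> z x \<partial>M) + (\<integral>x. norm (t x - s k x) \<partial>M)" using i by simp
    also have "\<dots> \<le> norm_Lp M p (\<lambda>x. s k x - t x) * norm_Lp M q z + m * norm_Lp M p (\<lambda>x. s k x - t x)"
      using Holder_pq(4)[OF dt(2) z, of k] L1_le_Lp[OF finite_M p1(2) dt(2), of k] unfolding flip m_def by linarith
    finally show ?thesis by simp
  qed
  have small: "(\<lambda>k. \<bar>\<integral>x. (\<sigma> x - s k x) \<bullet> D (u k) x \<partial>M\<bar>) \<longlonglongrightarrow> 0"
  proof (rule LIMSEQ_I)
    fix r :: real assume "r > 0"
    then have "r / 2 > 0" by simp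
    from c[OF this, of B] obtain N where
      "\<And>k. k \<ge> N \<Longrightarrow> \<bar>\<integral>x. (\<sigma> x - s k x) \<bullet> D (u k) x \<partial>M\<bar> \<le> r / 2" using u B by blast
    then show "\<exists>N. \<forall>k\<ge>N. norm (\<bar>\<integral>x. (\<sigma> x - s k x) \<bullet> D (u k) x \<partial>M\<bar> - 0) < r" using \<open>r > 0\<close> by fastforce
  qed
  have lim0: "(\<lambda>k. (norm_Lp M p (\<lambda>x. s k x - t x) * norm_Lp M q z + m * norm_Lp M p (\<lambda>x. s k x - t x)) + \<bar>\<integral>x. (\<sigma> x - s k x) \<bullet> D (u k) x \<partial>M\<bar>) \<longlonglongrightarrow> 0"
    by (intro tendsto_add_zero tendsto_mult_left_zero tendsto_mult_right_zero n0 small)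
  have "(\<lambda>k. conv_const * (\<integral>x. norm (\<sigma> x - s k x) powr p \<partial>M)) \<longlonglongrightarrow> 0"
  proof (rule tendsto_sandwich[OF _ _ tendsto_const lim0])
    show "\<forall>\<^sub>F k in sequentially. 0 \<le> conv_const * (\<integral>x. norm (\<sigma> x - s k x) powr p \<partial>M)"
      using conv_const_pos by (intro always_eventually) simp
  qed (use bound in \<open>simp add: always_eventually\<close>)
  from tendsto_mult_right_zero[OF this, of "1 / conv_const"]
  show "(\<lambda>k. \<integral>x. norm (\<sigma> x - flux (D (u k) x)) powr p \<partial>M) \<longlonglongrightarrow> 0" using conv_const_pos by (simp add: s_def)
qed

lemma maximising_sequence:
  obtains u where "\<And>k. u k \<in> W1 q \<Omega>" "(\<lambda>k. \<integral>x. norm (\<sigma> x - flux (D (u k) x)) powr p \<partial>M) \<longlonglongrightarrow> 0"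
    "\<exists>B. \<forall>k. (\<integral>x. norm (D (u k) x) powr q \<partial>M) \<le> B"
proof -
  define S where "S = (SUP w\<in>W1 q \<Omega>. J w)"
  have bdd: "bdd_above (J ` W1 q \<Omega>)" by (rule bdd_aboveI2[OF P2_bounds(1)])
  have S: "J w \<le> S" if "w \<in> W1 q \<Omega>" for w unfolding S_def by (rule cSUP_upper[OF that bdd])
  have "\<exists>w\<in>W1 q \<Omega>. S - inverse (real (Suc k)) < J w" for k
    using less_cSUP_iff[OF _ bdd, of "S - inverse (real (Suc k))"] zero_W1 by (auto simp: S_def)
  then obtain u where u: "\<And>k. u k \<in> W1 q \<Omega>" "\<And>k. S - inverse (real (Suc k)) < J (u k)" by metis
  have "(\<lambda>k. J (u k)) \<longlonglongrightarrow> S"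
  proof (rule tendsto_sandwich)
    show "(\<lambda>k. S - inverse (real (Suc k))) \<longlonglongrightarrow> S"
      using tendsto_diff[OF tendsto_const LIMSEQ_inverse_real_of_nat, of S] by simp
    show "(\<lambda>k. S) \<longlonglongrightarrow> S" by simp
  qed (use u S in \<open>auto intro: always_eventually less_imp_le\<close>)
  from flux_convergence[OF u(1) S this] u(1) show ?thesis using that by blast
qed

text \<open>The constant sequence is maximising, and the distance of its fluxes to \<open>\<sigma>\<close>, which tends to
  zero, does not depend on the index.\<close>

lemma P2_solution_flux:
  assumes "P2_solution q \<Omega> f u"
  shows "u \<in> W1 q \<Omega>" "AE x in M. \<sigma> x = flux (D u x)"
proof -
  show u: "u \<in> W1 q \<Omega>" using assms by (simp add: P2_solution_def is_arg_max_def)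
  have "J w \<le> J u" if "w \<in> W1 q \<Omega>" for w
    using assms that by (auto simp: P2_solution_def is_arg_max_def not_less)
  from flux_convergence(1)[of "\<lambda>_. u", OF u this tendsto_const]
  have 0: "(\<integral>x. norm (\<sigma> x - flux (D u x)) powr p \<partial>M) = 0" by (simp add: LIMSEQ_const_iff)
  have "in_Lp M p (\<lambda>x. \<sigma> x - flux (D u x))"
    by (rule in_Lp_diff[OF _ \<sigma>_Lp in_Lp_flux[OF W1_weak_gradient(3)[OF u]]]) (use p_gt_2 in simp)
  from in_Lp_integrable[OF this] 0 have "AE x in M. norm (\<sigma> x - flux (D u x)) powr p = 0"
    by (subst integral_nonneg_eq_0_iff_AE[symmetric]) auto
  then show "AE x in M. \<sigma> x = flux (D u x)" by eventually_elim auto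
qed

end

section \<open>The energy estimate for differences\<close>

lemma integral_norm_diff_powr_le:
  fixes f g :: "'a \<Rightarrow> 'b::{real_normed_vector, second_countable_topology}"
  assumes "r \<ge> 1" "in_Lp M r f" "in_Lp M r g"
  shows "(\<integral>x. norm (f x - g x) powr r \<partial>M) \<le> 2 powr (r - 1) * ((\<integral>x. norm (f x) powr r \<partial>M) + (\<integral>x. norm (g x) powr r \<partial>M))"
proof -
  have "(\<integral>x. norm (f x - g x) powr r \<partial>M) \<le> (\<integral>x. 2 powr (r - 1) * (norm (f x) powr r + norm (g x) powr r) \<partial>M)"
  proof (rule integral_mono)
    show "norm (f x - g x) powr r \<le> 2 powr (r - 1) * (norm (f x) powr r + norm (g x) powr r)" for x
      using norm_add_powr_le[OF assms(1), of "f x" "- g x"] by simp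
  qed (use in_Lp_diff[OF assms] assms in \<open>auto simp: in_Lp_def\<close>)
  also have "\<dots> = 2 powr (r - 1) * ((\<integral>x. norm (f x) powr r \<partial>M) + (\<integral>x. norm (g x) powr r \<partial>M))"
    using assms by (simp add: in_Lp_def)
  finally show ?thesis .
qed

lemma grad_square: "smooth \<eta> \<Longrightarrow> grad (\<lambda>x. \<eta> x * \<eta> x) x = (2 * \<eta> x) *\<^sub>R grad \<eta> x"
  by (simp add: grad_def vec_eq_iff partial_deriv_mult)

lemma grad_translate: "smooth \<zeta> \<Longrightarrow> grad (\<lambda>x. \<zeta> (x - h)) x = grad \<zeta> (x - h)"
  using partial_deriv_translate[of \<zeta> x "-h"] smooth_imp_differentiable[of \<zeta>] by (simp add: grad_def vec_eq_iff)

context exponents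
begin

text \<open>\<open>mono_const\<close> is the monotonicity constant that remains when the field \<open>F(\<nabla>u)\<close> is replaced
  by a field close to it; half of it is spent on absorbing the term with \<open>\<nabla>\<eta>\<close>, and \<open>young_const\<close> is
  the constant that Young's inequality then leaves.\<close>

definition mono_const :: real where "mono_const = 2 * conv_const * 2 powr (1 - p)"
definition young_const :: real where "young_const = (mono_const / 2 * p) powr (- q / p) / q"

lemma mono_const_pos: "mono_const > 0" using conv_const_pos by (simp add: mono_const_def)
lemma young_const_pos: "young_const > 0" using mono_const_pos p_gt_2 q by (simp add: young_const_def)

text \<open>Monotonicity of the flux for vectors \<open>a\<close>, \<open>b\<close> that only approximate \<open>flux g\<close> and \<open>flux k\<close>: the errors
  \<open>a - flux g\<close> and \<open>b - flux k\<close> appear in the last two terms.\<close>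

lemma perturbed_monotone:
  fixes a b g k :: "'a::real_inner"
  shows "mono_const * norm (a - b) powr p \<le> (a - b) \<bullet> (g - k)
    + norm ((a - flux g) - (b - flux k)) * norm (g - k) + 2 * conv_const * norm ((a - flux g) - (b - flux k)) powr p"
proof -
  let ?e = "(a - flux g) - (b - flux k)" and ?s = "flux g - flux k"
  have ab: "a - b = ?s + ?e" by simp
  have "norm (a - b) powr p \<le> 2 powr (p - 1) * (norm ?s powr p + norm ?e powr p)"
    unfolding ab using p_gt_2 by (intro norm_add_powr_le) simp
  then have "mono_const * norm (a - b) powr p \<le> mono_const * (2 powr (p - 1) * (norm ?s powr p + norm ?e powr p))"
    using mono_const_pos by (intro mult_left_mono) auto
  also have "\<dots> = 2 * conv_const * norm ?s powr p + 2 * conv_const * norm ?e powr p"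
    by (simp add: mono_const_def powr_diff powr_minus field_simps)
  finally have "mono_const * norm (a - b) powr p \<le> 2 * conv_const * norm ?s powr p + 2 * conv_const * norm ?e powr p" .
  moreover have "2 * conv_const * norm ?s powr p \<le> ?s \<bullet> (g - k)" by (rule flux_monotone)
  moreover have "?s \<bullet> (g - k) = (a - b) \<bullet> (g - k) - ?e \<bullet> (g - k)" by (simp add: inner_diff_left)
  moreover have "- (?e \<bullet> (g - k)) \<le> norm ?e * norm (g - k)" using Cauchy_Schwarz_ineq2[of ?e "g - k"] by linarith
  ultimately show ?thesis by linarith
qed

lemma flux_0 [simp]: "flux 0 = 0" by (simp add: flux_def)

end

context variational
begin

abbreviation "\<sigma>' \<equiv> zero_ext \<Omega> \<sigma>"
abbreviation "f' \<equiv> zero_ext \<Omega> f"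

lemma zero_ext_Lp:
  "in_Lp lebesgue p \<sigma>'" "in_Lp lebesgue p f'"
  "u \<in> W1 q \<Omega> \<Longrightarrow> in_Lp lebesgue q (zero_ext \<Omega> u)" "u \<in> W1 q \<Omega> \<Longrightarrow> in_Lp lebesgue q (zero_ext \<Omega> (D u))"
proof -
  have pq: "p > 0" "q > 0" using p_gt_2 q by auto
  show "in_Lp lebesgue p \<sigma>'" using \<sigma>_Lp by (simp add: in_Lp_zero_ext(1)[OF \<Omega>_sets pq(1)])
  show "in_Lp lebesgue p f'" using f_Lp by (simp add: in_Lp_zero_ext(1)[OF \<Omega>_sets pq(1)] Lp_iff)
  show "u \<in> W1 q \<Omega> \<Longrightarrow> in_Lp lebesgue q (zero_ext \<Omega> u)" "u \<in> W1 q \<Omega> \<Longrightarrow> in_Lp lebesgue q (zero_ext \<Omega> (D u))"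
    using W1_weak_gradient by (auto simp: in_Lp_zero_ext(1)[OF \<Omega>_sets pq(2)])
qed

lemma in_Lp_translate_diff:
  fixes g :: "real^'n \<Rightarrow> 'b::euclidean_space"
  assumes "r \<ge> 1" "in_Lp lebesgue r g" shows "in_Lp lebesgue r (\<lambda>x. g (x + h) - g x)"
  by (rule in_Lp_diff[OF assms(1) in_Lp_translate[OF assms(2)] assms(2)])

text \<open>The function \<open>\<zeta> \<Delta>u\<close>, extended by zero, is an admissible test function for the divergence
  constraint.\<close>

lemma cutoff_test:
  fixes \<zeta> :: "real^'n \<Rightarrow> real"
  assumes u: "u \<in> W1 q \<Omega>"
    and \<zeta>: "smooth \<zeta>" "compact K" "\<And>x. x \<notin> K \<Longrightarrow> \<zeta> x = 0" "K \<subseteq> \<Omega>" "\<And>x. x \<in> K \<Longrightarrow> x + h \<in> \<Omega>"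
  defines "v \<equiv> \<lambda>x. \<zeta> x * (zero_ext \<Omega> u (x + h) - zero_ext \<Omega> u x)"
    and "V \<equiv> \<lambda>x. \<zeta> x *\<^sub>R (zero_ext \<Omega> (D u) (x + h) - zero_ext \<Omega> (D u) x) + (zero_ext \<Omega> u (x + h) - zero_ext \<Omega> u x) *\<^sub>R grad \<zeta> x"
  shows "in_Lp lebesgue q v" "in_Lp lebesgue q V" "(\<integral>x. \<sigma>' x \<bullet> V x \<partial>lebesgue) = (\<integral>x. f' x * v x \<partial>lebesgue)"
proof -
  have q1: "q \<ge> 1" "q > 0" using q by auto
  have cont: "continuous_on UNIV \<zeta>" "continuous_on UNIV (grad \<zeta>)"
    using smooth_imp_continuous[OF \<zeta>(1)] continuous_grad[OF \<zeta>(1)] .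
  have go: "grad \<zeta> x = 0" if "x \<notin> K" for x by (rule grad_outside[OF compact_imp_closed[OF \<zeta>(2)] \<zeta>(3) that])
  have [measurable]: "\<zeta> \<in> borel_measurable lebesgue" "grad \<zeta> \<in> borel_measurable lebesgue"
    using cont by (auto intro!: measurable_completion simp: borel_measurable_continuous_onI)
  obtain B where B: "B > 0" "\<And>x. norm (\<zeta> x) \<le> B"
    using compact_support_bounded[OF cont(1) \<zeta>(2,3)] by blast
  obtain B' where B': "B' > 0" "\<And>x. norm (grad \<zeta> x) \<le> B'"
    using compact_support_bounded[OF cont(2) \<zeta>(2) go] by blast
  note w = in_Lp_translate_diff[OF q1(1) zero_ext_Lp(3)[OF u], of h] and W = in_Lp_translate_diff[OF q1(1) zero_ext_Lp(4)[OF u], of h]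
  note [measurable] = in_Lp_measurable[OF w] in_Lp_measurable[OF W]
  show v: "in_Lp lebesgue q v"
    unfolding v_def by (rule in_Lp_bound[OF q1(2) w, where C = B]) (use B in \<open>auto simp: abs_mult intro!: mult_right_mono\<close>)
  have V1: "in_Lp lebesgue q (\<lambda>x. \<zeta> x *\<^sub>R (zero_ext \<Omega> (D u) (x + h) - zero_ext \<Omega> (D u) x))"
    by (rule in_Lp_bound[OF q1(2) W, where C = B]) (use B in \<open>auto intro!: mult_right_mono\<close>)
  have V2: "in_Lp lebesgue q (\<lambda>x. (zero_ext \<Omega> u (x + h) - zero_ext \<Omega> u x) *\<^sub>R grad \<zeta> x)"
    by (rule in_Lp_bound[OF q1(2) w, where C = B']) (use B' in \<open>auto simp: mult.commute[of B'] intro!: mult_left_mono\<close>)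
  show V: "in_Lp lebesgue q V" unfolding V_def by (rule in_Lp_add[OF q1(1) V1 V2])
  have v_eq: "v = (\<lambda>x. \<zeta> x * (u (x + h) - u x))"
  proof
    fix x show "v x = \<zeta> x * (u (x + h) - u x)"
      using \<zeta>(3)[of x] subsetD[OF \<zeta>(4), of x] \<zeta>(5)[of x] by (cases "x \<in> K") (auto simp: v_def)
  qed
  have V_eq: "V = (\<lambda>x. \<zeta> x *\<^sub>R (D u (x + h) - D u x) + (u (x + h) - u x) *\<^sub>R grad \<zeta> x)"
  proof
    fix x show "V x = \<zeta> x *\<^sub>R (D u (x + h) - D u x) + (u (x + h) - u x) *\<^sub>R grad \<zeta> x"
      using \<zeta>(3)[of x] go[of x] subsetD[OF \<zeta>(4), of x] \<zeta>(5)[of x] by (cases "x \<in> K") (auto simp: V_def)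
  qed
  have wg: "has_weak_gradient \<Omega> v V" unfolding v_eq V_eq
    by (rule has_weak_gradient_cutoff_difference[OF open_\<Omega> W1_weak_gradient(2)[OF u] \<zeta>])
  have vM: "in_Lp M q v" and VM: "in_Lp M q V"
    using in_Lp_subset(1)[OF \<Omega>_sets _ _ q1(2), of UNIV v] in_Lp_subset(1)[OF \<Omega>_sets _ _ q1(2), of UNIV V] v V
    by (auto simp: lebesgue_on_UNIV_eq)
  note vW = W1_intro[OF vM wg VM]
  have "(\<integral>x. \<sigma>' x \<bullet> V x \<partial>lebesgue) = (\<integral>x. \<sigma> x \<bullet> V x \<partial>M)"
  proof -
    have "(\<integral>x. \<sigma> x \<bullet> V x \<partial>M) = (\<integral>x. \<sigma>' x \<bullet> V x \<partial>M)"
      by (intro Bochner_Integration.integral_cong) (auto simp: space_restrict_space)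
    then show ?thesis using integral_lebesgue_on_support(1)[OF \<Omega>_sets, of "\<lambda>x. \<sigma>' x \<bullet> V x"]
      by (simp add: zero_ext_def)
  qed
  also have "\<dots> = (\<integral>x. \<sigma> x \<bullet> D v x \<partial>M)"
  proof (rule integral_cong_AE)
    show "(\<lambda>x. \<sigma> x \<bullet> V x) \<in> borel_measurable M" "(\<lambda>x. \<sigma> x \<bullet> D v x) \<in> borel_measurable M"
      using Holder_pq(1)[OF \<sigma>_Lp VM] Holder_pq(1)[OF \<sigma>_Lp W1_weak_gradient(3)[OF vW(1)]] by auto
    show "AE x in M. \<sigma> x \<bullet> V x = \<sigma> x \<bullet> D v x" using vW(2) by eventually_elim simp
  qed
  also have "\<dots> = (\<integral>x. f x * v x \<partial>M)" by (rule \<sigma>_eq[OF vW(1)])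
  also have "\<dots> = (\<integral>x. f' x * v x \<partial>lebesgue)"
  proof -
    have "(\<integral>x. f x * v x \<partial>M) = (\<integral>x. f' x * v x \<partial>M)"
      by (intro Bochner_Integration.integral_cong) (auto simp: space_restrict_space)
    then show ?thesis using integral_lebesgue_on_support(1)[OF \<Omega>_sets, of "\<lambda>x. f' x * v x"]
      by (simp add: zero_ext_def)
  qed
  finally show "(\<integral>x. \<sigma>' x \<bullet> V x \<partial>lebesgue) = (\<integral>x. f' x * v x \<partial>lebesgue)" .
qed

text \<open>The shifted constraint comes from \<open>cutoff_test\<close> with \<open>\<zeta>(\<cdot> - h)\<close> and \<open>-h\<close> in place of
  \<open>\<zeta>\<close> and \<open>h\<close>, followed by a translation of the integrals; the test function changes sign.\<close>

lemma difference_equation: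
  fixes \<zeta> :: "real^'n \<Rightarrow> real"
  assumes u: "u \<in> W1 q \<Omega>"
    and \<zeta>: "smooth \<zeta>" "compact K" "\<And>x. x \<notin> K \<Longrightarrow> \<zeta> x = 0" "K \<subseteq> \<Omega>" "\<And>x. x \<in> K \<Longrightarrow> x + h \<in> \<Omega>"
  defines "v \<equiv> \<lambda>x. \<zeta> x * (zero_ext \<Omega> u (x + h) - zero_ext \<Omega> u x)"
    and "V \<equiv> \<lambda>x. \<zeta> x *\<^sub>R (zero_ext \<Omega> (D u) (x + h) - zero_ext \<Omega> (D u) x) + (zero_ext \<Omega> u (x + h) - zero_ext \<Omega> u x) *\<^sub>R grad \<zeta> x"
  shows "(\<integral>x. (\<sigma>' (x + h) - \<sigma>' x) \<bullet> V x \<partial>lebesgue) = (\<integral>x. (f' (x + h) - f' x) * v x \<partial>lebesgue)"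
proof -
  have v: "in_Lp lebesgue q v" unfolding v_def by (rule cutoff_test(1)[OF u \<zeta>])
  have V: "in_Lp lebesgue q V" unfolding V_def by (rule cutoff_test(2)[OF u \<zeta>])
  have e1: "(\<integral>x. \<sigma>' x \<bullet> V x \<partial>lebesgue) = (\<integral>x. f' x * v x \<partial>lebesgue)"
    unfolding v_def V_def by (rule cutoff_test(3)[OF u \<zeta>])
  let ?\<zeta> = "\<lambda>x. \<zeta> (x - h)" and ?K = "(\<lambda>x. x + h) ` K"
  have s: "smooth ?\<zeta>" using smooth_translate[OF \<zeta>(1), of "-h"] by simp
  have K: "compact ?K" using \<zeta>(2) by (auto intro!: compact_continuous_image continuous_intros)
  have z: "?\<zeta> x = 0" if "x \<notin> ?K" for x using that \<zeta>(3)[of "x - h"] by (force simp: image_iff)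
  have K2: "?K \<subseteq> \<Omega>" "\<And>x. x \<in> ?K \<Longrightarrow> x + - h \<in> \<Omega>" using \<zeta>(4,5) by auto
  have e2: "(\<integral>x. \<sigma>' x \<bullet> V (x - h) \<partial>lebesgue) = (\<integral>x. f' x * v (x - h) \<partial>lebesgue)"
  proof -
    have a: "(\<lambda>x. ?\<zeta> x *\<^sub>R (zero_ext \<Omega> (D u) (x + - h) - zero_ext \<Omega> (D u) x) + (zero_ext \<Omega> u (x + - h) - zero_ext \<Omega> u x) *\<^sub>R grad ?\<zeta> x)
      = (\<lambda>x. - V (x - h))" by (auto simp: V_def grad_translate[OF \<zeta>(1)] algebra_simps)
    have b: "(\<lambda>x. ?\<zeta> x * (zero_ext \<Omega> u (x + - h) - zero_ext \<Omega> u x)) = (\<lambda>x. - v (x - h))"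
      by (auto simp: v_def algebra_simps)
    have "(\<integral>x. \<sigma>' x \<bullet> (- V (x - h)) \<partial>lebesgue) = (\<integral>x. f' x * (- v (x - h)) \<partial>lebesgue)"
      using cutoff_test(3)[OF u s K z K2] unfolding fun_cong[OF a] fun_cong[OF b] .
    then show ?thesis by simp
  qed
  note Vh = in_Lp_translate[OF V, of "-h"] and vh = in_Lp_translate[OF v, of "-h"]
  have "integrable lebesgue (\<lambda>x. \<sigma>' x \<bullet> V (x - h))" "integrable lebesgue (\<lambda>x. f' x * v (x - h))"
    using Holder_pq(1)[OF zero_ext_Lp(1) Vh] Holder_pq(1)[OF zero_ext_Lp(2) vh] by simp_all
  from this[THEN borel_measurable_integrable, THEN lebesgue_translate(2), of h]
  have e3: "(\<integral>x. \<sigma>' (x + h) \<bullet> V x \<partial>lebesgue) = (\<integral>x. f' (x + h) * v x \<partial>lebesgue)" using e2 by simp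
  note sh = in_Lp_translate[OF zero_ext_Lp(1), of h] and fh = in_Lp_translate[OF zero_ext_Lp(2), of h]
  show ?thesis
    using e1 e3 Holder_pq(1)[OF zero_ext_Lp(1) V] Holder_pq(1)[OF zero_ext_Lp(2) v]
      Holder_pq(1)[OF sh V] Holder_pq(1)[OF fh v] by (simp add: inner_diff_left left_diff_distrib)
qed

definition defect :: "(real^'n \<Rightarrow> real) \<Rightarrow> real" where
  "defect u = (\<integral>x. norm (\<sigma> x - flux (D u x)) powr p \<partial>M)"

text \<open>An upper bound for the error terms of \<open>perturbed_monotone\<close> after integration. It vanishes with
  the defect as long as \<open>\<nabla>u\<close> stays bounded in \<open>L^q\<close>.\<close>

definition defect_term :: "(real^'n \<Rightarrow> real) \<Rightarrow> real" where
  "defect_term u = (2 powr p * defect u) powr (1/p) * (2 powr q * (\<integral>x. norm (D u x) powr q \<partial>M)) powr (1/q) + 2 * conv_const * (2 powr p * defect u)"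

text \<open>The difference equation is tested with \<open>\<zeta> = \<eta>\<^sup>2\<close>. The factor \<open>\<eta>\<close> in
  \<open>\<nabla>\<zeta> = 2\<eta> \<nabla>\<eta>\<close> is what allows the mixed term to be absorbed.\<close>

lemma energy_estimate:
  assumes u: "u \<in> W1 q \<Omega>"
    and \<eta>: "smooth \<eta>" "compact K" "\<And>x. x \<notin> K \<Longrightarrow> \<eta> x = 0" "K \<subseteq> \<Omega>" "\<And>x. \<bar>\<eta> x\<bar> \<le> 1" "\<And>x. norm (grad \<eta> x) \<le> L"
    and E: "E \<in> sets lebesgue" "E \<subseteq> \<Omega>" "\<And>x t. x \<in> K \<Longrightarrow> 0 \<le> t \<Longrightarrow> t \<le> 1 \<Longrightarrow> x + t *\<^sub>R h \<in> E"
  shows "mono_const / 2 * (\<integral>x. (\<eta> x)\<^sup>2 * norm (\<sigma>' (x + h) - \<sigma>' x) powr p \<partial>lebesgue)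
    \<le> norm_Lp lebesgue p (\<lambda>x. \<eta> x * (f' (x + h) - f' x)) * (norm h * norm_Lp (lebesgue_on E) q (D u))
     + young_const * (2 * L) powr q * norm h powr q * (\<integral>x. norm (D u x) powr q \<partial>lebesgue_on E) + defect_term u"
proof -
  have pq: "p \<ge> 1" "q \<ge> 1" "p > 0" "q > 0" "q > 1" using p_gt_2 q by auto
  have L: "L \<ge> 0" using \<eta>(6)[of 0] norm_ge_zero order_trans by blast
  have Kh: "x + h \<in> \<Omega>" if "x \<in> K" for x using E(3)[OF that, of 1] E(2) by auto
  define \<zeta> where "\<zeta> x = \<eta> x * \<eta> x" for x
  have \<zeta>: "smooth \<zeta>" "\<And>x. x \<notin> K \<Longrightarrow> \<zeta> x = 0" unfolding \<zeta>_def using \<eta>(1,3) by (auto intro: smooth_mult)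
  have g\<zeta>: "grad \<zeta> x = (2 * \<eta> x) *\<^sub>R grad \<eta> x" for x unfolding \<zeta>_def by (rule grad_square[OF \<eta>(1)])
  define w where "w x = zero_ext \<Omega> u (x + h) - zero_ext \<Omega> u x" for x
  define G where "G = zero_ext \<Omega> (D u)"
  define dG where "dG x = G (x + h) - G x" for x
  define ds where "ds x = \<sigma>' (x + h) - \<sigma>' x" for x
  define df where "df x = f' (x + h) - f' x" for x
  define e where "e x = \<sigma>' x - flux (G x)" for x
  define de where "de x = e (x + h) - e x" for x
  define V where "V x = \<zeta> x *\<^sub>R dG x + w x *\<^sub>R grad \<zeta> x" for x
  have G: "in_Lp lebesgue q G" unfolding G_def by (rule zero_ext_Lp(4)[OF u])
  have e: "in_Lp lebesgue p e" unfolding e_def by (rule in_Lp_diff[OF pq(1) zero_ext_Lp(1) in_Lp_flux[OF G]])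
  have w: "in_Lp lebesgue q w" unfolding w_def by (rule in_Lp_translate_diff[OF pq(2) zero_ext_Lp(3)[OF u]])
  have dG: "in_Lp lebesgue q dG" unfolding dG_def by (rule in_Lp_translate_diff[OF pq(2) G])
  have ds: "in_Lp lebesgue p ds" unfolding ds_def by (rule in_Lp_translate_diff[OF pq(1) zero_ext_Lp(1)])
  have df: "in_Lp lebesgue p df" unfolding df_def by (rule in_Lp_translate_diff[OF pq(1) zero_ext_Lp(2)])
  have de: "in_Lp lebesgue p de" unfolding de_def by (rule in_Lp_translate_diff[OF pq(1) e])
  note [measurable] = in_Lp_measurable[OF w] in_Lp_measurable[OF ds] in_Lp_measurable[OF df]
  have [measurable]: "\<eta> \<in> borel_measurable lebesgue"
    by (rule smooth_borel_measurable[OF \<eta>(1)])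
  have eq: "(\<integral>x. ds x \<bullet> V x \<partial>lebesgue) = (\<integral>x. df x * (\<zeta> x * w x) \<partial>lebesgue)"
    unfolding ds_def V_def df_def w_def dG_def G_def by (rule difference_equation[OF u \<zeta>(1) \<eta>(2) \<zeta>(2) \<eta>(4) Kh])
  have V: "in_Lp lebesgue q V"
    unfolding V_def w_def dG_def G_def by (rule cutoff_test(2)[OF u \<zeta>(1) \<eta>(2) \<zeta>(2) \<eta>(4) Kh])
  define U where "U = {x. \<eta> x \<noteq> 0}"
  have U: "open U" unfolding U_def
    using smooth_imp_continuous[OF \<eta>(1), of UNIV] by (intro open_Collect_neq) (auto intro: continuous_intros)
  have Um[measurable]: "U \<in> sets lebesgue" using U by auto
  have UK: "U \<subseteq> K" using \<eta>(3) by (auto simp: U_def)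
  define wU where "wU x = indicator U x * norm (w x) powr q" for x
  have wU_int: "integrable lebesgue wU"
    by (rule Bochner_Integration.integrable_bound[OF in_Lp_integrable[OF w]]) (auto simp: wU_def[abs_def] indicator_def)
  have dsint: "integrable lebesgue (\<lambda>x. (\<eta> x)\<^sup>2 * norm (ds x) powr p)"
  proof (rule Bochner_Integration.integrable_bound[OF in_Lp_integrable[OF ds]])
    have "(\<eta> x)\<^sup>2 \<le> 1" for x using \<eta>(5)[of x] by (simp add: abs_square_le_1)
    then show "AE x in lebesgue. norm ((\<eta> x)\<^sup>2 * norm (ds x) powr p) \<le> norm (norm (ds x) powr p)"
      by (auto intro!: mult_left_le_one_le)
  qed measurable
  \<comment> \<open>where \<open>\<eta>\<close> vanishes both sides are trivial; elsewhere the mixed term is split by Young, and \<open>|\<eta>| \<le> |\<eta>|^(2/p)\<close> provides the weight \<open>\<eta>\<^sup>2\<close> after taking the \<open>p\<close>-th power\<close>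
  have pointwise: "mono_const / 2 * ((\<eta> x)\<^sup>2 * norm (ds x) powr p)
      \<le> ds x \<bullet> V x + young_const * (2 * L) powr q * wU x + (norm (de x) * norm (dG x) + 2 * conv_const * norm (de x) powr p)" for x
  proof -
    have de0: "0 \<le> norm (de x) * norm (dG x) + 2 * conv_const * norm (de x) powr p" using conv_const_pos by simp
    show ?thesis
    proof (cases "\<eta> x = 0")
      case True
      then have "V x = 0" by (simp add: V_def \<zeta>_def g\<zeta>)
      then show ?thesis using True de0 young_const_pos by (simp add: wU_def)
    next
      case False
      let ?h = "\<bar>\<eta> x\<bar>"
      have h1: "?h > 0" "?h \<le> 1" using False \<eta>(5) by auto
      have m: "mono_const * norm (ds x) powr p \<le> ds x \<bullet> dG x + (norm (de x) * norm (dG x) + 2 * conv_const * norm (de x) powr p)"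
        using perturbed_monotone[of "\<sigma>' (x + h)" "\<sigma>' x" "G (x + h)" "G x"] by (simp add: ds_def dG_def de_def e_def)
      have sq: "(\<eta> x)\<^sup>2 \<le> 1" using \<eta>(5)[of x] by (simp add: abs_square_le_1)
      have "(\<eta> x)\<^sup>2 * (mono_const * norm (ds x) powr p) \<le> (\<eta> x)\<^sup>2 * (ds x \<bullet> dG x) + (\<eta> x)\<^sup>2 * (norm (de x) * norm (dG x) + 2 * conv_const * norm (de x) powr p)"
        using mult_left_mono[OF m, of "(\<eta> x)\<^sup>2"] by (simp add: distrib_left)
      also have "\<dots> \<le> (\<eta> x)\<^sup>2 * (ds x \<bullet> dG x) + (norm (de x) * norm (dG x) + 2 * conv_const * norm (de x) powr p)"
        using mult_right_mono[OF sq de0] by simp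
      finally have 1: "mono_const * ((\<eta> x)\<^sup>2 * norm (ds x) powr p) \<le> (\<eta> x)\<^sup>2 * (ds x \<bullet> dG x) + (norm (de x) * norm (dG x) + 2 * conv_const * norm (de x) powr p)"
        by (simp add: mult.left_commute)
      have 2: "ds x \<bullet> V x = (\<eta> x)\<^sup>2 * (ds x \<bullet> dG x) + ds x \<bullet> (w x *\<^sub>R grad \<zeta> x)"
        by (simp add: V_def \<zeta>_def inner_add_right power2_eq_square)
      have "?h powr 1 \<le> ?h powr (2 / p)" using h1 p_gt_2 by (intro powr_mono') auto
      then have hp: "?h \<le> ?h powr (2 / p)" using h1 by simp
      have hpp: "(?h powr (2 / p)) powr p = (\<eta> x)\<^sup>2" using h1 pq by (simp add: powr_powr)
      have "\<bar>ds x \<bullet> (w x *\<^sub>R grad \<zeta> x)\<bar> \<le> norm (ds x) * norm (w x *\<^sub>R grad \<zeta> x)" by (rule Cauchy_Schwarz_ineq2)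
      also have "\<dots> = (2 * norm (grad \<eta> x) * norm (w x)) * (?h * norm (ds x))" by (simp add: g\<zeta> abs_mult)
      also have "\<dots> \<le> (2 * L * norm (w x)) * (?h powr (2 / p) * norm (ds x))"
        using \<eta>(6)[of x] hp L by (intro mult_mono) auto
      also have "\<dots> \<le> (mono_const / 2 * p) powr (- q / p) * (2 * L * norm (w x)) powr q / q + mono_const / 2 * (?h powr (2 / p) * norm (ds x)) powr p"
        using mono_const_pos L by (intro young_scaled) auto
      also have "\<dots> = young_const * (2 * L) powr q * wU x + mono_const / 2 * ((\<eta> x)\<^sup>2 * norm (ds x) powr p)"
        using False L by (simp add: young_const_def wU_def U_def powr_mult hpp)
      finally have "- (ds x \<bullet> (w x *\<^sub>R grad \<zeta> x)) \<le> young_const * (2 * L) powr q * wU x + mono_const / 2 * ((\<eta> x)\<^sup>2 * norm (ds x) powr p)" by linarith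
      with 1 2 show ?thesis by simp
    qed
  qed
  note H1 = Holder_pq[OF de dG]
  have "mono_const / 2 * (\<integral>x. (\<eta> x)\<^sup>2 * norm (ds x) powr p \<partial>lebesgue) = (\<integral>x. mono_const / 2 * ((\<eta> x)\<^sup>2 * norm (ds x) powr p) \<partial>lebesgue)" by simp
  also have "\<dots> \<le> (\<integral>x. ds x \<bullet> V x + young_const * (2 * L) powr q * wU x + (norm (de x) * norm (dG x) + 2 * conv_const * norm (de x) powr p) \<partial>lebesgue)"
    using pointwise Holder_pq(1)[OF ds V] wU_int H1(2) in_Lp_integrable[OF de] dsint
    by (intro integral_mono) auto
  also have "\<dots> = (\<integral>x. ds x \<bullet> V x \<partial>lebesgue) + young_const * (2 * L) powr q * (\<integral>x. wU x \<partial>lebesgue)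
      + ((\<integral>x. norm (de x) * norm (dG x) \<partial>lebesgue) + 2 * conv_const * (\<integral>x. norm (de x) powr p \<partial>lebesgue))"
    using Holder_pq(1)[OF ds V] wU_int H1(2) in_Lp_integrable[OF de] by simp
  finally have main: "mono_const / 2 * (\<integral>x. (\<eta> x)\<^sup>2 * norm (ds x) powr p \<partial>lebesgue) \<le> \<dots>" .
  have Epq: "in_Lp (lebesgue_on E) q (D u)"
    by (rule in_Lp_subset(1)[OF E(1) \<Omega>_sets E(2) pq(4) W1_weak_gradient(3)[OF u]])
  have wU: "(\<integral>x. wU x \<partial>lebesgue) \<le> norm h powr q * (\<integral>x. norm (D u x) powr q \<partial>lebesgue_on E)"
  proof -
    have "(\<integral>x. wU x \<partial>lebesgue) = (\<integral>x. wU x \<partial>lebesgue_on U)"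
      by (rule integral_lebesgue_on_support(1)[OF Um, symmetric]) (simp add: wU_def)
    also have "\<dots> = (\<integral>x. \<bar>u (x + h) - u x\<bar> powr q \<partial>lebesgue_on U)"
    proof (rule Bochner_Integration.integral_cong)
      fix x assume "x \<in> space (lebesgue_on U)"
      then have "x \<in> U" by (simp add: space_restrict_space)
      moreover from this have "x \<in> \<Omega>" "x + h \<in> \<Omega>" using UK \<eta>(4) Kh by auto
      ultimately show "wU x = \<bar>u (x + h) - u x\<bar> powr q" by (simp add: wU_def w_def)
    qed simp
    also have "\<dots> \<le> norm h powr q * (\<integral>x. norm (D u x) powr q \<partial>lebesgue_on E)"
      by (rule difference_quotient_bound(2)[OF open_\<Omega> W1_weak_gradient(2)[OF u] E(2,1) bounded_subset[OF bounded_\<Omega> E(2)] pq(5) Epq U])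
         (rule E(3), use UK in auto)
    finally show ?thesis .
  qed
  have rhs: "(\<integral>x. ds x \<bullet> V x \<partial>lebesgue) \<le> norm_Lp lebesgue p (\<lambda>x. \<eta> x * df x) * (norm h * norm_Lp (lebesgue_on E) q (D u))"
  proof -
    have 1: "in_Lp lebesgue p (\<lambda>x. \<eta> x * df x)"
      by (rule in_Lp_bound[OF pq(3) df, where C = 1]) (use \<eta>(5) in \<open>auto simp: abs_mult mult_left_le_one_le\<close>)
    have 2: "in_Lp lebesgue q (\<lambda>x. \<eta> x * w x)"
      by (rule in_Lp_bound[OF pq(4) w, where C = 1]) (use \<eta>(5) in \<open>auto simp: abs_mult mult_left_le_one_le\<close>)
    have "(\<integral>x. ds x \<bullet> V x \<partial>lebesgue) = (\<integral>x. (\<eta> x * df x) \<bullet> (\<eta> x * w x) \<partial>lebesgue)"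
      unfolding eq by (intro Bochner_Integration.integral_cong) (auto simp: \<zeta>_def)
    also have "\<dots> \<le> norm_Lp lebesgue p (\<lambda>x. \<eta> x * df x) * norm_Lp lebesgue q (\<lambda>x. \<eta> x * w x)"
      using Holder_pq(4)[OF 1 2] by linarith
    also have "norm_Lp lebesgue q (\<lambda>x. \<eta> x * w x) \<le> norm h * norm_Lp (lebesgue_on E) q (D u)"
    proof -
      have "(\<integral>x. norm (\<eta> x * w x) powr q \<partial>lebesgue) \<le> (\<integral>x. wU x \<partial>lebesgue)"
      proof (rule integral_mono[OF in_Lp_integrable[OF 2] wU_int])
        fix x show "norm (\<eta> x * w x) powr q \<le> wU x"
          using \<eta>(5)[of x] pq by (auto simp: wU_def U_def indicator_def abs_mult intro!: powr_mono2 mult_left_le_one_le)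
      qed
      also note wU
      finally have "norm_Lp lebesgue q (\<lambda>x. \<eta> x * w x) \<le> (norm h powr q * (\<integral>x. norm (D u x) powr q \<partial>lebesgue_on E)) powr (1 / q)"
        unfolding norm_Lp_def using pq by (intro powr_mono2) auto
      also have "\<dots> = norm h * norm_Lp (lebesgue_on E) q (D u)"
        using pq by (simp add: powr_mult norm_Lp_def powr_powr)
      finally show ?thesis .
    qed
    finally show ?thesis by (simp add: mult_left_mono)
  qed
  have e_int: "(\<integral>x. norm (e x) powr p \<partial>lebesgue) = defect u"
  proof -
    have "e = zero_ext \<Omega> (\<lambda>x. \<sigma> x - flux (D u x))" by (auto simp: e_def G_def zero_ext_def)
    then show ?thesis using in_Lp_zero_ext(2)[OF \<Omega>_sets pq(3), of "\<lambda>x. \<sigma> x - flux (D u x)"] by (simp add: defect_def)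
  qed
  have G_int: "(\<integral>x. norm (G x) powr q \<partial>lebesgue) = (\<integral>x. norm (D u x) powr q \<partial>M)"
    unfolding G_def by (rule in_Lp_zero_ext(2)[OF \<Omega>_sets pq(4)])
  have tr: "(\<integral>x. norm (g (x + h)) powr r \<partial>lebesgue) = (\<integral>x. norm (g x) powr r \<partial>lebesgue)"
    if "in_Lp lebesgue r g" for g :: "real^'n \<Rightarrow> real^'n" and r
    by (rule lebesgue_translate(2)[OF borel_measurable_integrable[OF in_Lp_integrable[OF that]]])
  have two: "2 powr (r - 1) * (a + a) = 2 powr r * a" for r a :: real by (simp add: powr_diff)
  have de_int: "(\<integral>x. norm (de x) powr p \<partial>lebesgue) \<le> 2 powr p * defect u"
    using integral_norm_diff_powr_le[OF pq(1) in_Lp_translate[OF e, of h] e] unfolding tr[OF e] e_int two de_def .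
  have dG_int: "(\<integral>x. norm (dG x) powr q \<partial>lebesgue) \<le> 2 powr q * (\<integral>x. norm (D u x) powr q \<partial>M)"
    using integral_norm_diff_powr_le[OF pq(2) in_Lp_translate[OF G, of h] G] unfolding tr[OF G] G_int two dG_def .
  have err: "(\<integral>x. norm (de x) * norm (dG x) \<partial>lebesgue) + 2 * conv_const * (\<integral>x. norm (de x) powr p \<partial>lebesgue) \<le> defect_term u"
  proof -
    have "norm_Lp lebesgue p de \<le> (2 powr p * defect u) powr (1 / p)"
      unfolding norm_Lp_def using de_int pq by (intro powr_mono2) auto
    moreover have "norm_Lp lebesgue q dG \<le> (2 powr q * (\<integral>x. norm (D u x) powr q \<partial>M)) powr (1 / q)"
      unfolding norm_Lp_def using dG_int pq by (intro powr_mono2) auto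
    ultimately have "norm_Lp lebesgue p de * norm_Lp lebesgue q dG \<le> (2 powr p * defect u) powr (1 / p) * (2 powr q * (\<integral>x. norm (D u x) powr q \<partial>M)) powr (1 / q)"
      by (intro mult_mono) auto
    moreover have "2 * conv_const * (\<integral>x. norm (de x) powr p \<partial>lebesgue) \<le> 2 * conv_const * (2 powr p * defect u)"
      using de_int conv_const_pos by (intro mult_left_mono) auto
    ultimately show ?thesis unfolding defect_term_def using H1(3) by linarith
  qed
  have "young_const * (2 * L) powr q * (\<integral>x. wU x \<partial>lebesgue) \<le> young_const * (2 * L) powr q * (norm h powr q * (\<integral>x. norm (D u x) powr q \<partial>lebesgue_on E))"
    using wU young_const_pos by (intro mult_left_mono) auto
  with main rhs err show ?thesis unfolding ds_def df_def by (simp add: mult.assoc)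
qed

end

section \<open>Besov regularity of the minimiser\<close>

text \<open>The supremum of the quotients is a real number only if they are bounded; this form, without roots
  and suprema, is the one in which the estimates appear.\<close>

lemma in_besov_iff:
  fixes v :: "'a::euclidean_space \<Rightarrow> real"
  assumes m: "m > 0"
  shows "v \<in> besov \<beta> m \<longleftrightarrow> in_Lp lebesgue m v \<and> (\<exists>S. \<forall>h. h \<noteq> 0 \<longrightarrow> (\<integral>x. \<bar>v (x + h) - v x\<bar> powr m \<partial>lebesgue) \<le> S * norm h powr (\<beta> * m))"
    (is "_ \<longleftrightarrow> _ \<and> ?R")
proof -
  have quot: "besov_quotient \<beta> m UNIV v h = ((\<integral>x. \<bar>v (x + h) - v x\<bar> powr m \<partial>lebesgue) / norm h powr (\<beta> * m)) powr (1 / m)" for h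
    by (simp add: besov_quotient_def lebesgue_on_UNIV_eq)
  have nn: "0 \<le> (\<integral>x. \<bar>v (x + h) - v x\<bar> powr m \<partial>lebesgue)" for h by (rule Bochner_Integration.integral_nonneg) simp
  have "bdd_above (besov_quotient \<beta> m UNIV v ` (UNIV - {0})) \<longleftrightarrow> ?R"
  proof
    assume "bdd_above (besov_quotient \<beta> m UNIV v ` (UNIV - {0}))"
    then obtain S where S: "\<And>h. h \<noteq> 0 \<Longrightarrow> besov_quotient \<beta> m UNIV v h \<le> S" by (auto simp: bdd_above_def)
    have "(\<integral>x. \<bar>v (x + h) - v x\<bar> powr m \<partial>lebesgue) \<le> S powr m * norm h powr (\<beta> * m)" if "h \<noteq> 0" for h
    proof -
      have "(\<integral>x. \<bar>v (x + h) - v x\<bar> powr m \<partial>lebesgue) / norm h powr (\<beta> * m) = besov_quotient \<beta> m UNIV v h powr m"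
        using m nn[of h] by (simp add: quot powr_powr)
      also have "\<dots> \<le> S powr m" using S[OF that] m by (intro powr_mono2) (auto simp: quot)
      finally show ?thesis using that by (simp add: divide_le_eq)
    qed
    then show ?R by blast
  next
    assume ?R
    then obtain S where S: "\<And>h. h \<noteq> 0 \<Longrightarrow> (\<integral>x. \<bar>v (x + h) - v x\<bar> powr m \<partial>lebesgue) \<le> S * norm h powr (\<beta> * m)" by blast
    have "besov_quotient \<beta> m UNIV v h \<le> S powr (1 / m)" if "h \<noteq> 0" for h
      unfolding quot using S[OF that] m nn[of h] that by (intro powr_mono2) (auto simp: divide_le_eq)
    then show "bdd_above (besov_quotient \<beta> m UNIV v ` (UNIV - {0}))" by (intro bdd_aboveI2[where M = "S powr (1 / m)"]) auto
  qed
  then show ?thesis by (simp add: besov_def Lp_iff lebesgue_on_UNIV_eq)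
qed

text \<open>A segment from the centre to a point outside \<open>\<Omega>\<close> would meet the frontier at distance at most
  \<open>t\<close> from the ball.\<close>

lemma cball_subset_of_setdist:
  fixes x0 :: "'a::euclidean_space"
  assumes "open \<Omega>" "closure (ball x0 R) \<subseteq> \<Omega>" "R > 0" "0 \<le> t" "t < setdist (ball x0 R) (frontier \<Omega>)"
  shows "cball x0 (R + t) \<subseteq> \<Omega>"
proof (rule ccontr)
  assume "\<not> cball x0 (R + t) \<subseteq> \<Omega>"
  then obtain y where "y \<in> cball x0 (R + t)" and y2: "y \<notin> \<Omega>" by blast
  then have y: "dist x0 y \<le> R + t" "y \<notin> \<Omega>" by simp_all
  have cb: "cball x0 R \<subseteq> \<Omega>" using assms(2,3) by simp
  then have x0: "x0 \<in> \<Omega>" using assms(3) by auto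
  have "closed_segment x0 y \<inter> frontier \<Omega> \<noteq> {}"
  proof (rule connected_Int_frontier)
    show "closed_segment x0 y \<inter> \<Omega> \<noteq> {}" using x0 by auto
    show "closed_segment x0 y - \<Omega> \<noteq> {}" using y(2) by auto
  qed simp
  then obtain z where z: "z \<in> closed_segment x0 y" "z \<in> frontier \<Omega>" by auto
  have zO: "z \<notin> \<Omega>" using z(2) assms(1) by (simp add: frontier_def interior_open)
  then have far: "norm (z - x0) > R" using cb by (auto simp: subset_iff dist_norm norm_minus_commute not_le[symmetric])
  have "dist x0 z \<le> dist x0 y" using z(1) dist_in_closed_segment[of z x0 y] by (simp add: dist_commute)
  with y(1) have near: "norm (z - x0) \<le> R + t" by (simp add: dist_norm norm_minus_commute)
  have nz: "z \<noteq> x0"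
  proof
    assume "z = x0"
    then show False using far assms(3) by simp
  qed
  define w where "w = x0 + (R / norm (z - x0)) *\<^sub>R (z - x0)"
  have "w \<in> cball x0 R" using far assms(3) by (simp add: w_def dist_norm)
  then have w: "w \<in> closure (ball x0 R)" using assms(3) by simp
  have zw: "z - w = (1 - R / norm (z - x0)) *\<^sub>R (z - x0)" by (simp add: w_def algebra_simps)
  have "norm (z - w) = norm (z - x0) - R"
  proof -
    have "R / norm (z - x0) < 1" using far assms(3) by (simp add: divide_less_eq)
    then have "norm (z - w) = (1 - R / norm (z - x0)) * norm (z - x0)" by (simp add: zw)
    also have "\<dots> = norm (z - x0) - R" using nz by (simp add: left_diff_distrib)
    finally show ?thesis .
  qed
  moreover have "setdist (closure (ball x0 R)) (frontier \<Omega>) \<le> dist w z" by (rule setdist_le_dist[OF w z(2)])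
  ultimately have "setdist (ball x0 R) (frontier \<Omega>) \<le> t" using near by (simp add: dist_norm norm_minus_commute)
  with assms(5) show False by simp
qed

lemma ball_plus_ball:
  fixes x0 :: "'a::euclidean_space"
  assumes "R > 0" "r > 0" shows "ball x0 R + ball 0 r = ball x0 (R + r)"
proof
  show "ball x0 R + ball 0 r \<subseteq> ball x0 (R + r)"
  proof
    fix y assume "y \<in> ball x0 R + ball 0 r"
    then obtain a b where "y = a + b" "a \<in> ball x0 R" "b \<in> ball 0 r" by (auto elim: set_plus_elim)
    then show "y \<in> ball x0 (R + r)"
      using norm_triangle_ineq[of "a - x0" b] by (simp add: dist_norm norm_minus_commute algebra_simps)
  qed
  show "ball x0 (R + r) \<subseteq> ball x0 R + ball 0 r"
  proof
    fix y assume "y \<in> ball x0 (R + r)"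
    then have y: "norm (y - x0) < R + r" by (simp add: dist_norm norm_minus_commute)
    let ?a = "x0 + (R / (R + r)) *\<^sub>R (y - x0)" and ?b = "(r / (R + r)) *\<^sub>R (y - x0)"
    have "R / (R + r) + r / (R + r) = 1" using assms by (simp flip: add_divide_distrib)
    then have "?a + ?b = y" by (simp add: add.assoc flip: scaleR_left_distrib)
    moreover have "?a \<in> ball x0 R"
    proof -
      have "(R / (R + r)) * norm (y - x0) < (R / (R + r)) * (R + r)" using y assms by (intro mult_strict_left_mono) auto
      then show ?thesis using assms by (simp add: dist_norm)
    qed
    moreover have "?b \<in> ball 0 r"
    proof -
      have "(r / (R + r)) * norm (y - x0) < (r / (R + r)) * (R + r)" using y assms by (intro mult_strict_left_mono) auto
      then show ?thesis using assms by simp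
    qed
    ultimately show "y \<in> ball x0 R + ball 0 r" by (metis set_plus_intro)
  qed
qed

lemma ball_segment:
  fixes x0 :: "'a::euclidean_space"
  assumes x: "x \<in> ball x0 R" and t: "0 \<le> t" "t \<le> 1" and h: "norm h \<le> r"
  shows "x + t *\<^sub>R h \<in> ball x0 (R + r)"
proof -
  have "t * norm h \<le> 1 * norm h" using t by (intro mult_right_mono) auto
  then have "norm (t *\<^sub>R h) \<le> r" using t h by simp
  moreover have "norm (x - x0) < R" using x by (simp add: dist_norm norm_minus_commute)
  ultimately have "norm ((x - x0) + t *\<^sub>R h) < R + r" using norm_triangle_ineq[of "x - x0" "t *\<^sub>R h"] by linarith
  then show ?thesis by (simp add: dist_norm norm_minus_commute algebra_simps)
qed

lemma compact_neighbourhood: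
  fixes K :: "'a::euclidean_space set"
  assumes "compact K" "open \<Omega>" "K \<subseteq> \<Omega>"
  obtains d E where "d > 0" "compact E" "E \<subseteq> \<Omega>" "\<And>x y. x \<in> K \<Longrightarrow> norm y \<le> d \<Longrightarrow> x + y \<in> E"
proof -
  obtain d where d: "d > 0" "(\<Union>x\<in>K. cball x d) \<subseteq> \<Omega>"
    using compact_subset_open_imp_cball_epsilon_subset[OF assms] by blast
  let ?E = "{x + y | x y. x \<in> K \<and> y \<in> cball 0 d}"
  show ?thesis
  proof (rule that[OF d(1)])
    show "compact ?E" by (intro compact_sums assms(1) compact_cball)
    show "?E \<subseteq> \<Omega>"
    proof safe
      fix x y :: 'a assume "x \<in> K" "y \<in> cball 0 d"
      then have "x + y \<in> cball x d" by (simp add: dist_norm)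
      then show "x + y \<in> \<Omega>" using d(2) \<open>x \<in> K\<close> by blast
    qed
    show "x + y \<in> ?E" if "x \<in> K" "norm y \<le> d" for x y using that by auto
  qed
qed

context exponents
begin

definition shift_exponent :: real where "shift_exponent = 2 / (3 - q)"

text \<open>The inequality \<open>shift_exponent \<le> q\<close> amounts to \<open>(q - 1)(2 - q) \<ge> 0\<close>.\<close>

lemma shift_exponent: "0 < shift_exponent" "shift_exponent \<le> q" "shift_exponent / p = 2 / (p * (3 - q))"
proof -
  show "0 < shift_exponent" using q by (simp add: shift_exponent_def)
  have "0 \<le> (q - 1) * (2 - q)" using q by simp
  then have "2 \<le> q * (3 - q)" by (simp add: algebra_simps)
  then show "shift_exponent \<le> q" using q by (simp add: shift_exponent_def divide_le_eq)
  show "shift_exponent / p = 2 / (p * (3 - q))" by (simp add: shift_exponent_def mult.commute)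
qed

definition ball_const :: "real \<Rightarrow> real" where
  "ball_const L = 2 / mono_const * (1 + young_const * (2 * L) powr q) + 2 powr p"

lemma ball_const_pos: "ball_const L > 0"
  using mono_const_pos young_const_pos by (simp add: ball_const_def add_nonneg_pos)

end

context variational
begin

text \<open>The energy estimate along a maximising sequence, in the limit of vanishing defect. The bound \<open>B\<close>
  for the gradients is uniform in \<open>\<eta>\<close> and \<open>h\<close>.\<close>

lemma limit_energy_estimate:
  shows "\<exists>B\<ge>0. \<forall>\<eta> K L h. smooth \<eta> \<and> compact K \<and> (\<forall>x. x \<notin> K \<longrightarrow> \<eta> x = 0) \<and> K \<subseteq> \<Omega> \<and> (\<forall>x. \<bar>\<eta> x\<bar> \<le> 1)
    \<and> (\<forall>x. norm (grad \<eta> x) \<le> L) \<and> (\<forall>x t. x \<in> K \<longrightarrow> 0 \<le> t \<longrightarrow> t \<le> 1 \<longrightarrow> x + t *\<^sub>R h \<in> \<Omega>) \<longrightarrow>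
    mono_const / 2 * (\<integral>x. (\<eta> x)\<^sup>2 * norm (\<sigma>' (x + h) - \<sigma>' x) powr p \<partial>lebesgue)
    \<le> norm_Lp lebesgue p (\<lambda>x. \<eta> x * (f' (x + h) - f' x)) * (norm h * B powr (1 / q)) + young_const * (2 * L) powr q * norm h powr q * B"
proof -
  have pq: "p > 0" "q > 0" using p_gt_2 q by auto
  obtain u where u: "\<And>k. u k \<in> W1 q \<Omega>" "(\<lambda>k. defect (u k)) \<longlonglongrightarrow> 0"
    "\<exists>B. \<forall>k. (\<integral>x. norm (D (u k) x) powr q \<partial>M) \<le> B"
    using maximising_sequence unfolding defect_def by blast
  obtain B where B: "\<And>k. (\<integral>x. norm (D (u k) x) powr q \<partial>M) \<le> B" using u(3) by blast
  have B0: "B \<ge> 0" by (rule order_trans[OF _ B[of 0]]) simp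
  have dnn: "defect (u k) \<ge> 0" for k by (simp add: defect_def)
  show ?thesis
  proof (intro exI[of _ B] conjI allI impI B0)
    fix \<eta> :: "real^'n \<Rightarrow> real" and K L h
    assume a: "smooth \<eta> \<and> compact K \<and> (\<forall>x. x \<notin> K \<longrightarrow> \<eta> x = 0) \<and> K \<subseteq> \<Omega> \<and> (\<forall>x. \<bar>\<eta> x\<bar> \<le> 1)
      \<and> (\<forall>x. norm (grad \<eta> x) \<le> L) \<and> (\<forall>x t. x \<in> K \<longrightarrow> 0 \<le> t \<longrightarrow> t \<le> 1 \<longrightarrow> x + t *\<^sub>R h \<in> \<Omega>)"
    then have \<eta>: "smooth \<eta>" "compact K" "\<And>x. x \<notin> K \<Longrightarrow> \<eta> x = 0" "K \<subseteq> \<Omega>" "\<And>x. \<bar>\<eta> x\<bar> \<le> 1" "\<And>x. norm (grad \<eta> x) \<le> L"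
      and E: "\<And>x t. x \<in> K \<Longrightarrow> 0 \<le> t \<Longrightarrow> t \<le> 1 \<Longrightarrow> x + t *\<^sub>R h \<in> \<Omega>" by blast+
    let ?lhs = "mono_const / 2 * (\<integral>x. (\<eta> x)\<^sup>2 * norm (\<sigma>' (x + h) - \<sigma>' x) powr p \<partial>lebesgue)"
    let ?A = "norm_Lp lebesgue p (\<lambda>x. \<eta> x * (f' (x + h) - f' x))"
    let ?rhs = "?A * (norm h * B powr (1 / q)) + young_const * (2 * L) powr q * norm h powr q * B"
    let ?d = "\<lambda>k. (2 powr p * defect (u k)) powr (1/p) * (2 powr q * B) powr (1/q) + 2 * conv_const * (2 powr p * defect (u k))"
    have "?lhs \<le> ?rhs + ?d k" for k
    proof -
      have "?lhs \<le> ?A * (norm h * norm_Lp M q (D (u k))) + young_const * (2 * L) powr q * norm h powr q * (\<integral>x. norm (D (u k) x) powr q \<partial>M) + defect_term (u k)"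
        by (rule energy_estimate[OF u(1) \<eta> \<Omega>_sets subset_refl E])
      also have "\<dots> \<le> ?A * (norm h * B powr (1 / q)) + young_const * (2 * L) powr q * norm h powr q * B + ?d k"
        unfolding defect_term_def norm_Lp_def using B[of k] pq young_const_pos conv_const_pos dnn[of k]
        by (intro add_mono mult_left_mono mult_mono powr_mono2 order_refl) auto
      finally show ?thesis .
    qed
    moreover have "(\<lambda>k. ?rhs + ?d k) \<longlonglongrightarrow> ?rhs + ((2 powr p * 0) powr (1/p) * (2 powr q * B) powr (1/q) + 2 * conv_const * (2 powr p * 0))"
      using dnn pq by (intro tendsto_intros tendsto_powr' u(2)) auto
    ultimately show "?lhs \<le> ?rhs" using LIMSEQ_le_const[of _ _ ?lhs] by fastforce
  qed
qed

text \<open>Differences of \<open>\<phi> g\<close> and \<open>\<phi>\<close> times differences of \<open>g\<close> agree up to a term of order \<open>|h|\<close>,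
  because \<open>\<phi>\<close> is Lipschitz. The first passes from the energy estimate to Besov norms, the second from
  the Besov assumption on \<open>f\<close> to the right-hand side of the estimate.\<close>

lemma product_difference_bound:
  fixes \<phi> :: "real^'n \<Rightarrow> real" and g :: "real^'n \<Rightarrow> real"
  assumes r: "r \<ge> 1" and \<phi>: "\<phi> \<in> test_function \<Omega>" "\<And>x. \<bar>\<phi> x\<bar> \<le> B" "\<And>x. norm (grad \<phi> x) \<le> B" and g: "in_Lp lebesgue r g"
  shows "(\<integral>x. \<bar>\<phi> (x + h) * g (x + h) - \<phi> x * g x\<bar> powr r \<partial>lebesgue)
      \<le> 2 powr (r - 1) * ((\<integral>x. \<bar>\<phi> x * (g (x + h) - g x)\<bar> powr r \<partial>lebesgue) + B powr r * norm h powr r * (\<integral>x. \<bar>g x\<bar> powr r \<partial>lebesgue))"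
    and "(\<integral>x. \<bar>\<phi> x * (g (x + h) - g x)\<bar> powr r \<partial>lebesgue)
      \<le> 2 powr (r - 1) * ((\<integral>x. \<bar>\<phi> (x + h) * g (x + h) - \<phi> x * g x\<bar> powr r \<partial>lebesgue) + B powr r * norm h powr r * (\<integral>x. \<bar>g x\<bar> powr r \<partial>lebesgue))"
    and "in_Lp lebesgue r (\<lambda>x. \<phi> x * (g (x + h) - g x))"
    and "in_Lp lebesgue r (\<lambda>x. \<phi> x * g x)"
proof -
  have r0: "r > 0" using r by simp
  have s: "smooth \<phi>" using \<phi>(1) by (auto simp: test_function_def smooth_def)
  have B0: "B \<ge> 0" by (rule order_trans[OF _ \<phi>(2)[of 0]]) simp
  have [measurable]: "\<phi> \<in> borel_measurable lebesgue"
    by (rule smooth_borel_measurable[OF s])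
  have [measurable]: "(\<lambda>x. \<phi> (x + h)) \<in> borel_measurable lebesgue" by (rule lebesgue_translate(3)) measurable
  note gh = in_Lp_translate[OF g, of h] and dg = in_Lp_translate_diff[OF r g, of h]
  note [measurable] = in_Lp_measurable[OF g] in_Lp_measurable[OF gh] in_Lp_measurable[OF dg]
  show a: "in_Lp lebesgue r (\<lambda>x. \<phi> x * (g (x + h) - g x))"
    by (rule in_Lp_bound[OF r0 dg, where C = B]) (use \<phi>(2) in \<open>auto simp: abs_mult intro!: mult_right_mono\<close>)
  show b: "in_Lp lebesgue r (\<lambda>x. \<phi> x * g x)"
    by (rule in_Lp_bound[OF r0 g, where C = B]) (use \<phi>(2) in \<open>auto simp: abs_mult intro!: mult_right_mono\<close>)
  have lip: "\<bar>\<phi> (x + h) - \<phi> x\<bar> \<le> B * norm h" for x by (rule smooth_lipschitz[OF s \<phi>(3)])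
  have c: "in_Lp lebesgue r (\<lambda>x. (\<phi> (x + h) - \<phi> x) * g (x + h))"
    by (rule in_Lp_bound[OF r0 gh, where C = "B * norm h"]) (use lip in \<open>auto simp: abs_mult intro!: mult_right_mono\<close>)
  have c_le: "(\<integral>x. norm ((\<phi> (x + h) - \<phi> x) * g (x + h)) powr r \<partial>lebesgue) \<le> B powr r * norm h powr r * (\<integral>x. \<bar>g x\<bar> powr r \<partial>lebesgue)"
  proof -
    have "(\<integral>x. norm ((\<phi> (x + h) - \<phi> x) * g (x + h)) powr r \<partial>lebesgue) \<le> (\<integral>x. (B * norm h) powr r * norm (g (x + h)) powr r \<partial>lebesgue)"
    proof (rule integral_mono[OF in_Lp_integrable[OF c]])
      show "integrable lebesgue (\<lambda>x. (B * norm h) powr r * norm (g (x + h)) powr r)" using in_Lp_integrable[OF gh] by simp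
      show "norm ((\<phi> (x + h) - \<phi> x) * g (x + h)) powr r \<le> (B * norm h) powr r * norm (g (x + h)) powr r" for x
        unfolding powr_mult[symmetric] norm_mult using lip[of x] r0 by (intro powr_mono2 mult_right_mono) auto
    qed
    also have "\<dots> = (B * norm h) powr r * (\<integral>x. \<bar>g x\<bar> powr r \<partial>lebesgue)"
      using lebesgue_translate(2)[OF borel_measurable_integrable[OF in_Lp_integrable[OF g]], of h] by simp
    finally show ?thesis using B0 by (simp add: powr_mult)
  qed
  have id1: "\<phi> (x + h) * g (x + h) - \<phi> x * g x = \<phi> x * (g (x + h) - g x) - - ((\<phi> (x + h) - \<phi> x) * g (x + h))" for x
    by (simp add: algebra_simps)
  show "(\<integral>x. \<bar>\<phi> (x + h) * g (x + h) - \<phi> x * g x\<bar> powr r \<partial>lebesgue)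
      \<le> 2 powr (r - 1) * ((\<integral>x. \<bar>\<phi> x * (g (x + h) - g x)\<bar> powr r \<partial>lebesgue) + B powr r * norm h powr r * (\<integral>x. \<bar>g x\<bar> powr r \<partial>lebesgue))"
    unfolding id1 using integral_norm_diff_powr_le[OF r a in_Lp_minus[OF c]] c_le
    by (smt (verit) mult_left_mono norm_minus_cancel powr_ge_zero real_norm_def Bochner_Integration.integral_cong)
  have id2: "\<phi> x * (g (x + h) - g x) = (\<phi> (x + h) * g (x + h) - \<phi> x * g x) - (\<phi> (x + h) - \<phi> x) * g (x + h)" for x
    by (simp add: algebra_simps)
  show "(\<integral>x. \<bar>\<phi> x * (g (x + h) - g x)\<bar> powr r \<partial>lebesgue)
      \<le> 2 powr (r - 1) * ((\<integral>x. \<bar>\<phi> (x + h) * g (x + h) - \<phi> x * g x\<bar> powr r \<partial>lebesgue) + B powr r * norm h powr r * (\<integral>x. \<bar>g x\<bar> powr r \<partial>lebesgue))"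
    unfolding id2 using integral_norm_diff_powr_le[OF r in_Lp_translate_diff[OF r b] c, of h] c_le
    by (smt (verit) mult_left_mono powr_ge_zero real_norm_def Bochner_Integration.integral_cong)
qed

lemma W1_loc_difference:
  assumes f: "f \<in> W1_loc p \<Omega>" and \<phi>: "\<phi> \<in> test_function \<Omega>"
  obtains A d where "A \<ge> 0" "d > 0" "\<And>h. norm h \<le> d \<Longrightarrow> (\<integral>x. \<bar>\<phi> x * (f' (x + h) - f' x)\<bar> powr p \<partial>lebesgue) \<le> A * norm h powr p"
proof -
  have p1: "p > 1" "p > 0" using p_gt_2 by auto
  obtain G where G: "has_weak_gradient \<Omega> f G" "\<And>K. compact K \<Longrightarrow> K \<subseteq> \<Omega> \<Longrightarrow> G \<in> Lp p K"
    using f by (auto simp: W1_loc_def)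
  obtain K where K: "smooth \<phi>" "compact K" "\<And>x. x \<notin> K \<Longrightarrow> \<phi> x = 0" "K \<subseteq> \<Omega>" using test_functionE[OF \<phi>] by metis
  obtain B where B: "B > 0" "\<And>x. \<bar>\<phi> x\<bar> \<le> B" "\<And>x. norm (grad \<phi> x) \<le> B" using test_function_bounds[OF \<phi>] by metis
  obtain d E where d: "d > 0" "compact E" "E \<subseteq> \<Omega>" "\<And>x y. x \<in> K \<Longrightarrow> norm y \<le> d \<Longrightarrow> x + y \<in> E"
    using compact_neighbourhood[OF K(2) open_\<Omega> K(4)] by metis
  have Em: "E \<in> sets lebesgue" by (rule fmeasurableD[OF lmeasurable_compact[OF d(2)]])
  have GE: "in_Lp (lebesgue_on E) p G" using G(2)[OF d(2,3)] by (simp add: Lp_iff)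
  define U where "U = {x. \<phi> x \<noteq> 0}"
  have U: "open U" unfolding U_def
    using smooth_imp_continuous[OF K(1), of UNIV] by (intro open_Collect_neq) (auto intro: continuous_intros)
  have Um: "U \<in> sets lebesgue" using U by auto
  have UK: "U \<subseteq> K" using K(3) by (auto simp: U_def)
  let ?A = "B powr p * (\<integral>x. norm (G x) powr p \<partial>lebesgue_on E)"
  show ?thesis
  proof (rule that[of ?A d])
    fix h :: "real^'n" assume h: "norm h \<le> d"
    have seg: "x + t *\<^sub>R h \<in> E" if "x \<in> U" "0 \<le> t" "t \<le> 1" for x t
    proof -
      have "t * norm h \<le> 1 * norm h" using that by (intro mult_right_mono) auto
      then have "norm (t *\<^sub>R h) \<le> d" using that h by simp
      then show ?thesis using d(4) UK that(1) by blast
    qed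
    note dq = difference_quotient_bound[OF open_\<Omega> G(1) d(3) Em compact_imp_bounded[OF d(2)] p1(1) GE U seg]
    have "(\<integral>x. \<bar>\<phi> x * (f' (x + h) - f' x)\<bar> powr p \<partial>lebesgue) = (\<integral>x. \<bar>\<phi> x * (f' (x + h) - f' x)\<bar> powr p \<partial>lebesgue_on U)"
      by (rule integral_lebesgue_on_support(1)[OF Um, symmetric]) (simp add: U_def)
    also have "\<dots> \<le> (\<integral>x. B powr p * \<bar>f (x + h) - f x\<bar> powr p \<partial>lebesgue_on U)"
    proof (rule integral_mono)
      show "integrable (lebesgue_on U) (\<lambda>x. B powr p * \<bar>f (x + h) - f x\<bar> powr p)" using in_Lp_integrable[OF dq(1)] by simp
      have "integrable lebesgue (\<lambda>x. norm (\<phi> x * (f' (x + h) - f' x)) powr p)"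
        by (rule in_Lp_integrable[OF product_difference_bound(3)[OF _ \<phi> B(2,3) zero_ext_Lp(2)]]) (use p1 in simp)
      then show "integrable (lebesgue_on U) (\<lambda>x. \<bar>\<phi> x * (f' (x + h) - f' x)\<bar> powr p)"
        by (subst integral_lebesgue_on_support(2)[OF Um]) (auto simp: U_def)
      fix x assume "x \<in> space (lebesgue_on U)"
      then have "x \<in> U" by (simp add: space_restrict_space)
      then have "x \<in> \<Omega>" "x + h \<in> \<Omega>" using seg[of x 1] UK K(4) d(3) by auto
      then show "\<bar>\<phi> x * (f' (x + h) - f' x)\<bar> powr p \<le> B powr p * \<bar>f (x + h) - f x\<bar> powr p"
        unfolding powr_mult[symmetric] using B(2)[of x] p1 by (intro powr_mono2) (auto simp: abs_mult intro: mult_right_mono)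
    qed
    also have "\<dots> = B powr p * (\<integral>x. \<bar>f (x + h) - f x\<bar> powr p \<partial>lebesgue_on U)" by simp
    also have "\<dots> \<le> B powr p * (norm h powr p * (\<integral>x. norm (G x) powr p \<partial>lebesgue_on E))"
      by (intro mult_left_mono dq(2)) auto
    finally show "(\<integral>x. \<bar>\<phi> x * (f' (x + h) - f' x)\<bar> powr p \<partial>lebesgue) \<le> ?A * norm h powr p" by (simp add: mult.assoc mult.commute[of "norm h powr p"])
  qed (use d(1) in auto)
qed

lemma besov_loc_difference:
  assumes f: "f \<in> besov_loc \<alpha> p \<Omega>" and \<phi>: "\<phi> \<in> test_function \<Omega>" and \<alpha>: "\<alpha> \<le> 1"
  obtains A where "A \<ge> 0" "\<And>h. norm h \<le> 1 \<Longrightarrow> (\<integral>x. \<bar>\<phi> x * (f' (x + h) - f' x)\<bar> powr p \<partial>lebesgue) \<le> A * norm h powr (\<alpha> * p)"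
proof -
  have p1: "p \<ge> 1" "p > 0" using p_gt_2 by auto
  obtain B where B: "B > 0" "\<And>x. \<bar>\<phi> x\<bar> \<le> B" "\<And>x. norm (grad \<phi> x) \<le> B" using test_function_bounds[OF \<phi>] by metis
  have "(\<lambda>x. \<phi> x * f x) = (\<lambda>x. \<phi> x * f' x)" using test_function_zero[OF \<phi>] by (auto simp: zero_ext_def)
  then have "(\<lambda>x. \<phi> x * f' x) \<in> besov \<alpha> p" using f \<phi> by (auto simp: besov_loc_def)
  then obtain S where S: "\<And>h. h \<noteq> 0 \<Longrightarrow> (\<integral>x. \<bar>\<phi> (x + h) * f' (x + h) - \<phi> x * f' x\<bar> powr p \<partial>lebesgue) \<le> S * norm h powr (\<alpha> * p)"
    unfolding in_besov_iff[OF p1(2)] by blast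
  let ?A = "2 powr (p - 1) * (\<bar>S\<bar> + B powr p * (\<integral>x. \<bar>f' x\<bar> powr p \<partial>lebesgue))"
  show ?thesis
  proof (rule that[of ?A])
    fix h :: "real^'n" assume h: "norm h \<le> 1"
    show "(\<integral>x. \<bar>\<phi> x * (f' (x + h) - f' x)\<bar> powr p \<partial>lebesgue) \<le> ?A * norm h powr (\<alpha> * p)"
    proof (cases "h = 0")
      case False
      have hp: "norm h powr p \<le> norm h powr (\<alpha> * p)" using h \<alpha> p1 by (intro powr_mono') auto
      have "(\<integral>x. \<bar>\<phi> x * (f' (x + h) - f' x)\<bar> powr p \<partial>lebesgue)
        \<le> 2 powr (p - 1) * ((\<integral>x. \<bar>\<phi> (x + h) * f' (x + h) - \<phi> x * f' x\<bar> powr p \<partial>lebesgue) + B powr p * norm h powr p * (\<integral>x. \<bar>f' x\<bar> powr p \<partial>lebesgue))"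
        by (rule product_difference_bound(2)[OF p1(1) \<phi> B(2,3) zero_ext_Lp(2)])
      also have "\<dots> \<le> 2 powr (p - 1) * (\<bar>S\<bar> * norm h powr (\<alpha> * p) + B powr p * norm h powr (\<alpha> * p) * (\<integral>x. \<bar>f' x\<bar> powr p \<partial>lebesgue))"
      proof (intro mult_left_mono add_mono mult_right_mono hp)
        show "(\<integral>x. \<bar>\<phi> (x + h) * f' (x + h) - \<phi> x * f' x\<bar> powr p \<partial>lebesgue) \<le> \<bar>S\<bar> * norm h powr (\<alpha> * p)"
          by (rule order_trans[OF S[OF False]]) (auto intro: mult_right_mono)
      qed auto
      also have "\<dots> = ?A * norm h powr (\<alpha> * p)" by (simp add: algebra_simps)
      finally show ?thesis .
    qed (use p1 in simp)
  qed simp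
qed

text \<open>The test function itself, scaled to be bounded by \<open>1\<close>, serves as the cutoff in the energy
  estimate. Since \<open>p > 2\<close>, \<open>|\<eta>|^p \<le> \<eta>\<^sup>2\<close>. Large shifts are
  controlled by the norm of \<open>\<phi> \<sigma>\<close>.\<close>

lemma flux_besov:
  assumes \<phi>: "\<phi> \<in> test_function \<Omega>" and th: "0 < \<theta>" "\<theta> \<le> q" "\<theta> \<le> a + 1" and A: "A \<ge> 0" and d: "d > 0"
    and fd: "\<And>h. norm h \<le> d \<Longrightarrow> (\<integral>x. \<bar>\<phi> x * (f' (x + h) - f' x)\<bar> powr p \<partial>lebesgue) \<le> A * norm h powr (a * p)"
  shows "(\<lambda>x. \<phi> x * \<sigma> x $ i) \<in> besov (\<theta> / p) p"
proof -
  have p1: "p \<ge> 1" "p > 0" "q > 0" using p_gt_2 q by auto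
  have thp: "\<theta> \<le> p" using th q p_gt_2 by linarith
  obtain K where K: "smooth \<phi>" "compact K" "\<And>x. x \<notin> K \<Longrightarrow> \<phi> x = 0" "K \<subseteq> \<Omega>" using test_functionE[OF \<phi>] by metis
  obtain B0 where B0: "B0 > 0" "\<And>x. \<bar>\<phi> x\<bar> \<le> B0" "\<And>x. norm (grad \<phi> x) \<le> B0" using test_function_bounds[OF \<phi>] by metis
  define B where "B = B0 + 1"
  have B: "B \<ge> 1" "\<And>x. \<bar>\<phi> x\<bar> \<le> B" "\<And>x. norm (grad \<phi> x) \<le> B"
  proof -
    show "B \<ge> 1" using B0(1) by (simp add: B_def)
    show "\<bar>\<phi> x\<bar> \<le> B" "norm (grad \<phi> x) \<le> B" for x using B0(2,3)[of x] by (simp_all add: B_def)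
  qed
  obtain d1 E where d1: "d1 > 0" "compact E" "E \<subseteq> \<Omega>" "\<And>x y. x \<in> K \<Longrightarrow> norm y \<le> d1 \<Longrightarrow> x + y \<in> E"
    using compact_neighbourhood[OF K(2) open_\<Omega> K(4)] by metis
  obtain M0 where M0: "M0 \<ge> 0" "\<forall>\<eta> K L h. smooth \<eta> \<and> compact K \<and> (\<forall>x. x \<notin> K \<longrightarrow> \<eta> x = 0) \<and> K \<subseteq> \<Omega> \<and> (\<forall>x. \<bar>\<eta> x\<bar> \<le> 1)
    \<and> (\<forall>x. norm (grad \<eta> x) \<le> L) \<and> (\<forall>x t. x \<in> K \<longrightarrow> 0 \<le> t \<longrightarrow> t \<le> 1 \<longrightarrow> x + t *\<^sub>R h \<in> \<Omega>) \<longrightarrow>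
    mono_const / 2 * (\<integral>x. (\<eta> x)\<^sup>2 * norm (\<sigma>' (x + h) - \<sigma>' x) powr p \<partial>lebesgue)
    \<le> norm_Lp lebesgue p (\<lambda>x. \<eta> x * (f' (x + h) - f' x)) * (norm h * M0 powr (1 / q)) + young_const * (2 * L) powr q * norm h powr q * M0"
    using limit_energy_estimate by blast
  define \<eta> where "\<eta> x = (1 / B) * \<phi> x" for x
  have s\<eta>: "smooth \<eta>" unfolding \<eta>_def[abs_def] by (rule smooth_cmult[OF K(1)])
  have g\<eta>: "grad \<eta> x = (1 / B) *\<^sub>R grad \<phi> x" for x
  proof -
    have "partial_deriv i (\<lambda>x. 1 / B) x = 0" for i and x :: "real^'n" by (rule partial_deriv_eq[OF has_derivative_const])
    then show ?thesis
      unfolding grad_def vec_eq_iff \<eta>_def[abs_def] by (simp add: partial_deriv_mult[OF smooth_const K(1), of _ "1/B" x, simplified])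
  qed
  have \<eta>1: "\<bar>\<eta> x\<bar> \<le> 1" "norm (grad \<eta> x) \<le> 1" for x
    using B(1) B(2,3)[of x] by (auto simp: \<eta>_def g\<eta> abs_mult divide_le_eq)
  define d2 where "d2 = min (min d d1) 1"
  have d2: "d2 > 0" "d2 \<le> d" "d2 \<le> d1" "d2 \<le> 1" using d d1(1) by (auto simp: d2_def)
  define C1 where "C1 = 2 / mono_const * (A powr (1 / p) * M0 powr (1 / q) + young_const * 2 powr q * M0)"
  have C1: "C1 \<ge> 0" using mono_const_pos young_const_pos M0(1) by (simp add: C1_def)
  have energy: "(\<integral>x. (\<eta> x)\<^sup>2 * norm (\<sigma>' (x + h) - \<sigma>' x) powr p \<partial>lebesgue) \<le> C1 * norm h powr \<theta>" if h: "norm h \<le> d2" for h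
  proof -
    have h1: "norm h \<le> d" "norm h \<le> d1" "norm h \<le> 1" using h d2 by auto
    have seg: "x + t *\<^sub>R h \<in> \<Omega>" if "x \<in> K" "0 \<le> t" "t \<le> 1" for x t
    proof -
      have "t * norm h \<le> 1 * norm h" using that by (intro mult_right_mono) auto
      then have "norm (t *\<^sub>R h) \<le> d1" using that h1 by simp
      then show ?thesis using d1(3,4) that(1) by blast
    qed
    have \<eta>0: "\<eta> x = 0" if "x \<notin> K" for x using K(3)[OF that] by (simp add: \<eta>_def)
    have "norm_Lp lebesgue p (\<lambda>x. \<eta> x * (f' (x + h) - f' x)) \<le> (A * norm h powr (a * p)) powr (1 / p)"
    proof -
      have "(\<integral>x. norm (\<eta> x * (f' (x + h) - f' x)) powr p \<partial>lebesgue) = (1 / B) powr p * (\<integral>x. \<bar>\<phi> x * (f' (x + h) - f' x)\<bar> powr p \<partial>lebesgue)"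
        using B(1) by (simp add: \<eta>_def abs_mult powr_mult powr_divide mult.assoc)
      also have "\<dots> \<le> 1 * (\<integral>x. \<bar>\<phi> x * (f' (x + h) - f' x)\<bar> powr p \<partial>lebesgue)"
      proof (rule mult_right_mono)
        have "(1 / B) powr p \<le> 1 powr p" using B(1) p1 by (intro powr_mono2) auto
        then show "(1 / B) powr p \<le> 1" by simp
      qed simp
      also have "\<dots> \<le> A * norm h powr (a * p)" using fd[OF h1(1)] by simp
      finally show ?thesis unfolding norm_Lp_def using p1 by (intro powr_mono2) auto
    qed
    also have "\<dots> = A powr (1 / p) * norm h powr a" using p1 A by (simp add: powr_mult powr_powr)
    finally have nf: "norm_Lp lebesgue p (\<lambda>x. \<eta> x * (f' (x + h) - f' x)) \<le> A powr (1 / p) * norm h powr a" .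
    have ha: "norm h powr a * norm h \<le> norm h powr \<theta>"
    proof -
      have "norm h powr a * norm h = norm h powr (a + 1)"
        using powr_mult_self[of "norm h" "a + 1"] by (simp add: mult.commute)
      also have "\<dots> \<le> norm h powr \<theta>" using h1 th by (intro powr_mono') auto
      finally show ?thesis .
    qed
    have hq: "norm h powr q \<le> norm h powr \<theta>" using h1 th by (intro powr_mono') auto
    have "mono_const / 2 * (\<integral>x. (\<eta> x)\<^sup>2 * norm (\<sigma>' (x + h) - \<sigma>' x) powr p \<partial>lebesgue)
      \<le> norm_Lp lebesgue p (\<lambda>x. \<eta> x * (f' (x + h) - f' x)) * (norm h * M0 powr (1 / q)) + young_const * (2 * 1) powr q * norm h powr q * M0"
      by (rule M0(2)[THEN spec[of _ \<eta>], THEN spec[of _ K], THEN spec, THEN spec, THEN mp]) (intro conjI allI impI s\<eta> K(2) \<eta>0 K(4) \<eta>1 seg)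
    also have "\<dots> \<le> (A powr (1 / p) * norm h powr a) * (norm h * M0 powr (1 / q)) + young_const * 2 powr q * norm h powr q * M0"
      using mult_right_mono[OF nf, of "norm h * M0 powr (1 / q)"] by simp
    also have "\<dots> = (A powr (1 / p) * M0 powr (1 / q)) * (norm h powr a * norm h) + (young_const * 2 powr q * M0) * norm h powr q" by simp
    also have "\<dots> \<le> (A powr (1 / p) * M0 powr (1 / q)) * norm h powr \<theta> + (young_const * 2 powr q * M0) * norm h powr \<theta>"
      using ha hq young_const_pos M0(1) by (intro add_mono mult_left_mono) auto
    also have "\<dots> = mono_const / 2 * (C1 * norm h powr \<theta>)" using mono_const_pos by (simp add: C1_def algebra_simps)
    finally show ?thesis using mono_const_pos by simp
  qed
  let ?g = "\<lambda>x. \<sigma>' x $ i"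
  have g: "in_Lp lebesgue p ?g"
    by (rule in_Lp_bound[OF p1(2) zero_ext_Lp(1), where C = 1])
       (use in_Lp_measurable[OF zero_ext_Lp(1)] in \<open>auto intro!: measurable_compose[OF _ borel_measurable_nth] simp: component_le_norm_cart\<close>)
  note pd = product_difference_bound[OF p1(1) \<phi> B(2,3) g]
  have "(\<lambda>x. \<phi> x * \<sigma> x $ i) = (\<lambda>x. \<phi> x * ?g x)" using test_function_zero[OF \<phi>] by (auto simp: zero_ext_def)
  moreover have "(\<lambda>x. \<phi> x * ?g x) \<in> besov (\<theta> / p) p"
  proof -
    let ?I = "\<integral>x. \<bar>?g x\<bar> powr p \<partial>lebesgue" and ?J = "\<integral>x. norm (\<phi> x * ?g x) powr p \<partial>lebesgue"
    define S1 where "S1 = 2 powr (p - 1) * (B powr p * C1 + B powr p * ?I)"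
    define S2 where "S2 = 2 powr (p - 1) * (?J + ?J) / d2 powr \<theta>"
    have Snn: "0 \<le> S1" "0 \<le> S2" using C1 by (auto simp: S1_def S2_def intro!: mult_nonneg_nonneg add_nonneg_nonneg)
    have "(\<integral>x. \<bar>\<phi> (x + h) * ?g (x + h) - \<phi> x * ?g x\<bar> powr p \<partial>lebesgue) \<le> (S1 + S2) * norm h powr \<theta>" if "h \<noteq> 0" for h
    proof (cases "norm h \<le> d2")
      case True
      have "norm h \<le> 1" using True d2 by simp
      then have hp: "norm h powr p \<le> norm h powr \<theta>" using thp by (intro powr_mono') auto
      have "(\<integral>x. \<bar>\<phi> x * (?g (x + h) - ?g x)\<bar> powr p \<partial>lebesgue) \<le> (\<integral>x. B powr p * ((\<eta> x)\<^sup>2 * norm (\<sigma>' (x + h) - \<sigma>' x) powr p) \<partial>lebesgue)"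
      proof (rule integral_mono)
        show "integrable lebesgue (\<lambda>x. \<bar>\<phi> x * (?g (x + h) - ?g x)\<bar> powr p)" using in_Lp_integrable[OF pd(3)] by simp
        have [measurable]: "\<eta> \<in> borel_measurable lebesgue"
          by (rule smooth_borel_measurable[OF s\<eta>])
        note ds = in_Lp_translate_diff[OF p1(1) zero_ext_Lp(1), of h]
        note [measurable] = in_Lp_measurable[OF ds]
        have "integrable lebesgue (\<lambda>x. (\<eta> x)\<^sup>2 * norm (\<sigma>' (x + h) - \<sigma>' x) powr p)"
        proof (rule Bochner_Integration.integrable_bound[OF in_Lp_integrable[OF ds]])
          have "(\<eta> x)\<^sup>2 \<le> 1" for x using \<eta>1(1)[of x] by (simp add: abs_square_le_1)
          then show "AE x in lebesgue. norm ((\<eta> x)\<^sup>2 * norm (\<sigma>' (x + h) - \<sigma>' x) powr p) \<le> norm (norm (\<sigma>' (x + h) - \<sigma>' x) powr p)"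
            by (auto intro!: mult_left_le_one_le)
        qed measurable
        then show "integrable lebesgue (\<lambda>x. B powr p * ((\<eta> x)\<^sup>2 * norm (\<sigma>' (x + h) - \<sigma>' x) powr p))" by simp
        fix x
        have "\<phi> x = B * \<eta> x" using B(1) by (simp add: \<eta>_def)
        then have "\<bar>\<phi> x * (?g (x + h) - ?g x)\<bar> powr p = B powr p * (\<bar>\<eta> x\<bar> powr p * \<bar>(\<sigma>' (x + h) - \<sigma>' x) $ i\<bar> powr p)"
          using B(1) by (simp add: abs_mult powr_mult mult.assoc)
        also have "\<dots> \<le> B powr p * ((\<eta> x)\<^sup>2 * norm (\<sigma>' (x + h) - \<sigma>' x) powr p)"
        proof (intro mult_left_mono mult_mono powr_mono2 component_le_norm_cart)
          have "\<bar>\<eta> x\<bar> powr p \<le> \<bar>\<eta> x\<bar> powr 2" using \<eta>1(1)[of x] p_gt_2 by (intro powr_mono') auto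
          then show "\<bar>\<eta> x\<bar> powr p \<le> (\<eta> x)\<^sup>2" by simp
        qed (use p1 in auto)
        finally show "\<bar>\<phi> x * (?g (x + h) - ?g x)\<bar> powr p \<le> B powr p * ((\<eta> x)\<^sup>2 * norm (\<sigma>' (x + h) - \<sigma>' x) powr p)" .
      qed
      also have "\<dots> \<le> B powr p * (C1 * norm h powr \<theta>)" using energy[OF True] by (simp add: mult_left_mono)
      finally have e: "(\<integral>x. \<bar>\<phi> x * (?g (x + h) - ?g x)\<bar> powr p \<partial>lebesgue) \<le> B powr p * (C1 * norm h powr \<theta>)" .
      have "(\<integral>x. \<bar>\<phi> (x + h) * ?g (x + h) - \<phi> x * ?g x\<bar> powr p \<partial>lebesgue)
        \<le> 2 powr (p - 1) * ((\<integral>x. \<bar>\<phi> x * (?g (x + h) - ?g x)\<bar> powr p \<partial>lebesgue) + B powr p * norm h powr p * ?I)" by (rule pd(1))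
      also have "\<dots> \<le> 2 powr (p - 1) * (B powr p * (C1 * norm h powr \<theta>) + B powr p * norm h powr \<theta> * ?I)"
        using e hp by (intro mult_left_mono add_mono mult_right_mono) auto
      also have "\<dots> = S1 * norm h powr \<theta>" by (simp add: S1_def algebra_simps)
      also have "\<dots> \<le> (S1 + S2) * norm h powr \<theta>" using Snn by (intro mult_right_mono) auto
      finally show ?thesis .
    next
      case False
      have "(\<integral>x. \<bar>\<phi> (x + h) * ?g (x + h) - \<phi> x * ?g x\<bar> powr p \<partial>lebesgue) \<le> 2 powr (p - 1) * (?J + ?J)"
        using integral_norm_diff_powr_le[OF p1(1) in_Lp_translate[OF pd(4), of h] pd(4)]
          lebesgue_translate(2)[OF borel_measurable_integrable[OF in_Lp_integrable[OF pd(4)]], of h] by simp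
      also have "\<dots> = S2 * d2 powr \<theta>" using d2(1) by (simp add: S2_def)
      also have "\<dots> \<le> S2 * norm h powr \<theta>" using False d2(1) th Snn by (intro mult_left_mono powr_mono2) auto
      also have "\<dots> \<le> (S1 + S2) * norm h powr \<theta>" using Snn by (intro mult_right_mono) auto
      finally show ?thesis .
    qed
    then show ?thesis unfolding in_besov_iff[OF p1(2)] using pd(4) p1 by auto
  qed
  ultimately show ?thesis by simp
qed

lemma flux_besov_of_W1_loc:
  assumes "f \<in> W1_loc p \<Omega>" shows "\<sigma> \<in> besov_loc_vec (2 / (p * (3 - q))) p \<Omega>"
proof -
  have "(\<lambda>x. \<phi> x * \<sigma> x $ i) \<in> besov (shift_exponent / p) p" if \<phi>: "\<phi> \<in> test_function \<Omega>" for \<phi> i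
  proof -
    obtain A d where Ad: "A \<ge> 0" "d > 0" "\<And>h. norm h \<le> d \<Longrightarrow> (\<integral>x. \<bar>\<phi> x * (f' (x + h) - f' x)\<bar> powr p \<partial>lebesgue) \<le> A * norm h powr (1 * p)"
      unfolding mult_1 using W1_loc_difference[OF assms \<phi>] by blast
    show ?thesis by (rule flux_besov[OF \<phi> shift_exponent(1,2) _ Ad]) (use shift_exponent(2) q in simp)
  qed
  then show ?thesis by (simp add: besov_loc_vec_def besov_loc_def shift_exponent(3))
qed

lemma flux_besov_of_besov_loc:
  assumes "f \<in> besov_loc \<alpha> p \<Omega>" "0 < \<alpha>" "\<alpha> < 1"
  shows "\<sigma> \<in> besov_loc_vec (min ((\<alpha> + 1) / p) (2 / (p * (3 - q)))) p \<Omega>"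
proof -
  have e: "min ((\<alpha> + 1) / p) (2 / (p * (3 - q))) = min (\<alpha> + 1) shift_exponent / p"
    using p_gt_2 by (simp add: shift_exponent(3)[symmetric] min_def divide_le_cancel)
  have "(\<lambda>x. \<phi> x * \<sigma> x $ i) \<in> besov (min (\<alpha> + 1) shift_exponent / p) p" if \<phi>: "\<phi> \<in> test_function \<Omega>" for \<phi> i
  proof -
    obtain A where A: "A \<ge> 0" "\<And>h. norm h \<le> 1 \<Longrightarrow> (\<integral>x. \<bar>\<phi> x * (f' (x + h) - f' x)\<bar> powr p \<partial>lebesgue) \<le> A * norm h powr (\<alpha> * p)"
      using besov_loc_difference[OF assms(1) \<phi> less_imp_le[OF assms(3)]] by blast
    show ?thesis by (rule flux_besov[OF \<phi> _ _ _ A(1) zero_less_one A(2)]) (use shift_exponent(1,2) assms(2) in auto)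
  qed
  then show ?thesis by (simp add: besov_loc_vec_def besov_loc_def e)
qed

end

section \<open>Estimates on balls\<close>

lemma in_Lp_lebesgue_subset:
  fixes g :: "'a::euclidean_space \<Rightarrow> 'b::euclidean_space"
  assumes "S \<in> sets lebesgue" "r > 0" "in_Lp lebesgue r g"
  shows "in_Lp (lebesgue_on S) r g" "(\<integral>x. norm (g x) powr r \<partial>lebesgue_on S) \<le> (\<integral>x. norm (g x) powr r \<partial>lebesgue)"
  using in_Lp_subset[OF assms(1) _ _ assms(2), of UNIV g] assms(3) by (auto simp: lebesgue_on_UNIV_eq)

lemma cutoff_exists:
  assumes "R > 0"
  shows "\<exists>L. \<exists>\<eta> :: real^'n::finite \<Rightarrow> real. smooth \<eta> \<and> (\<forall>x. \<bar>\<eta> x\<bar> \<le> 1) \<and> (\<forall>x. norm x \<le> R / 2 \<longrightarrow> \<eta> x = 1)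
    \<and> (\<forall>x. 3 * R / 4 < norm x \<longrightarrow> \<eta> x = 0) \<and> (\<forall>x. norm (grad \<eta> x) \<le> L)"
proof -
  have "0 < R / 2" "R / 2 < 3 * R / 4" using assms by auto
  then obtain \<eta> :: "real^'n \<Rightarrow> real" where \<eta>: "smooth \<eta>" "\<And>x. 0 \<le> \<eta> x" "\<And>x. \<eta> x \<le> 1" "\<And>x. norm x \<le> R / 2 \<Longrightarrow> \<eta> x = 1"
    "\<And>x. 3 * R / 4 \<le> norm x \<Longrightarrow> \<eta> x = 0" using ball_cutoff[of "R / 2" "3 * R / 4"] by metis
  have "\<eta> \<in> test_function UNIV"
    by (rule test_functionI[OF \<eta>(1) compact_cball[of 0 "3 * R / 4"]]) (use \<eta>(5) in auto)
  then obtain L where "\<And>x. norm (grad \<eta> x) \<le> L" using test_function_bounds by metis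
  then show ?thesis using \<eta> by (intro exI[of _ L] exI[of _ \<eta>]) (auto simp: abs_le_iff intro: order_trans[of _ 0])
qed

context variational
begin

text \<open>For \<open>|h| \<le> 1\<close> this is the energy estimate with defect zero; the exponent \<open>q\<close> may be lowered to
  \<open>2 / (3 - q)\<close>. For \<open>|h| > 1\<close> the difference is estimated by the two values of \<open>\<sigma>\<close> and
  \<open>|\<sigma>|^p \<le> |\<nabla>u|^q\<close>, which holds since \<open>\<sigma>\<close> is the flux of \<open>\<nabla>u\<close>.\<close>

lemma ball_estimate:
  assumes u: "P2_solution q \<Omega> f u" and R: "R > 0" and r0: "norm h \<le> r0" "r0 > 0" and sub: "ball x0 (R + r0) \<subseteq> \<Omega>"
    and \<eta>: "smooth \<eta>" "\<And>x. \<bar>\<eta> x\<bar> \<le> 1" "\<And>x. norm x \<le> R / 2 \<Longrightarrow> \<eta> x = 1" "\<And>x. 3 * R / 4 < norm x \<Longrightarrow> \<eta> x = 0"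
      "\<And>x. norm (grad \<eta> x) \<le> L"
    and A: "norm_Lp lebesgue p (\<lambda>x. \<eta> (x - x0) * (f' (x + h) - f' x)) \<le> A"
  defines "N \<equiv> norm_Lp (lebesgue_on (ball x0 (R + r0))) q (D u)"
  shows "(\<integral>x. norm (\<sigma> (x + h) - \<sigma> x) powr p \<partial>lebesgue_on (ball x0 (R / 2)))
    \<le> ball_const L * (A * N * norm h + N powr q * norm h powr shift_exponent)"
proof -
  have pq: "p \<ge> 1" "p > 0" "q > 0" using p_gt_2 q by auto
  have A0: "A \<ge> 0" using A norm_Lp_nonneg order_trans by blast
  have N0: "N \<ge> 0" by (simp add: N_def)
  let ?B' = "ball x0 (R + r0)" and ?B = "ball x0 (R / 2)"
  have Bm: "?B' \<in> sets lebesgue" "?B \<in> sets lebesgue" by auto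
  note uW = P2_solution_flux[OF u]
  have DuB: "in_Lp (lebesgue_on ?B') q (D u)" by (rule in_Lp_subset(1)[OF Bm(1) \<Omega>_sets sub pq(3) W1_weak_gradient(3)[OF uW(1)]])
  have Nq: "N powr q = (\<integral>x. norm (D u x) powr q \<partial>lebesgue_on ?B')" unfolding N_def using pq by (simp add: norm_Lp_powr)
  have inB': "x \<in> ?B'" "x + h \<in> ?B'" if "x \<in> ?B" for x
    using that R r0 norm_triangle_ineq[of "x - x0" h] by (auto simp: dist_norm norm_minus_commute algebra_simps)
  let ?lhs = "\<integral>x. norm (\<sigma> (x + h) - \<sigma> x) powr p \<partial>lebesgue_on ?B"
  show ?thesis
  proof (cases "norm h \<le> 1")
    case True
    define \<xi> where "\<xi> x = \<eta> (x - x0)" for x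
    let ?K = "cball x0 (3 * R / 4)"
    have s\<xi>: "smooth \<xi>" unfolding \<xi>_def using smooth_translate[OF \<eta>(1), of "- x0"] by simp
    have g\<xi>: "norm (grad \<xi> x) \<le> L" for x unfolding \<xi>_def using grad_translate[OF \<eta>(1), of x0 x] \<eta>(5) by simp
    have \<xi>0: "\<xi> x = 0" if "x \<notin> ?K" for x unfolding \<xi>_def using that by (intro \<eta>(4)) (simp add: dist_norm norm_minus_commute)
    have KB: "?K \<subseteq> ?B'" using R r0 by (intro subsetI) (auto simp: dist_norm)
    have seg: "x + t *\<^sub>R h \<in> ?B'" if "x \<in> ?K" "0 \<le> t" "t \<le> 1" for x t
      by (rule ball_segment[OF _ that(2,3) r0(1)]) (use that(1) R in simp)
    have d0: "defect u = 0"
    proof -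
      have "AE x in M. norm (\<sigma> x - flux (D u x)) powr p = 0" using uW(2) by eventually_elim simp
      then show ?thesis unfolding defect_def by (rule integral_eq_zero_AE)
    qed
    then have dt: "defect_term u = 0" using pq by (simp add: defect_term_def)
    let ?E = "\<integral>x. (\<xi> x)\<^sup>2 * norm (\<sigma>' (x + h) - \<sigma>' x) powr p \<partial>lebesgue"
    have "mono_const / 2 * ?E \<le> norm_Lp lebesgue p (\<lambda>x. \<xi> x * (f' (x + h) - f' x)) * (norm h * N)
       + young_const * (2 * L) powr q * norm h powr q * N powr q + defect_term u"
      unfolding Nq unfolding N_def
      by (rule energy_estimate[OF uW(1) s\<xi> compact_cball \<xi>0 _ _ g\<xi> Bm(1) sub seg]) (use KB sub \<eta>(2) in \<open>auto simp: \<xi>_def\<close>)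
    also have "\<dots> \<le> A * (norm h * N) + young_const * (2 * L) powr q * norm h powr shift_exponent * N powr q"
    proof -
      have "norm h powr q \<le> norm h powr shift_exponent" using True shift_exponent by (intro powr_mono') auto
      then have "young_const * (2 * L) powr q * norm h powr q * N powr q \<le> young_const * (2 * L) powr q * norm h powr shift_exponent * N powr q"
        using young_const_pos by (intro mult_right_mono mult_left_mono) auto
      moreover have "norm_Lp lebesgue p (\<lambda>x. \<xi> x * (f' (x + h) - f' x)) * (norm h * N) \<le> A * (norm h * N)"
        using A N0 unfolding \<xi>_def by (intro mult_right_mono) auto
      ultimately show ?thesis using dt by linarith
    qed
    finally have "?E \<le> 2 / mono_const * (A * (norm h * N) + young_const * (2 * L) powr q * norm h powr shift_exponent * N powr q)"
      using mono_const_pos by (simp add: field_simps)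
    also have "\<dots> \<le> 2 / mono_const * ((1 + young_const * (2 * L) powr q) * (A * N * norm h + N powr q * norm h powr shift_exponent))"
    proof (rule mult_left_mono)
      have "0 \<le> (young_const * (2 * L) powr q) * (A * N * norm h)" "0 \<le> N powr q * norm h powr shift_exponent"
        using young_const_pos A0 N0 by (auto intro!: mult_nonneg_nonneg)
      then show "A * (norm h * N) + young_const * (2 * L) powr q * norm h powr shift_exponent * N powr q \<le> (1 + young_const * (2 * L) powr q) * (A * N * norm h + N powr q * norm h powr shift_exponent)"
        by (simp add: algebra_simps)
    qed (use mono_const_pos in simp)
    also have "\<dots> = (2 / mono_const * (1 + young_const * (2 * L) powr q)) * (A * N * norm h + N powr q * norm h powr shift_exponent)" by simp
    also have "\<dots> \<le> ball_const L * (A * N * norm h + N powr q * norm h powr shift_exponent)"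
      unfolding ball_const_def using A0 N0 by (intro mult_right_mono) auto
    finally have E: "?E \<le> ball_const L * (A * N * norm h + N powr q * norm h powr shift_exponent)" .
    have ds: "in_Lp lebesgue p (\<lambda>x. \<sigma>' (x + h) - \<sigma>' x)" by (rule in_Lp_translate_diff[OF pq(1) zero_ext_Lp(1)])
    note [measurable] = in_Lp_measurable[OF ds]
    have [measurable]: "\<xi> \<in> borel_measurable lebesgue"
      by (rule smooth_borel_measurable[OF s\<xi>])
    have "?lhs = (\<integral>x. norm (if x \<in> ?B then norm (\<sigma>' (x + h) - \<sigma>' x) powr p else 0) \<partial>lebesgue)"
    proof -
      have "?lhs = (\<integral>x. norm (\<sigma>' (x + h) - \<sigma>' x) powr p \<partial>lebesgue_on ?B)"
      proof (rule Bochner_Integration.integral_cong)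
        fix x assume "x \<in> space (lebesgue_on ?B)"
        then have "x \<in> \<Omega>" "x + h \<in> \<Omega>" using inB'[of x] sub by (auto simp: space_restrict_space)
        then show "norm (\<sigma> (x + h) - \<sigma> x) powr p = norm (\<sigma>' (x + h) - \<sigma>' x) powr p" by simp
      qed simp
      then show ?thesis using Lebesgue_Measure.integral_restrict_UNIV[OF Bm(2), of "\<lambda>x. norm (\<sigma>' (x + h) - \<sigma>' x) powr p"]
        by (simp add: if_distrib cong: if_cong)
    qed
    also have "\<dots> \<le> ?E"
    proof (rule integral_mono)
      show "integrable lebesgue (\<lambda>x. (\<xi> x)\<^sup>2 * norm (\<sigma>' (x + h) - \<sigma>' x) powr p)"
      proof (rule Bochner_Integration.integrable_bound[OF in_Lp_integrable[OF ds]])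
        have "(\<xi> x)\<^sup>2 \<le> 1" for x using \<eta>(2)[of "x - x0"] by (simp add: abs_square_le_1 \<xi>_def)
        then show "AE x in lebesgue. norm ((\<xi> x)\<^sup>2 * norm (\<sigma>' (x + h) - \<sigma>' x) powr p) \<le> norm (norm (\<sigma>' (x + h) - \<sigma>' x) powr p)"
          by (auto intro!: mult_left_le_one_le)
      qed measurable
      show "integrable lebesgue (\<lambda>x. norm (if x \<in> ?B then norm (\<sigma>' (x + h) - \<sigma>' x) powr p else 0))"
        using in_Lp_integrable[OF in_Lp_lebesgue_subset(1)[OF Bm(2) pq(2) ds]]
          Lebesgue_Measure.integrable_restrict_UNIV[OF Bm(2), of "\<lambda>x. norm (\<sigma>' (x + h) - \<sigma>' x) powr p"]
        by (intro integrable_norm) simp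
      show "norm (if x \<in> ?B then norm (\<sigma>' (x + h) - \<sigma>' x) powr p else 0) \<le> (\<xi> x)\<^sup>2 * norm (\<sigma>' (x + h) - \<sigma>' x) powr p" for x
        using \<eta>(3)[of "x - x0"] by (auto simp: \<xi>_def dist_norm norm_minus_commute)
    qed
    also note E
    finally show ?thesis .
  next
    case False
    let ?s = "zero_ext ?B' \<sigma>"
    have sB: "in_Lp (lebesgue_on ?B') p \<sigma>" by (rule in_Lp_subset(1)[OF Bm(1) \<Omega>_sets sub pq(2) \<sigma>_Lp])
    then have s: "in_Lp lebesgue p ?s" using in_Lp_zero_ext(1)[OF Bm(1) pq(2), of \<sigma>] by simp
    have aeB: "AE x in lebesgue_on ?B'. \<sigma> x = flux (D u x)"
      using uW(2) unfolding AE_lebesgue_on_iff[OF Bm(1)] AE_lebesgue_on_iff[OF \<Omega>_sets] by eventually_elim (use sub in auto)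
    have sN: "(\<integral>x. norm (\<sigma> x) powr p \<partial>lebesgue_on ?B') \<le> N powr q"
      unfolding Nq
    proof (rule integral_mono_AE[OF in_Lp_integrable[OF sB] in_Lp_integrable[OF DuB]])
      show "AE x in lebesgue_on ?B'. norm (\<sigma> x) powr p \<le> norm (D u x) powr q"
        using aeB by eventually_elim (simp add: norm_flux_powr_le)
    qed
    have "?lhs = (\<integral>x. norm (?s (x + h) - ?s x) powr p \<partial>lebesgue_on ?B)"
      by (rule Bochner_Integration.integral_cong) (use inB' in \<open>auto simp: space_restrict_space\<close>)
    also have "\<dots> \<le> (\<integral>x. norm (?s (x + h) - ?s x) powr p \<partial>lebesgue)"
      by (rule in_Lp_lebesgue_subset(2)[OF Bm(2) pq(2) in_Lp_translate_diff[OF pq(1) s]])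
    also have "\<dots> \<le> 2 powr (p - 1) * ((\<integral>x. norm (?s (x + h)) powr p \<partial>lebesgue) + (\<integral>x. norm (?s x) powr p \<partial>lebesgue))"
      by (rule integral_norm_diff_powr_le[OF pq(1) in_Lp_translate[OF s] s])
    also have "(\<integral>x. norm (?s (x + h)) powr p \<partial>lebesgue) = (\<integral>x. norm (?s x) powr p \<partial>lebesgue)"
      by (rule lebesgue_translate(2)[OF borel_measurable_integrable[OF in_Lp_integrable[OF s]]])
    also have "(\<integral>x. norm (?s x) powr p \<partial>lebesgue) = (\<integral>x. norm (\<sigma> x) powr p \<partial>lebesgue_on ?B')"
      by (rule in_Lp_zero_ext(2)[OF Bm(1) pq(2)])
    also have "2 powr (p - 1) * ((\<integral>x. norm (\<sigma> x) powr p \<partial>lebesgue_on ?B') + (\<integral>x. norm (\<sigma> x) powr p \<partial>lebesgue_on ?B'))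
        = 2 powr p * (\<integral>x. norm (\<sigma> x) powr p \<partial>lebesgue_on ?B')" by (simp add: powr_diff)
    also have "\<dots> \<le> 2 powr p * (N powr q * norm h powr shift_exponent)"
    proof (rule mult_left_mono)
      have "1 powr shift_exponent \<le> norm h powr shift_exponent" using False shift_exponent(1) by (intro powr_mono2) auto
      then have "N powr q * 1 \<le> N powr q * norm h powr shift_exponent" by (intro mult_left_mono) auto
      with sN show "(\<integral>x. norm (\<sigma> x) powr p \<partial>lebesgue_on ?B') \<le> N powr q * norm h powr shift_exponent" by simp
    qed simp
    also have "\<dots> \<le> ball_const L * (A * N * norm h + N powr q * norm h powr shift_exponent)"
      unfolding ball_const_def using A0 N0 mono_const_pos young_const_pos by (intro mult_mono) (auto intro!: add_nonneg_nonneg mult_nonneg_nonneg)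
    finally show ?thesis .
  qed
qed

lemma norm_Lp_cutoff_difference_le:
  assumes U: "open U" and \<xi>: "\<xi> \<in> borel_measurable lebesgue" "\<And>x. \<bar>\<xi> x\<bar> \<le> 1" "\<And>x. x \<notin> U \<Longrightarrow> \<xi> x = 0"
    and sub: "\<And>x. x \<in> U \<Longrightarrow> x \<in> \<Omega> \<and> x + h \<in> \<Omega>"
  shows "norm_Lp lebesgue p (\<lambda>x. \<xi> x * (f' (x + h) - f' x)) \<le> norm_Lp (lebesgue_on U) p (\<lambda>x. f (x + h) - f x)"
    and "in_Lp (lebesgue_on U) p (\<lambda>x. f (x + h) - f x)"
proof -
  have pq: "p \<ge> 1" "p > 0" using p_gt_2 by auto
  have Um: "U \<in> sets lebesgue" using U by auto
  have d: "in_Lp lebesgue p (\<lambda>x. f' (x + h) - f' x)" by (rule in_Lp_translate_diff[OF pq(1) zero_ext_Lp(2)])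
  note dU = in_Lp_lebesgue_subset(1)[OF Um pq(2) d]
  have eq: "f' (x + h) - f' x = f (x + h) - f x" if "x \<in> U" for x using sub[OF that] by simp
  show L: "in_Lp (lebesgue_on U) p (\<lambda>x. f (x + h) - f x)"
  proof (rule in_Lp_cong_AE[OF dU])
    have ae: "AE x in lebesgue. x \<in> U \<longrightarrow> f' (x + h) - f' x = f (x + h) - f x" using eq by auto
    show "(\<lambda>x. f (x + h) - f x) \<in> borel_measurable (lebesgue_on U)"
      by (rule measurable_lebesgue_on_AE[OF Um in_Lp_measurable[OF dU] ae])
    show "AE x in lebesgue_on U. f' (x + h) - f' x = f (x + h) - f x" using ae by (simp only: AE_lebesgue_on_iff[OF Um])
  qed
  note [measurable] = \<xi>(1) in_Lp_measurable[OF d]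
  have x: "in_Lp lebesgue p (\<lambda>x. \<xi> x * (f' (x + h) - f' x))"
    by (rule in_Lp_bound[OF pq(2) d, where C = 1]) (use \<xi>(2) in \<open>auto simp: abs_mult mult_left_le_one_le\<close>)
  have "(\<integral>x. norm (\<xi> x * (f' (x + h) - f' x)) powr p \<partial>lebesgue) = (\<integral>x. norm (\<xi> x * (f' (x + h) - f' x)) powr p \<partial>lebesgue_on U)"
    by (rule integral_lebesgue_on_support(1)[OF Um, symmetric]) (simp add: \<xi>(3))
  also have "\<dots> \<le> (\<integral>x. norm (f (x + h) - f x) powr p \<partial>lebesgue_on U)"
  proof (rule integral_mono[OF in_Lp_integrable[OF in_Lp_lebesgue_subset(1)[OF Um pq(2) x]] in_Lp_integrable[OF L]])
    fix x assume "x \<in> space (lebesgue_on U)"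
    then have "x \<in> U" by (simp add: space_restrict_space)
    then show "norm (\<xi> x * (f' (x + h) - f' x)) powr p \<le> norm (f (x + h) - f x) powr p"
      unfolding eq[OF \<open>x \<in> U\<close>] using \<xi>(2)[of x] pq by (intro powr_mono2) (auto simp: abs_mult mult_left_le_one_le)
  qed
  finally show "norm_Lp lebesgue p (\<lambda>x. \<xi> x * (f' (x + h) - f' x)) \<le> norm_Lp (lebesgue_on U) p (\<lambda>x. f (x + h) - f x)"
    unfolding norm_Lp_def using pq by (intro powr_mono2) auto
qed

lemma W1_loc_ball_difference:
  assumes f: "f \<in> W1_loc p \<Omega>" and R: "R > 0" and r0: "norm h \<le> r0" "r0 > 0" and sub: "cball x0 (R + r0) \<subseteq> \<Omega>"
  shows "norm_Lp (lebesgue_on (ball x0 R)) p (\<lambda>x. f (x + h) - f x) \<le> norm h * norm_Lp (lebesgue_on (ball x0 (R + r0))) p (D f)"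
proof -
  have p1: "p > 1" "p > 0" using p_gt_2 by auto
  obtain G where G: "has_weak_gradient \<Omega> f G" "\<And>K. compact K \<Longrightarrow> K \<subseteq> \<Omega> \<Longrightarrow> G \<in> Lp p K"
    using f by (auto simp: W1_loc_def)
  let ?B' = "ball x0 (R + r0)"
  have B': "?B' \<subseteq> \<Omega>" "?B' \<in> sets lebesgue" using sub ball_subset_cball by (blast, simp)
  have "in_Lp (lebesgue_on (cball x0 (R + r0))) p G" using G(2)[OF compact_cball sub] by (simp add: Lp_iff)
  then have "in_Lp (lebesgue_on (cball x0 (R + r0))) p (D f)"
    by (intro in_Lp_weak_gradient[OF open_\<Omega> G(1) _ sub]) auto
  then have Df: "in_Lp (lebesgue_on ?B') p (D f)"
    by (rule in_Lp_subset(1)[rotated -1]) (use p1 in auto)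
  have "(\<integral>x. \<bar>f (x + h) - f x\<bar> powr p \<partial>lebesgue_on (ball x0 R)) \<le> norm h powr p * (\<integral>x. norm (D f x) powr p \<partial>lebesgue_on ?B')"
    by (rule difference_quotient_bound(2)[OF open_\<Omega> weak_gradient_eq(1)[OF open_\<Omega> G(1)] B' bounded_ball p1(1) Df open_ball ball_segment[OF _ _ _ r0(1)]])
  then have "norm_Lp (lebesgue_on (ball x0 R)) p (\<lambda>x. f (x + h) - f x) \<le> (norm h powr p * (\<integral>x. norm (D f x) powr p \<partial>lebesgue_on ?B')) powr (1 / p)"
    unfolding norm_Lp_def using p1 by (intro powr_mono2) auto
  also have "\<dots> = norm h * norm_Lp (lebesgue_on ?B') p (D f)" using p1 by (simp add: powr_mult powr_powr norm_Lp_def)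
  finally show ?thesis .
qed

text \<open>A cutoff equal to \<open>1\<close> on the larger ball shows that the quotients of \<open>f\<close> on it are bounded, so
  that its Besov seminorm is a genuine supremum and dominates each of them.\<close>

lemma besov_ball_difference:
  assumes f: "f \<in> besov_loc \<alpha> p \<Omega>" and R: "R > 0" and r0: "norm h \<le> r0" "r0 > 0" "R + r0 < \<rho>" and sub: "cball x0 \<rho> \<subseteq> \<Omega>"
  shows "norm_Lp (lebesgue_on (ball x0 R)) p (\<lambda>x. f (x + h) - f x) \<le> norm h powr \<alpha> * besov_norm \<alpha> p (ball x0 (R + r0)) f"
    and "0 \<le> besov_norm \<alpha> p (ball x0 (R + r0)) f"
proof -
  have p1: "p \<ge> 1" "p > 0" using p_gt_2 by auto
  let ?B' = "ball x0 (R + r0)"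
  have "0 < R + r0" using R r0 by simp
  then obtain \<theta> :: "real^'n \<Rightarrow> real" where \<theta>: "smooth \<theta>" "\<And>x. norm x \<le> R + r0 \<Longrightarrow> \<theta> x = 1" "\<And>x. \<rho> \<le> norm x \<Longrightarrow> \<theta> x = 0"
    using ball_cutoff[OF _ r0(3)] by metis
  let ?\<theta> = "\<lambda>x. \<theta> (x - x0)"
  have \<theta>t: "?\<theta> \<in> test_function \<Omega>"
  proof (rule test_functionI[OF _ compact_cball _ sub])
    show "smooth ?\<theta>" using smooth_translate[OF \<theta>(1), of "- x0"] by simp
    show "?\<theta> x = 0" if "x \<notin> cball x0 \<rho>" for x using that by (intro \<theta>(3)) (simp add: dist_norm norm_minus_commute)
  qed
  have \<theta>1: "?\<theta> x = 1" if "x \<in> ?B'" for x using that by (intro \<theta>(2)) (simp add: dist_norm norm_minus_commute)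
  let ?v = "\<lambda>x. ?\<theta> x * f x"
  have "?v \<in> besov \<alpha> p" using f \<theta>t by (auto simp: besov_loc_def)
  then obtain S where v: "in_Lp lebesgue p ?v" and S: "\<And>h. h \<noteq> 0 \<Longrightarrow> (\<integral>x. \<bar>?v (x + h) - ?v x\<bar> powr p \<partial>lebesgue) \<le> S * norm h powr (\<alpha> * p)"
    unfolding in_besov_iff[OF p1(2)] by blast
  define W where "W h = {x \<in> ?B'. x + h \<in> ?B'}" for h
  have Wo: "open (W h)" for h
  proof -
    have "W h = ?B' \<inter> (\<lambda>x. x + h) -` ?B'" by (auto simp: W_def)
    moreover have "open ((\<lambda>x. x + h) -` ?B')" by (intro open_vimage continuous_intros open_ball)
    ultimately show ?thesis by auto
  qed
  have Wm: "W h \<in> sets lebesgue" for h using Wo[of h] by auto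
  define Q where "Q h = (\<integral>x. \<bar>f (x + h) - f x\<bar> powr p \<partial>lebesgue_on (W h))" for h
  have Qnn: "0 \<le> Q h" for h by (simp add: Q_def)
  have eqW: "?v (x + h) - ?v x = f (x + h) - f x" if "x \<in> W h" for x h using that \<theta>1[of x] \<theta>1[of "x + h"] by (simp add: W_def)
  have quot: "besov_quotient \<alpha> p ?B' f h = (Q h / norm h powr (\<alpha> * p)) powr (1 / p)" for h
    unfolding besov_quotient_def Q_def W_def by simp
  have QS: "Q h \<le> S * norm h powr (\<alpha> * p)" if "h \<noteq> 0" for h
  proof -
    have "Q h = (\<integral>x. norm (?v (x + h) - ?v x) powr p \<partial>lebesgue_on (W h))"
      unfolding Q_def by (rule Bochner_Integration.integral_cong) (use eqW in \<open>auto simp: space_restrict_space\<close>)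
    also have "\<dots> \<le> (\<integral>x. norm (?v (x + h) - ?v x) powr p \<partial>lebesgue)"
      by (rule in_Lp_lebesgue_subset(2)[OF Wm p1(2) in_Lp_translate_diff[OF p1(1) v]])
    also have "\<dots> \<le> S * norm h powr (\<alpha> * p)" using S[OF that] by simp
    finally show ?thesis .
  qed
  have bdd: "bdd_above (besov_quotient \<alpha> p ?B' f ` (UNIV - {0}))"
  proof (rule bdd_aboveI2[where M = "S powr (1 / p)"])
    fix h :: "real^'n" assume "h \<in> UNIV - {0}"
    then have "h \<noteq> 0" by simp
    then show "besov_quotient \<alpha> p ?B' f h \<le> S powr (1 / p)"
      unfolding quot using QS[of h] Qnn[of h] p1 by (intro powr_mono2) (auto simp: divide_le_eq)
  qed
  have semi: "besov_quotient \<alpha> p ?B' f h \<le> besov_seminorm \<alpha> p ?B' f" if "h \<noteq> 0" for h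
    unfolding besov_seminorm_def by (rule cSUP_upper[OF _ bdd]) (use that in simp)
  \<comment> \<open>some nonzero shift, whose quotient shows that the supremum is nonnegative\<close>
  have "axis undefined 1 \<noteq> (0 :: real^'n)" by simp
  from semi[OF this] have semi0: "0 \<le> besov_seminorm \<alpha> p ?B' f" by (rule order_trans[rotated]) (simp add: quot)
  have LpN: "0 \<le> Lp_norm p ?B' f" by (simp add: Lp_norm_eq)
  show nn: "0 \<le> besov_norm \<alpha> p ?B' f" using semi0 LpN by (simp add: besov_norm_def)
  show "norm_Lp (lebesgue_on (ball x0 R)) p (\<lambda>x. f (x + h) - f x) \<le> norm h powr \<alpha> * besov_norm \<alpha> p ?B' f"
  proof (cases "h = 0")
    case True
    then show ?thesis using p1 by (simp add: norm_Lp_def)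
  next
    case False
    have sW: "ball x0 R \<subseteq> W h"
    proof
      fix x assume "x \<in> ball x0 R"
      then show "x \<in> W h" using r0 norm_triangle_ineq[of "x - x0" h]
        by (auto simp: W_def dist_norm norm_minus_commute algebra_simps)
    qed
    have fW: "in_Lp (lebesgue_on (W h)) p (\<lambda>x. f (x + h) - f x)"
    proof (rule norm_Lp_cutoff_difference_le(2)[OF Wo, of "\<lambda>x. 0"])
      show "x \<in> \<Omega> \<and> x + h \<in> \<Omega>" if "x \<in> W h" for x
        using that sub r0(3) by (auto simp: W_def subset_iff)
    qed auto
    have "(\<integral>x. norm (f (x + h) - f x) powr p \<partial>lebesgue_on (ball x0 R)) \<le> Q h"
      using in_Lp_subset(2)[OF _ Wm sW p1(2) fW] by (simp add: Q_def)
    then have "norm_Lp (lebesgue_on (ball x0 R)) p (\<lambda>x. f (x + h) - f x) \<le> Q h powr (1 / p)"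
      unfolding norm_Lp_def using p1 by (intro powr_mono2) auto
    also have "\<dots> = norm h powr \<alpha> * besov_quotient \<alpha> p ?B' f h"
      using False p1 Qnn[of h] by (simp add: quot powr_divide powr_powr)
    also have "\<dots> \<le> norm h powr \<alpha> * besov_norm \<alpha> p ?B' f"
      using semi[OF False] LpN by (intro mult_left_mono) (auto simp: besov_norm_def)
    finally show ?thesis .
  qed
qed

lemma shift_estimate:
  fixes \<eta> :: "real^'n \<Rightarrow> real"
  assumes u: "P2_solution q \<Omega> f u" and R: "R > 0" and cl: "closure (ball x0 R) \<subseteq> \<Omega>"
    and r0: "0 < r0" "\<bar>h\<bar> \<le> r0" "r0 < setdist (ball x0 R) (frontier \<Omega>) / 2"
    and \<eta>: "smooth \<eta>" "\<And>x. \<bar>\<eta> x\<bar> \<le> 1" "\<And>x. norm x \<le> R / 2 \<Longrightarrow> \<eta> x = 1" "\<And>x. 3 * R / 4 < norm x \<Longrightarrow> \<eta> x = 0"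
      "\<And>x. norm (grad \<eta> x) \<le> L"
  defines "B' \<equiv> ball x0 R + ball 0 r0"
  shows "f \<in> W1_loc p \<Omega> \<Longrightarrow> (\<integral>x. norm (shift s h \<sigma> x - \<sigma> x) powr p \<partial>lebesgue_on (ball x0 (R / 2)))
      \<le> ball_const L * (Lp_norm p B' (D f) * Lp_norm q B' (D u) * \<bar>h\<bar> powr 2 + Lp_norm q B' (D u) powr q * \<bar>h\<bar> powr (2 / (3 - q)))"
    and "f \<in> besov_loc \<alpha> p \<Omega> \<Longrightarrow> (\<integral>x. norm (shift s h \<sigma> x - \<sigma> x) powr p \<partial>lebesgue_on (ball x0 (R / 2)))
      \<le> ball_const L * (besov_norm \<alpha> p B' f * Lp_norm q B' (D u) * \<bar>h\<bar> powr (\<alpha> + 1) + Lp_norm q B' (D u) powr q * \<bar>h\<bar> powr (2 / (3 - q)))"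
proof -
  let ?h = "h *\<^sub>R axis s 1 :: real^'n"
  have nh: "norm ?h = \<bar>h\<bar>" by simp
  have B': "B' = ball x0 (R + r0)" unfolding B'_def by (rule ball_plus_ball[OF R r0(1)])
  \<comment> \<open>radius \<open>R + 2 * r0\<close> leaves room for a cutoff that is \<open>1\<close> on the ball of radius \<open>R + r0\<close>\<close>
  have big: "cball x0 (R + 2 * r0) \<subseteq> \<Omega>"
    by (rule cball_subset_of_setdist[OF open_\<Omega> cl R]) (use r0 in auto)
  have mid: "cball x0 (R + r0) \<subseteq> \<Omega>" using big subset_cball[of "R + r0" "R + 2 * r0" x0] r0 by simp
  have sub: "ball x0 (R + r0) \<subseteq> \<Omega>" using mid ball_subset_cball by blast
  have hr: "norm ?h \<le> r0" using r0 nh by simp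
  have s\<xi>: "smooth (\<lambda>x. \<eta> (x - x0))" using smooth_translate[OF \<eta>(1), of "- x0"] by simp
  have cut: "norm_Lp lebesgue p (\<lambda>x. \<eta> (x - x0) * (f' (x + ?h) - f' x)) \<le> norm_Lp (lebesgue_on (ball x0 R)) p (\<lambda>x. f (x + ?h) - f x)"
  proof (rule norm_Lp_cutoff_difference_le(1)[OF open_ball])
    show "(\<lambda>x. \<eta> (x - x0)) \<in> borel_measurable lebesgue"
      by (rule smooth_borel_measurable[OF s\<xi>])
    show "\<bar>\<eta> (x - x0)\<bar> \<le> 1" for x by (rule \<eta>(2))
    show "\<eta> (x - x0) = 0" if "x \<notin> ball x0 R" for x using that R by (intro \<eta>(4)) (simp add: dist_norm norm_minus_commute)
    show "x \<in> \<Omega> \<and> x + ?h \<in> \<Omega>" if "x \<in> ball x0 R" for x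
    proof -
      have "x \<in> ball x0 (R + r0)" using that r0 by simp
      moreover have "x + ?h \<in> ball x0 (R + r0)"
        using that hr norm_triangle_ineq[of "x - x0" ?h] by (simp add: dist_norm norm_minus_commute algebra_simps)
      ultimately show ?thesis using sub by blast
    qed
  qed
  have sh: "(\<integral>x. norm (shift s h \<sigma> x - \<sigma> x) powr p \<partial>lebesgue_on (ball x0 (R / 2))) = (\<integral>x. norm (\<sigma> (x + ?h) - \<sigma> x) powr p \<partial>lebesgue_on (ball x0 (R / 2)))"
    by (simp add: shift_def)
  have hpow: "\<bar>h\<bar> powr a * \<bar>h\<bar> = \<bar>h\<bar> powr (a + 1)" for a
    using powr_mult_self[of "\<bar>h\<bar>" "a + 1"] by (simp add: mult.commute)
  {
    assume f: "f \<in> W1_loc p \<Omega>"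
    have A: "norm_Lp lebesgue p (\<lambda>x. \<eta> (x - x0) * (f' (x + ?h) - f' x)) \<le> \<bar>h\<bar> * Lp_norm p B' (D f)"
      using order_trans[OF cut W1_loc_ball_difference[OF f R hr r0(1) mid]] unfolding nh by (simp add: B' Lp_norm_eq)
    have e: "\<bar>h\<bar> * Lp_norm p B' (D f) * Lp_norm q B' (D u) * \<bar>h\<bar> = Lp_norm p B' (D f) * Lp_norm q B' (D u) * \<bar>h\<bar> powr 2"
      using hpow[of 1] by (simp add: power2_eq_square)
    show "(\<integral>x. norm (shift s h \<sigma> x - \<sigma> x) powr p \<partial>lebesgue_on (ball x0 (R / 2)))
      \<le> ball_const L * (Lp_norm p B' (D f) * Lp_norm q B' (D u) * \<bar>h\<bar> powr 2 + Lp_norm q B' (D u) powr q * \<bar>h\<bar> powr (2 / (3 - q)))"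
      unfolding e[symmetric] sh using ball_estimate[OF u R hr r0(1) sub \<eta> A]
      by (simp only: nh shift_exponent_def B' Lp_norm_eq)
  next
    assume f: "f \<in> besov_loc \<alpha> p \<Omega>"
    have "R + r0 < R + 2 * r0" using r0 by simp
    note bd = besov_ball_difference[OF f R hr r0(1) this big]
    have A: "norm_Lp lebesgue p (\<lambda>x. \<eta> (x - x0) * (f' (x + ?h) - f' x)) \<le> \<bar>h\<bar> powr \<alpha> * besov_norm \<alpha> p B' f"
      using order_trans[OF cut bd(1)] unfolding nh B' .
    have e: "\<bar>h\<bar> powr \<alpha> * besov_norm \<alpha> p B' f * Lp_norm q B' (D u) * \<bar>h\<bar> = besov_norm \<alpha> p B' f * Lp_norm q B' (D u) * \<bar>h\<bar> powr (\<alpha> + 1)"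
      unfolding hpow[symmetric] by simp
    show "(\<integral>x. norm (shift s h \<sigma> x - \<sigma> x) powr p \<partial>lebesgue_on (ball x0 (R / 2)))
      \<le> ball_const L * (besov_norm \<alpha> p B' f * Lp_norm q B' (D u) * \<bar>h\<bar> powr (\<alpha> + 1) + Lp_norm q B' (D u) powr q * \<bar>h\<bar> powr (2 / (3 - q)))"
      unfolding e[symmetric] sh using ball_estimate[OF u R hr r0(1) sub \<eta> A]
      by (simp only: nh shift_exponent_def B' Lp_norm_eq)
  }
qed

end

theorem theorem1p2:
  fixes q p :: real
  assumes n: "CARD('n::finite) \<ge> 2"
    and q: "1 < q" "q < 2"
    and p: "p = q / (q - 1)"
  shows "\<exists>C1 C2 :: real \<Rightarrow> real. (\<forall>R>0. C1 R > 0 \<and> C2 R > 0) \<and>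
    (\<forall>(\<alpha>::real) (\<Omega>::(real^'n) set) (f::real^'n \<Rightarrow> real) (\<sigma>0::real^'n \<Rightarrow> real^'n).
       0 < \<alpha> \<and> \<alpha> < 1 \<and>
       bounded \<Omega> \<and> connected \<Omega> \<and> open \<Omega> \<and> lipschitz_boundary \<Omega> \<and>
       f \<in> Lp p \<Omega> \<and> (\<integral>x. f x \<partial>lebesgue_on \<Omega>) = 0 \<and>
       P1_solution q \<Omega> f \<sigma>0
       \<longrightarrow>
       (f \<in> W1_loc p \<Omega> \<longrightarrow> \<sigma>0 \<in> besov_loc_vec (2 / (p * (3 - q))) p \<Omega>) \<and>
       (f \<in> besov_loc \<alpha> p \<Omega> \<longrightarrow>
          \<sigma>0 \<in> besov_loc_vec (min ((\<alpha> + 1) / p) (2 / (p * (3 - q)))) p \<Omega>) \<and>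
       (f \<in> W1_loc p \<Omega> \<longrightarrow>
          (\<forall>u x0 R r0. \<forall>s::'n. \<forall>h.
             P2_solution q \<Omega> f u \<and> R > 0 \<and> closure (ball x0 R) \<subseteq> \<Omega> \<and>
             0 < r0 \<and> \<bar>h\<bar> \<le> r0 \<and> r0 < setdist (ball x0 R) (frontier \<Omega>) / 2 \<longrightarrow>
             (let B' = ball x0 R + ball 0 r0; grad_u = weak_gradient \<Omega> u in
              (\<integral>x. norm (shift s h \<sigma>0 x - \<sigma>0 x) powr p \<partial>lebesgue_on (ball x0 (R / 2)))
              \<le> C1 R * (Lp_norm p B' (weak_gradient \<Omega> f) * Lp_norm q B' grad_u * \<bar>h\<bar> powr 2
                        + Lp_norm q B' grad_u powr q * \<bar>h\<bar> powr (2 / (3 - q)))))) \<and>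
       (f \<in> besov_loc \<alpha> p \<Omega> \<longrightarrow>
          (\<forall>u x0 R r0. \<forall>s::'n. \<forall>h.
             P2_solution q \<Omega> f u \<and> R > 0 \<and> closure (ball x0 R) \<subseteq> \<Omega> \<and>
             0 < r0 \<and> \<bar>h\<bar> \<le> r0 \<and> r0 < setdist (ball x0 R) (frontier \<Omega>) / 2 \<longrightarrow>
             (let B' = ball x0 R + ball 0 r0; grad_u = weak_gradient \<Omega> u in
              (\<integral>x. norm (shift s h \<sigma>0 x - \<sigma>0 x) powr p \<partial>lebesgue_on (ball x0 (R / 2)))
              \<le> C2 R * (besov_norm \<alpha> p B' f * Lp_norm q B' grad_u * \<bar>h\<bar> powr (\<alpha> + 1)
                        + Lp_norm q B' grad_u powr q * \<bar>h\<bar> powr (2 / (3 - q)))))))"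
proof -
  interpret exponents p q using q p by unfold_locales
  have "\<forall>R. \<exists>L. R > 0 \<longrightarrow> (\<exists>\<eta> :: real^'n \<Rightarrow> real. smooth \<eta> \<and> (\<forall>x. \<bar>\<eta> x\<bar> \<le> 1) \<and> (\<forall>x. norm x \<le> R / 2 \<longrightarrow> \<eta> x = 1)
    \<and> (\<forall>x. 3 * R / 4 < norm x \<longrightarrow> \<eta> x = 0) \<and> (\<forall>x. norm (grad \<eta> x) \<le> L))"
    using cutoff_exists by blast
  then obtain L where L: "\<And>R. R > 0 \<Longrightarrow> \<exists>\<eta> :: real^'n \<Rightarrow> real. smooth \<eta> \<and> (\<forall>x. \<bar>\<eta> x\<bar> \<le> 1) \<and> (\<forall>x. norm x \<le> R / 2 \<longrightarrow> \<eta> x = 1)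
    \<and> (\<forall>x. 3 * R / 4 < norm x \<longrightarrow> \<eta> x = 0) \<and> (\<forall>x. norm (grad \<eta> x) \<le> L R)"
    by metis
  \<comment> \<open>the constants depend on \<open>R\<close> through the gradient bound of the cutoff\<close>
  show ?thesis
  proof (intro exI[of _ "\<lambda>R. ball_const (L R)"] conjI allI impI)
    show "ball_const (L R) > 0" for R by (rule ball_const_pos)
    show "ball_const (L R) > 0" for R by (rule ball_const_pos)
    fix \<alpha> :: real and \<Omega> :: "(real^'n) set" and f \<sigma>0
    assume hyp: "0 < \<alpha> \<and> \<alpha> < 1 \<and> bounded \<Omega> \<and> connected \<Omega> \<and> open \<Omega> \<and> lipschitz_boundary \<Omega> \<and>
       f \<in> Lp p \<Omega> \<and> (\<integral>x. f x \<partial>lebesgue_on \<Omega>) = 0 \<and> P1_solution q \<Omega> f \<sigma>0"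
    interpret variational p q \<Omega> f \<sigma>0 using hyp by unfold_locales auto
    show "\<sigma>0 \<in> besov_loc_vec (2 / (p * (3 - q))) p \<Omega>" if "f \<in> W1_loc p \<Omega>"
      by (rule flux_besov_of_W1_loc[OF that])
    show "\<sigma>0 \<in> besov_loc_vec (min ((\<alpha> + 1) / p) (2 / (p * (3 - q)))) p \<Omega>" if "f \<in> besov_loc \<alpha> p \<Omega>"
      using flux_besov_of_besov_loc[OF that] hyp by blast
    fix u x0 R r0 and s :: 'n and h
    assume a: "P2_solution q \<Omega> f u \<and> R > 0 \<and> closure (ball x0 R) \<subseteq> \<Omega> \<and>
             0 < r0 \<and> \<bar>h\<bar> \<le> r0 \<and> r0 < setdist (ball x0 R) (frontier \<Omega>) / 2"
    then obtain \<eta> :: "real^'n \<Rightarrow> real" where \<eta>: "smooth \<eta>" "\<And>x. \<bar>\<eta> x\<bar> \<le> 1" "\<And>x. norm x \<le> R / 2 \<Longrightarrow> \<eta> x = 1"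
      "\<And>x. 3 * R / 4 < norm x \<Longrightarrow> \<eta> x = 0" "\<And>x. norm (grad \<eta> x) \<le> L R" using L[of R] by blast
    have a': "P2_solution q \<Omega> f u" "R > 0" "closure (ball x0 R) \<subseteq> \<Omega>" "0 < r0" "\<bar>h\<bar> \<le> r0"
      "r0 < setdist (ball x0 R) (frontier \<Omega>) / 2" using a by blast+
    show "let B' = ball x0 R + ball 0 r0; grad_u = weak_gradient \<Omega> u in
              (\<integral>x. norm (shift s h \<sigma>0 x - \<sigma>0 x) powr p \<partial>lebesgue_on (ball x0 (R / 2)))
              \<le> ball_const (L R) * (Lp_norm p B' (weak_gradient \<Omega> f) * Lp_norm q B' grad_u * \<bar>h\<bar> powr 2
                        + Lp_norm q B' grad_u powr q * \<bar>h\<bar> powr (2 / (3 - q)))" if "f \<in> W1_loc p \<Omega>"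
      unfolding Let_def by (rule shift_estimate(1)[OF a' \<eta> that])
    show "let B' = ball x0 R + ball 0 r0; grad_u = weak_gradient \<Omega> u in
              (\<integral>x. norm (shift s h \<sigma>0 x - \<sigma>0 x) powr p \<partial>lebesgue_on (ball x0 (R / 2)))
              \<le> ball_const (L R) * (besov_norm \<alpha> p B' f * Lp_norm q B' grad_u * \<bar>h\<bar> powr (\<alpha> + 1)
                        + Lp_norm q B' grad_u powr q * \<bar>h\<bar> powr (2 / (3 - q)))" if "f \<in> besov_loc \<alpha> p \<Omega>"
      unfolding Let_def by (rule shift_estimate(2)[OF a' \<eta> that])
  qed
qed

end
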